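(* Let $N\ge2$, $1<q\le2$, $\alpha\ge0$, $p>0$, $\beta>0$ and $M\in[0,+\infty]$. Consider the problem $$(P)\qquad\begin{cases}-\Delta z+\alpha z^p+\beta|\nabla z|^q=0&\text{in }\mathbb{R}^N_+,\\ z\ge0&\text{in }\mathbb{R}^N_+,\\ \lim_{\xi_1\to0^+}z(\xi_1,\xi')=M&\text{locally uniformly with respect to }\xi'.\end{cases}$$ (i) If $\alpha>0$, problem $(P)$ admits a unique solution $z$, and $z=z(\xi_1)$. (ii) If $\alpha=0$, any solution of $(P)$ is a function of the only variable $\xi_1$. In particular: (a) if $q=2$, then (necessarily) $M<\infty$ and $z\equiv M$; (b) if $q<2$ and $M<\infty$, then either $z\equiv M$ or there exists $l\in[0,M)$ such that $$z(\xi)=l+\int_{\xi_1}^{+\infty}\big[(q-1)s+c_{M,l}\big]^{-\frac1{q-1}}ds,$$ where $c_{M,l}$ is uniquely determined by the implicit relation $$\int_0^{+\infty}\big[(q-1)s+c_{M,l}\big]^{-\frac1{q-1}}ds=M-l;$$ while if $q<2$ and $M=+\infty$, then there exists $l\in[0,+\infty)$ such that $$z(\xi)=l+\int_{\xi_1}^{+\infty}\big[(q-1)s\big]^{-\frac1{q-1}}ds .$$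
   Context: $\mathbb{R}^N_+=\{\xi=(\xi_1,\xi')\in\mathbb{R}\times\mathbb{R}^{N-1}:\xi_1>0\}$. When $M=+\infty$ the boundary condition means that $z(\xi_1,\xi')\to+\infty$ as $\xi_1\to0^+$, locally uniformly in $\xi'\in\mathbb{R}^{N-1}$.
   Formalization: In (ii)(b) the printed integrands [(q-1)s+c] and [(q-1)s] solve the equation only when β=1; the formal statement uses [(q-1)βs+c_{M,l}] and [(q-1)βs] in the formulas for z and in the implicit relation, valid for all β>0 and identical to the printed ones when β=1. *)

theory Defs
  imports "HOL-Analysis.Analysis"
begin

text \<open>
  \<open>\<real>\<^sup>N\<close> is the type \<open>real \<times> (real^'m)\<close> with \<open>N = CARD('m) + 1\<close>, so that \<open>N \<ge> 2\<close> ranges over all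
  finite types \<open>'m\<close>; \<open>fst\<close> is the coordinate \<open>\<xi>\<^sub>1\<close> and \<open>snd\<close> is \<open>\<xi>'\<close>.
\<close>

definition half_space :: "(real \<times> (real^'m)) set" where
  "half_space = {\<xi>. 0 < fst \<xi>}"

definition partial_deriv :: "'a::euclidean_space \<Rightarrow> ('a \<Rightarrow> real) \<Rightarrow> 'a \<Rightarrow> real" where
  "partial_deriv b f x = frechet_derivative f (at x) b"

definition gradient :: "('a::euclidean_space \<Rightarrow> real) \<Rightarrow> 'a \<Rightarrow> 'a" where
  "gradient f x = (\<Sum>b\<in>Basis. partial_deriv b f x *\<^sub>R b)"

definition laplacian :: "('a::euclidean_space \<Rightarrow> real) \<Rightarrow> 'a \<Rightarrow> real" where
  "laplacian f x = (\<Sum>b\<in>Basis. partial_deriv b (partial_deriv b f) x)"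

text \<open>Twice continuously differentiable; meant for open \<open>S\<close>.\<close>

definition C2_on :: "'a::euclidean_space set \<Rightarrow> ('a \<Rightarrow> real) \<Rightarrow> bool" where
  "C2_on S f \<longleftrightarrow>
     f differentiable_on S \<and>
     (\<forall>b\<in>Basis. partial_deriv b f differentiable_on S) \<and>
     (\<forall>b\<in>Basis. \<forall>b'\<in>Basis. continuous_on S (partial_deriv b' (partial_deriv b f)))"

text \<open>Locally uniform convergence on \<open>real^'m\<close> is uniform convergence on compact sets.\<close>

definition boundary_limit :: "ennreal \<Rightarrow> (real \<times> (real^'m) \<Rightarrow> real) \<Rightarrow> bool" where
  "boundary_limit M z \<longleftrightarrow>
     (\<forall>K. compact K \<longrightarrow>
        (if M = \<infinity>
         then \<forall>A. \<forall>\<^sub>F t in at_right 0. \<forall>y\<in>K. A < z (t, y)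
         else uniform_limit K (\<lambda>t y. z (t, y)) (\<lambda>_. enn2real M) (at_right 0)))"

text \<open>
  Classical solutions of \<open>(P)\<close>. Since \<open>z\<close> is nonnegative and \<open>p, q > 0\<close>, \<open>powr\<close> agrees with the
  usual powers, also at \<open>0\<close>. Values of \<open>z\<close> outside the half space are irrelevant.
\<close>

definition solves_P ::
    "real \<Rightarrow> real \<Rightarrow> real \<Rightarrow> real \<Rightarrow> ennreal \<Rightarrow> (real \<times> (real^'m) \<Rightarrow> real) \<Rightarrow> bool" where
  "solves_P q \<alpha> p \<beta> M z \<longleftrightarrow>
     C2_on half_space z \<and>
     (\<forall>\<xi>\<in>half_space.
        - laplacian z \<xi> + \<alpha> * z \<xi> powr p + \<beta> * norm (gradient z \<xi>) powr q = 0) \<and>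
     (\<forall>\<xi>\<in>half_space. 0 \<le> z \<xi>) \<and>
     boundary_limit M z"

definition depends_only_on_first :: "(real \<times> (real^'m) \<Rightarrow> real) \<Rightarrow> bool" where
  "depends_only_on_first z \<longleftrightarrow> (\<exists>\<phi>. \<forall>\<xi>\<in>half_space. z \<xi> = \<phi> (fst \<xi>))"

text \<open>
  The function \<open>- z'\<close> for a decreasing solution of \<open>z'' = \<beta> \<bar>z'\<bar>\<^sup>q\<close> on the half line. The formula
  is often written for \<open>\<beta> = 1\<close>; for general \<open>\<beta>\<close> the equation forces the factor \<open>\<beta>\<close>.
\<close>

definition slope :: "real \<Rightarrow> real \<Rightarrow> real \<Rightarrow> real \<Rightarrow> real" where
  "slope q \<beta> c s = ((q - 1) * \<beta> * s + c) powr (- 1 / (q - 1))"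

text \<open>
  The implicit relation for \<open>c\<^bsub>M,l\<^esub>\<close>, with \<open>d = M - l\<close>. The condition \<open>c \<ge> 0\<close> says that the base of
  the power is positive for all \<open>s > 0\<close>.
\<close>

definition implicit_relation :: "real \<Rightarrow> real \<Rightarrow> real \<Rightarrow> real \<Rightarrow> bool" where
  "implicit_relation q \<beta> d c \<longleftrightarrow> 0 \<le> c \<and> (slope q \<beta> c has_integral d) {0..}"

end

theory Submission
  imports Defs
begin

text \<open>
  Everything is done by comparison, using only second-derivative tests at contact points. Barriers are
  \<open>f(\<xi>\<^sub>1) \<plusminus> U(\<xi>')\<close>: since the gradients of the two parts are orthogonal, no cross term appears, and a
  rescaled one-dimensional solution \<open>f(t) = c \<phi>(t / c)\<close> satisfies \<open>f'' = c\<^sup>-\<^sup>1 \<phi>''\<close> with \<open>f'(t) = \<phi>'(t / c)\<close>, which leaves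
  room for \<open>U\<close> when \<open>c \<noteq> 1\<close>. From above, \<open>U\<close> blows up on the boundary of a large ball (possible because
  \<open>q > 1\<close>); from below it grows slowly, and \<open>z \<ge> 0\<close> localizes. Letting \<open>c \<rightarrow> 1\<close> gives \<open>z = \<phi>(\<xi>\<^sub>1)\<close>.

  For \<open>\<alpha> > 0\<close> the absorption term forces \<open>z \<rightarrow> 0\<close> as \<open>\<xi>\<^sub>1 \<rightarrow> \<infinity>\<close>, and \<open>\<phi>\<close> comes from the phase plane. For
  \<open>\<alpha> = 0\<close> the behaviour at infinity is controlled by the interior bound \<open>\<bar>\<nabla>z\<bar> \<le> (C / \<xi>\<^sub>1)\<^bsup>1 / (q - 1)\<^esup>\<close>: if
  \<open>q < 2\<close> the oscillation of \<open>z\<close> on \<open>{\<xi>\<^sub>1 \<ge> A}\<close> tends to \<open>0\<close>, so \<open>z\<close> tends to its infimum \<open>l\<close>; if \<open>q = 2\<close> the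
  subsolutions \<open>L - ln (1 + \<sigma> \<xi>\<^sub>1) / (2 \<beta>)\<close> give \<open>z \<ge> L\<close> for every finite \<open>L \<le> M\<close>.
\<close>

section \<open>Second derivatives along coordinate directions\<close>

text \<open>Nothing is assumed about \<open>z\<close> as |\<xi>'| grows, and there is no boundary
  condition at \<xi>1 = \<infinity>. The first gap is closed by barriers whose radius is fixed by
  the tolerances alone, the second by decay estimates. As p may be less than 1, the absorption need
  not be Lipschitz at 0; only its monotonicity is used, and all strictness is bought with
  parameters: c \<noteq> 1 gives a multiplicative surplus, \<eta> is what the barrier may spend,
  \<epsilon> is the final error, and \<theta> is the share of the gradient term kept for the profile
  when bounding from above. If M = \<infinity>, both functions blow up at the boundary and cannot be
  compared there. The profile is shifted by \<delta>, its singularity lying inside the half space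
  for upper bounds and outside for lower ones. If \<alpha> = 0, adding a constant preserves the
  equation, so for q < 2 the level l has to be identified: it is the infimum of \<open>z\<close>.
  The lower bound must come first, because it keeps near-minimizers away from the boundary, and this
  is what makes the upper bound possible.\<close>

definition dir2 :: "('a::real_normed_vector \<Rightarrow> real) \<Rightarrow> 'a \<Rightarrow> 'a \<Rightarrow> real \<Rightarrow> real \<Rightarrow> bool" where
  "dir2 f b x d1 d2 \<longleftrightarrow> (\<exists>f'. (\<forall>\<^sub>F t in nhds 0. ((\<lambda>t. f (x + t *\<^sub>R b)) has_real_derivative f' t) (at t))
     \<and> f' 0 = d1 \<and> (f' has_real_derivative d2) (at 0))"

lemma dir2I:
  assumes "\<forall>\<^sub>F t in nhds 0. ((\<lambda>t. f (x + t *\<^sub>R b)) has_real_derivative f' t) (at t)"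
    and "f' 0 = d1" and "(f' has_real_derivative d2) (at 0)"
  shows "dir2 f b x d1 d2"
  using assms unfolding dir2_def by blast

lemma dir2_diff:
  assumes "dir2 f b x d1 d2" "dir2 g b x e1 e2"
  shows "dir2 (\<lambda>x. f x - g x) b x (d1 - e1) (d2 - e2)"
proof -
  obtain f' where f: "\<forall>\<^sub>F t in nhds 0. ((\<lambda>t. f (x + t *\<^sub>R b)) has_real_derivative f' t) (at t)"
    "f' 0 = d1" "(f' has_real_derivative d2) (at 0)"
    using assms(1) unfolding dir2_def by blast
  obtain g' where g: "\<forall>\<^sub>F t in nhds 0. ((\<lambda>t. g (x + t *\<^sub>R b)) has_real_derivative g' t) (at t)"
    "g' 0 = e1" "(g' has_real_derivative e2) (at 0)"
    using assms(2) unfolding dir2_def by blast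
  show ?thesis
  proof (rule dir2I)
    show "\<forall>\<^sub>F t in nhds 0. ((\<lambda>t. f (x + t *\<^sub>R b) - g (x + t *\<^sub>R b)) has_real_derivative f' t - g' t) (at t)"
      using f(1) g(1) by eventually_elim (rule DERIV_diff)
  qed (use f g in \<open>auto intro: DERIV_diff\<close>)
qed

text \<open>A positive second derivative at 0 makes \<open>u'\<close> positive just to the right,
  and the mean value theorem then pushes \<open>u\<close> above \<open>u 0\<close>. Only the
  derivative of \<open>u'\<close> at the single point 0 enters.\<close>

lemma second_derivative_test_max:
  fixes u :: "real \<Rightarrow> real"
  assumes d: "\<forall>\<^sub>F t in nhds 0. (u has_real_derivative u' t) (at t)"
    and d2: "(u' has_real_derivative D) (at 0)"
    and mx: "\<forall>\<^sub>F t in nhds 0. u t \<le> u 0"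
  shows "u' 0 = 0" "D \<le> 0"
proof -
  obtain e where e: "e > 0" "\<And>t. \<bar>t\<bar> < e \<Longrightarrow> (u has_real_derivative u' t) (at t) \<and> u t \<le> u 0"
    using eventually_conj[OF d mx] unfolding eventually_nhds_metric dist_real_def by auto
  show 0: "u' 0 = 0"
    by (rule DERIV_local_max[of u "u' 0" 0 e]) (use e in auto)
  show "D \<le> 0"
  proof (rule ccontr)
    assume "\<not> D \<le> 0"
    then obtain d where d: "d > 0" "\<And>h. 0 < h \<Longrightarrow> h < d \<Longrightarrow> u' 0 < u' (0 + h)"
      using DERIV_pos_inc_right[OF d2] by auto
    define t where "t = min d e / 2"
    have t: "0 < t" "t < d" "t < e" using d(1) e(1) by (auto simp: t_def)
    obtain s where s: "0 < s" "s < t" "u t - u 0 = (t - 0) * u' s"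
      using MVT2[OF t(1), of u u'] e(2) t by (smt (verit) abs_of_nonneg)
    have "u' s > 0" using d(2)[of s] s t 0 by simp
    hence "u t > u 0" using s t by (smt (verit) mult_pos_pos)
    thus False using e(2)[of t] t by simp
  qed
qed

text \<open>This test is why \<open>dir2\<close> speaks of lines only: a barrier needs derivatives
  along coordinate lines, not a Frechet derivative, and never has to be fed to
  \<open>partial_deriv\<close>.\<close>

lemma dir2_local_max:
  assumes f: "dir2 f b x d1 d2" and g: "dir2 g b x e1 e2"
    and mx: "\<forall>\<^sub>F y in nhds x. f y - g y \<le> f x - g x"
  shows "d1 = e1" "d2 \<le> e2"
proof -
  obtain u' where u: "\<forall>\<^sub>F t in nhds 0. ((\<lambda>t. f (x + t *\<^sub>R b) - g (x + t *\<^sub>R b)) has_real_derivative u' t) (at t)"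
    "u' 0 = d1 - e1" "(u' has_real_derivative (d2 - e2)) (at 0)"
    using dir2_diff[OF f g] unfolding dir2_def by blast
  have "((\<lambda>t. x + t *\<^sub>R b) \<longlongrightarrow> x + 0 *\<^sub>R b) (nhds 0)"
    by (intro tendsto_intros filterlim_ident)
  hence "filterlim (\<lambda>t. x + t *\<^sub>R b) (nhds x) (nhds 0)" by simp
  hence "\<forall>\<^sub>F t in nhds 0. f (x + t *\<^sub>R b) - g (x + t *\<^sub>R b) \<le> f x - g x"
    using mx by (rule eventually_compose_filterlim[rotated])
  hence "\<forall>\<^sub>F t in nhds 0. f (x + t *\<^sub>R b) - g (x + t *\<^sub>R b) \<le> f (x + 0 *\<^sub>R b) - g (x + 0 *\<^sub>R b)"
    by simp
  from second_derivative_test_max[OF u(1,3) this] u(2) show "d1 = e1" "d2 \<le> e2" by auto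
qed

section \<open>From Frechet derivatives to derivatives along coordinate lines\<close>

lemma differentiable_on_openD:
  "f differentiable_on S \<Longrightarrow> open S \<Longrightarrow> x \<in> S \<Longrightarrow> (f has_derivative frechet_derivative f (at x)) (at x)"
  by (metis at_within_open differentiable_on_def frechet_derivative_works)

lemma partial_deriv_along:
  assumes "f differentiable_on S" "open S" "x \<in> S"
  shows "((\<lambda>t. f (x + t *\<^sub>R b)) has_real_derivative partial_deriv b f x) (at 0)"
proof -
  have "(f has_derivative frechet_derivative f (at x)) (at (x + 0 *\<^sub>R b))"
    using differentiable_on_openD[OF assms] by simp
  moreover have "((\<lambda>t. x + t *\<^sub>R b) has_derivative (\<lambda>t. t *\<^sub>R b)) (at 0)"
    by (auto intro!: derivative_eq_intros)
  ultimately have "((\<lambda>t. f (x + t *\<^sub>R b)) has_derivative (\<lambda>t. frechet_derivative f (at x) (t *\<^sub>R b))) (at 0)"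
    by (rule has_derivative_compose[rotated])
  moreover have "linear (frechet_derivative f (at x))"
    using differentiable_on_openD[OF assms] has_derivative_linear by blast
  ultimately show ?thesis
    by (simp add: has_field_derivative_def partial_deriv_def linear_scale mult.commute[of _ "frechet_derivative f (at x) b"])
qed

lemma partial_deriv_along_at:
  assumes "f differentiable_on S" "open S" "x + t *\<^sub>R b \<in> S"
  shows "((\<lambda>t. f (x + t *\<^sub>R b)) has_real_derivative partial_deriv b f (x + t *\<^sub>R b)) (at t)"
proof -
  have "((\<lambda>h. f ((x + t *\<^sub>R b) + h *\<^sub>R b)) has_real_derivative partial_deriv b f (x + t *\<^sub>R b)) (at 0)"
    by (rule partial_deriv_along[OF assms])
  hence "((\<lambda>h. f (x + (h + t) *\<^sub>R b)) has_real_derivative partial_deriv b f (x + t *\<^sub>R b)) (at 0)"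
    by (simp add: algebra_simps)
  thus ?thesis using DERIV_shift[of "\<lambda>t. f (x + t *\<^sub>R b)" _ 0 t] by simp
qed

text \<open>The Bernstein argument compares \<open>z\<close> with its composition with a dilation,
  so the chain rule is built in: each derivative contributes one factor \<open>s\<close>. The plain
  case is \<open>c = 0\<close>, \<open>s = 1\<close>.\<close>

lemma C2_on_dir2_affine:
  assumes f: "C2_on S f" and S: "open S" and x: "c + s *\<^sub>R x \<in> S" and b: "b \<in> Basis"
  shows "dir2 (\<lambda>x. f (c + s *\<^sub>R x)) b x (s * partial_deriv b f (c + s *\<^sub>R x))
     (s\<^sup>2 * partial_deriv b (partial_deriv b f) (c + s *\<^sub>R x))"
proof (rule dir2I)
  let ?w = "c + s *\<^sub>R x"
  have d: "f differentiable_on S" "partial_deriv b f differentiable_on S"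
    using f b unfolding C2_on_def by auto
  have lim: "((\<lambda>t. ?w + (s * t) *\<^sub>R b) \<longlongrightarrow> ?w + (s * 0) *\<^sub>R b) (nhds 0)"
    by (intro tendsto_intros filterlim_ident)
  have "\<forall>\<^sub>F t in nhds 0. ?w + (s * t) *\<^sub>R b \<in> S"
    using topological_tendstoD[OF lim S] x by simp
  thus "\<forall>\<^sub>F t in nhds 0. ((\<lambda>t. f (c + s *\<^sub>R (x + t *\<^sub>R b))) has_real_derivative
      s * partial_deriv b f (?w + (s * t) *\<^sub>R b)) (at t)"
  proof eventually_elim
    case (elim t)
    have "((\<lambda>t. f (?w + t *\<^sub>R b)) has_real_derivative partial_deriv b f (?w + (s * t) *\<^sub>R b)) (at (s * t))"
      by (rule partial_deriv_along_at[OF d(1) S elim])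
    hence "((\<lambda>t. f (?w + (s * t) *\<^sub>R b)) has_real_derivative partial_deriv b f (?w + (s * t) *\<^sub>R b) * s) (at t)"
      by (rule DERIV_chain2) (auto intro!: derivative_eq_intros)
    thus ?case by (simp add: algebra_simps)
  qed
  have "((\<lambda>t. partial_deriv b f (?w + t *\<^sub>R b)) has_real_derivative partial_deriv b (partial_deriv b f) ?w) (at (s * 0))"
    using partial_deriv_along[OF d(2) S x] by simp
  hence "((\<lambda>t. partial_deriv b f (?w + (s * t) *\<^sub>R b)) has_real_derivative partial_deriv b (partial_deriv b f) ?w * s) (at 0)"
    by (rule DERIV_chain2) (auto intro!: derivative_eq_intros)
  from DERIV_cmult[OF this, of s]
  show "((\<lambda>t. s * partial_deriv b f (?w + (s * t) *\<^sub>R b)) has_real_derivative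
    s\<^sup>2 * partial_deriv b (partial_deriv b f) ?w) (at 0)"
    by (simp add: power2_eq_square mult_ac)
qed simp

lemma C2_on_dir2:
  assumes "C2_on S f" "open S" "x \<in> S" "b \<in> Basis"
  shows "dir2 f b x (partial_deriv b f x) (partial_deriv b (partial_deriv b f) x)"
  using C2_on_dir2_affine[of S f 0 1 x b] assms by simp

lemma gradient_inner_Basis: "b \<in> Basis \<Longrightarrow> gradient f x \<bullet> b = partial_deriv b f x"
  unfolding gradient_def by (simp add: inner_sum_left inner_Basis if_distrib cong: if_cong)

lemma norm_gradient_square: "(norm (gradient f x))\<^sup>2 = (\<Sum>b\<in>Basis. (partial_deriv b f x)\<^sup>2)"
  unfolding power2_norm_eq_inner
  by (subst euclidean_inner) (simp add: gradient_inner_Basis power2_eq_square)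

lemma frechet_derivative_eq_gradient:
  assumes "f differentiable_on S" "open S" "x \<in> S"
  shows "(f has_derivative (\<lambda>v. gradient f x \<bullet> v)) (at x)"
proof -
  let ?F = "frechet_derivative f (at x)"
  have d: "(f has_derivative ?F) (at x)" by (rule differentiable_on_openD[OF assms])
  hence lin: "linear ?F" by (rule has_derivative_linear)
  have "?F v = gradient f x \<bullet> v" for v
  proof -
    have "?F v = ?F (\<Sum>b\<in>Basis. (v \<bullet> b) *\<^sub>R b)" by (simp add: euclidean_representation)
    also have "\<dots> = (\<Sum>b\<in>Basis. (v \<bullet> b) * ?F b)"
      by (simp add: linear_sum[OF lin] linear_scale[OF lin])
    also have "\<dots> = gradient f x \<bullet> v"
      by (subst euclidean_inner) (auto simp: gradient_inner_Basis partial_deriv_def mult.commute intro!: sum.cong)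
    finally show ?thesis .
  qed
  thus ?thesis using d by (simp add: has_derivative_def bounded_linear_inner_right)
qed

lemma C2_on_gradient_continuous:
  assumes "C2_on S f" shows "continuous_on S (gradient f)"
  unfolding gradient_def using assms unfolding C2_on_def
  by (intro continuous_intros) (auto intro: differentiable_imp_continuous_on)

text \<open>The comparison arguments end here: a positive maximum cannot sit at a point of
  \<open>C\<close> outside its interior, and interiority turns it into a maximum over a full
  neighbourhood, as the derivative tests require.\<close>

lemma compact_positive_max_interior:
  fixes g :: "'a::metric_space \<Rightarrow> real"
  assumes "compact C" "continuous_on C g" "x \<in> C" "0 < g x"
    and "\<And>y. y \<in> C \<Longrightarrow> y \<notin> interior C \<Longrightarrow> g y \<le> 0"
  obtains y where "y \<in> interior C" "0 < g y" "\<forall>\<^sub>F w in nhds y. g w \<le> g y"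
proof -
  obtain y where y: "y \<in> C" "\<And>w. w \<in> C \<Longrightarrow> g w \<le> g y"
    using continuous_attains_sup[of C g] assms by auto
  have pos: "0 < g y" using y(2)[of x] assms by auto
  hence int: "y \<in> interior C" using assms(5)[OF y(1)] by force
  have "\<forall>\<^sub>F w in nhds y. w \<in> interior C"
    using int by (intro eventually_nhds_in_open) auto
  hence "\<forall>\<^sub>F w in nhds y. g w \<le> g y"
    by eventually_elim (use y(2) interior_subset in blast)
  with pos int show ?thesis using that by blast
qed

section \<open>Barriers\<close>

text \<open>The left side is the Laplacian of \<epsilon> (1 - (\<mu> r)^2)^(-k) in dimension n, and
  the base of the last power is its gradient norm. In terms of D = 1 - (\<mu> r)^2 they grow like
  D^(-k-2) and, after taking the power q, D^(-(k+1)q). Since k = 1/(q-1) gives (k+1)q = k + 2 +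
  (q-1), the gradient term wins near the sphere by a factor D^(-(q-1)). Elsewhere the factor \<mu>^2
  makes the left side smaller than \<eta>.\<close>

lemma barrier_inequality:
  fixes q \<epsilon> \<eta> b n k :: real
  assumes q: "1 < q" "q \<le> 2" and pos: "0 < \<epsilon>" "0 < \<eta>" "0 < b" "0 \<le> n" and k: "k = 1 / (q - 1)"
  shows "\<exists>\<mu>>0. \<forall>r\<ge>0. \<mu> * r < 1 \<longrightarrow>
     \<epsilon> * k * \<mu>\<^sup>2 * (2 * n * (1 - (\<mu> * r)\<^sup>2) powr (-k-1) + 4 * (k+1) * \<mu>\<^sup>2 * r\<^sup>2 * (1 - (\<mu> * r)\<^sup>2) powr (-k-2))
     \<le> \<eta> + b * (2 * \<epsilon> * k * \<mu>\<^sup>2 * r * (1 - (\<mu> * r)\<^sup>2) powr (-k-1)) powr q"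
proof -
  have k0: "k > 0" using q k by simp
  define P where "P = k * (2 * n + 4 * (k + 1))"
  have P0: "P > 0" using k0 pos(4) by (auto simp: P_def intro!: mult_pos_pos add_nonneg_pos)
  \<comment> \<open>Threshold for the coefficients: once D^(q-1) \<le> Y and \<mu> r \<ge> 1/2, the
    gradient term beats \<epsilon> P \<mu>^2 D^(-k-2).\<close>
  define Y where "Y = b * (\<epsilon> * k) powr q / (\<epsilon> * P)"
  have Y0: "Y > 0" using pos k0 P0 by (simp add: Y_def)
  have YY: "b * (\<epsilon> * k) powr q * (1 / Y) = \<epsilon> * P"
    using pos k0 P0 by (simp add: Y_def)
  \<comment> \<open>Below Y^k one has D^(q-1) \<le> Y; below 3/4 moreover \<mu> r \<ge> 1/2, so the
    factor r in the gradient does not degenerate.\<close>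
  define D0 where "D0 = min (3/4) (Y powr k)"
  have D0: "0 < D0" "D0 \<le> 3/4" using Y0 by (auto simp: D0_def)
  have kq: "k * (q - 1) = 1" using k q by simp
  have D0Y: "D powr (q - 1) \<le> Y" if "0 < D" "D \<le> D0" for D
  proof -
    have "D powr (q - 1) \<le> (Y powr k) powr (q - 1)"
      using that q by (intro powr_mono2) (auto simp: D0_def)
    also have "\<dots> = Y" using kq Y0 by (simp add: powr_powr)
    finally show ?thesis .
  qed
  \<comment> \<open>Makes \<mu>^2 \<epsilon> P D0^(-k-2) \<le> \<eta>, which settles the region D
    \<ge> D0; \<mu> \<le> 1 is there for \<mu>^2 \<le> \<mu>^q, a consequence of q \<le> 2.\<close>
  define \<mu> where "\<mu> = min 1 (sqrt (\<eta> / (\<epsilon> * P * D0 powr (-k-2))))"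
  have den: "\<epsilon> * P * D0 powr (-k-2) > 0" using pos P0 D0 by simp
  have mu: "0 < \<mu>" "\<mu> \<le> 1" using den pos by (auto simp: \<mu>_def)
  have "\<mu>\<^sup>2 \<le> (sqrt (\<eta> / (\<epsilon> * P * D0 powr (-k-2))))\<^sup>2"
    using mu by (intro power_mono) (auto simp: \<mu>_def)
  also have "\<dots> = \<eta> / (\<epsilon> * P * D0 powr (-k-2))" using den pos by simp
  finally have mueta: "\<mu>\<^sup>2 * (\<epsilon> * P * D0 powr (-k-2)) \<le> \<eta>" using den by (simp add: field_simps)
  show ?thesis
  proof (intro exI[of _ \<mu>] conjI allI impI mu(1))
    fix r :: real assume r: "0 \<le> r" "\<mu> * r < 1"
    define D where "D = 1 - (\<mu> * r)\<^sup>2"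
    have mr: "0 \<le> \<mu> * r" using mu r by simp
    have mr1: "(\<mu> * r)\<^sup>2 < 1" using mr r by (simp add: power_less_one_iff)
    have D: "0 < D" "D \<le> 1" using mr1 by (auto simp: D_def)
    have "2 * n * D powr (-k-1) \<le> 2 * n * D powr (-k-2)"
      using D pos(4) by (intro mult_left_mono) (auto intro: powr_mono')
    moreover have "4 * (k+1) * \<mu>\<^sup>2 * r\<^sup>2 * D powr (-k-2) \<le> 4 * (k+1) * D powr (-k-2)"
      using mr1 k0 D mult_right_mono[of "(\<mu>*r)\<^sup>2" 1 "4 * (k+1) * D powr (-k-2)"]
      by (simp add: power_mult_distrib mult_ac)
    ultimately have "2 * n * D powr (-k-1) + 4 * (k+1) * \<mu>\<^sup>2 * r\<^sup>2 * D powr (-k-2)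
        \<le> (2 * n + 4 * (k+1)) * D powr (-k-2)"
      by (simp add: algebra_simps)
    hence "\<epsilon> * k * \<mu>\<^sup>2 * (2 * n * D powr (-k-1) + 4 * (k+1) * \<mu>\<^sup>2 * r\<^sup>2 * D powr (-k-2))
        \<le> \<epsilon> * k * \<mu>\<^sup>2 * ((2 * n + 4 * (k+1)) * D powr (-k-2))"
      using pos k0 by (intro mult_left_mono) auto
    also have "\<dots> = \<mu>\<^sup>2 * (\<epsilon> * P) * D powr (-k-2)" by (simp add: P_def mult_ac)
    finally have 1: "\<epsilon> * k * \<mu>\<^sup>2 * (2 * n * D powr (-k-1) + 4 * (k+1) * \<mu>\<^sup>2 * r\<^sup>2 * D powr (-k-2))
        \<le> \<mu>\<^sup>2 * (\<epsilon> * P) * D powr (-k-2)" .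
    have 2: "\<mu>\<^sup>2 * (\<epsilon> * P) * D powr (-k-2) \<le> \<eta> + b * (2 * \<epsilon> * k * \<mu>\<^sup>2 * r * D powr (-k-1)) powr q"
    proof (cases "D0 \<le> D")
      case True
      have "\<mu>\<^sup>2 * (\<epsilon> * P) * D powr (-k-2) \<le> \<mu>\<^sup>2 * (\<epsilon> * P) * D0 powr (-k-2)"
        using True D0 pos P0 k0 by (intro mult_left_mono powr_mono2') auto
      also have "\<dots> \<le> \<eta>" using mueta by (simp add: mult_ac)
      also have "\<dots> \<le> \<eta> + b * (2 * \<epsilon> * k * \<mu>\<^sup>2 * r * D powr (-k-1)) powr q" using pos by simp
      finally show ?thesis .
    next
      case False
      hence "(\<mu> * r)\<^sup>2 \<ge> (1/2)\<^sup>2" using D0 by (simp add: D_def power2_eq_square)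
      hence half: "\<mu> * r \<ge> 1/2" using mr by (simp add: power2_le_iff_abs_le abs_le_square_iff)
      have "\<epsilon> * k * \<mu> * D powr (-k-1) \<le> 2 * (\<mu> * r) * (\<epsilon> * k * \<mu> * D powr (-k-1))"
        using mult_right_mono[of 1 "2 * (\<mu> * r)" "\<epsilon> * k * \<mu> * D powr (-k-1)"] half pos k0 mu by simp
      hence "(\<epsilon> * k * \<mu> * D powr (-k-1)) powr q \<le> (2 * \<epsilon> * k * \<mu>\<^sup>2 * r * D powr (-k-1)) powr q"
        using q pos k0 mu by (intro powr_mono2) (auto simp: power2_eq_square mult_ac)
      moreover have "(\<epsilon> * k * \<mu> * D powr (-k-1)) powr q = (\<epsilon> * k) powr q * \<mu> powr q * D powr ((-k-1) * q)"
        using pos k0 mu by (simp add: powr_mult powr_powr)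
      moreover have "(-k-1) * q = (-k-2) + - (q - 1)" using kq by (simp add: algebra_simps)
      moreover have "\<mu> powr q \<ge> \<mu>\<^sup>2" using mu q powr_mono'[of q 2 \<mu>] by (simp add: powr_numeral)
      moreover have "D powr (- (q - 1)) \<ge> 1 / Y"
        using D0Y[of D] D False Y0 by (subst powr_minus_divide) (intro divide_left_mono, auto)
      ultimately have g1: "(\<epsilon> * k) powr q * \<mu> powr q * (D powr (-k-2) * D powr (- (q - 1))) \<le> (2 * \<epsilon> * k * \<mu>\<^sup>2 * r * D powr (-k-1)) powr q"
        and g2: "\<mu>\<^sup>2 \<le> \<mu> powr q" and g3: "1 / Y \<le> D powr (- (q - 1))"
        by (simp_all only: powr_add)
      have "(\<epsilon> * k) powr q * \<mu>\<^sup>2 * (D powr (-k-2) * (1 / Y)) \<le> (\<epsilon> * k) powr q * \<mu> powr q * (D powr (-k-2) * D powr (- (q - 1)))"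
        using g2 g3 Y0 by (intro mult_mono mult_nonneg_nonneg) auto
      from mult_left_mono[OF order_trans[OF this g1], of b]
      have "b * ((\<epsilon> * k) powr q * \<mu>\<^sup>2 * (D powr (-k-2) * (1 / Y)))
          \<le> b * (2 * \<epsilon> * k * \<mu>\<^sup>2 * r * D powr (-k-1)) powr q"
        using pos by simp
      moreover have "b * ((\<epsilon> * k) powr q * \<mu>\<^sup>2 * (D powr (-k-2) * (1 / Y)))
          = \<mu>\<^sup>2 * (b * (\<epsilon> * k) powr q * (1 / Y)) * D powr (-k-2)"
        by (simp only: mult.assoc mult.commute mult.left_commute)
      ultimately have "\<mu>\<^sup>2 * (\<epsilon> * P) * D powr (-k-2) \<le> b * (2 * \<epsilon> * k * \<mu>\<^sup>2 * r * D powr (-k-1)) powr q"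
        unfolding YY by simp
      thus ?thesis using pos by linarith
    qed
    show "\<epsilon> * k * \<mu>\<^sup>2 * (2 * n * (1 - (\<mu> * r)\<^sup>2) powr (-k-1) + 4 * (k+1) * \<mu>\<^sup>2 * r\<^sup>2 * (1 - (\<mu> * r)\<^sup>2) powr (-k-2))
     \<le> \<eta> + b * (2 * \<epsilon> * k * \<mu>\<^sup>2 * r * (1 - (\<mu> * r)\<^sup>2) powr (-k-1)) powr q"
      using order_trans[OF 1 2] unfolding D_def .
  qed
qed

section \<open>Coordinate derivatives of the radial barrier\<close>

lemma has_real_derivative_barrier:
  assumes "0 < 1 - \<mu>\<^sup>2 * (s + 2 * t * c + t\<^sup>2)"
  shows "((\<lambda>t. \<epsilon> * (1 - \<mu>\<^sup>2 * (s + 2 * t * c + t\<^sup>2)) powr (- k)) has_real_derivative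
     2 * \<epsilon> * k * \<mu>\<^sup>2 * (c + t) * (1 - \<mu>\<^sup>2 * (s + 2 * t * c + t\<^sup>2)) powr (- k - 1)) (at t)"
proof -
  have "((\<lambda>t. 1 - \<mu>\<^sup>2 * (s + 2 * t * c + t\<^sup>2)) has_real_derivative - \<mu>\<^sup>2 * (2 * c + 2 * t)) (at t)"
    by (auto intro!: derivative_eq_intros)
  from DERIV_cmult[OF DERIV_fun_powr[OF this assms, of "- k"], of \<epsilon>] show ?thesis
    by (rule DERIV_cong) (simp add: algebra_simps)
qed

lemma has_real_derivative_barrier2:
  assumes "0 < 1 - \<mu>\<^sup>2 * s"
  shows "((\<lambda>t. 2 * \<epsilon> * k * \<mu>\<^sup>2 * (c + t) * (1 - \<mu>\<^sup>2 * (s + 2 * t * c + t\<^sup>2)) powr (- k - 1)) has_real_derivative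
     \<epsilon> * k * \<mu>\<^sup>2 * (2 * (1 - \<mu>\<^sup>2 * s) powr (- k - 1) + 4 * (k + 1) * \<mu>\<^sup>2 * c\<^sup>2 * (1 - \<mu>\<^sup>2 * s) powr (- k - 2))) (at 0)"
proof -
  have d: "((\<lambda>t. 1 - \<mu>\<^sup>2 * (s + 2 * t * c + t\<^sup>2)) has_real_derivative - \<mu>\<^sup>2 * (2 * c)) (at 0)"
    by (auto intro!: derivative_eq_intros)
  have "((\<lambda>t. (1 - \<mu>\<^sup>2 * (s + 2 * t * c + t\<^sup>2)) powr (- k - 1)) has_real_derivative
     (k + 1) * \<mu>\<^sup>2 * (2 * c) * (1 - \<mu>\<^sup>2 * s) powr (- k - 2)) (at 0)"
    using assms by (intro DERIV_cong[OF DERIV_fun_powr[OF d]]) (auto simp: algebra_simps)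
  moreover have "((\<lambda>t. 2 * \<epsilon> * k * \<mu>\<^sup>2 * (c + t)) has_real_derivative 2 * \<epsilon> * k * \<mu>\<^sup>2) (at 0)"
    by (auto intro!: derivative_eq_intros)
  ultimately show ?thesis
    by (rule DERIV_cong[OF DERIV_mult[rotated]]) (simp add: algebra_simps power2_eq_square)
qed

text \<open>Minimum \<epsilon> at \<open>y0\<close> and blow-up on the sphere of radius 1/\<mu>:
  near that sphere it dominates any function bounded on the ball, whatever happens outside.\<close>

definition ball_barrier :: "real \<Rightarrow> real \<Rightarrow> real \<Rightarrow> 'a::euclidean_space \<Rightarrow> 'a \<Rightarrow> real" where
  "ball_barrier \<epsilon> \<mu> k y0 y = \<epsilon> * (1 - (\<mu> * norm (y - y0))\<^sup>2) powr (- k)"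

lemma norm_add_Basis_square:
  fixes y y0 b :: "'a::euclidean_space"
  assumes b: "b \<in> Basis"
  shows "(norm (y + t *\<^sub>R b - y0))\<^sup>2 = (norm (y - y0))\<^sup>2 + 2 * t * ((y - y0) \<bullet> b) + t\<^sup>2"
proof -
  have "y + t *\<^sub>R b - y0 = (y - y0) + t *\<^sub>R b" by simp
  moreover have "b \<bullet> b = 1" using b by (simp add: inner_Basis)
  ultimately show ?thesis unfolding power2_norm_eq_inner
    by (simp only: inner_add_left inner_add_right inner_scaleR_left inner_scaleR_right inner_commute[of b "y - y0"])
      (simp add: power2_eq_square distrib_left)
qed

lemma dir2_ball_barrier:
  fixes y :: "'a::euclidean_space"
  assumes b: "b \<in> Basis" and y: "0 \<le> \<mu>" "\<mu> * norm (y - y0) < 1"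
  defines "D \<equiv> 1 - (\<mu> * norm (y - y0))\<^sup>2"
  shows "dir2 (ball_barrier \<epsilon> \<mu> k y0) b y (2 * \<epsilon> * k * \<mu>\<^sup>2 * ((y - y0) \<bullet> b) * D powr (-k-1))
     (\<epsilon> * k * \<mu>\<^sup>2 * (2 * D powr (-k-1) + 4 * (k+1) * \<mu>\<^sup>2 * ((y - y0) \<bullet> b)\<^sup>2 * D powr (-k-2)))"
proof -
  define s c where "s = (norm (y - y0))\<^sup>2" and "c = (y - y0) \<bullet> b"
  have DD: "D = 1 - \<mu>\<^sup>2 * s" by (simp add: D_def s_def power_mult_distrib)
  have D0: "0 < D" using y by (simp add: D_def power_less_one_iff)
  have nn: "(norm (y + t *\<^sub>R b - y0))\<^sup>2 = s + 2 * t * c + t\<^sup>2" for t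
    unfolding s_def c_def by (rule norm_add_Basis_square[OF b])
  have eq: "ball_barrier \<epsilon> \<mu> k y0 (y + t *\<^sub>R b) = \<epsilon> * (1 - \<mu>\<^sup>2 * (s + 2 * t * c + t\<^sup>2)) powr (- k)" for t
    unfolding ball_barrier_def power_mult_distrib nn ..
  show ?thesis
  proof (rule dir2I)
    have "((\<lambda>t. 1 - \<mu>\<^sup>2 * (s + 2 * t * c + t\<^sup>2)) \<longlongrightarrow> 1 - \<mu>\<^sup>2 * (s + 2 * 0 * c + 0\<^sup>2)) (nhds 0)"
      by (intro tendsto_intros filterlim_ident)
    from order_tendstoD(1)[OF this, of 0]
    have "\<forall>\<^sub>F t in nhds 0. 0 < 1 - \<mu>\<^sup>2 * (s + 2 * t * c + t\<^sup>2)"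
      using D0 DD by simp
    thus "\<forall>\<^sub>F t in nhds 0. ((\<lambda>t. ball_barrier \<epsilon> \<mu> k y0 (y + t *\<^sub>R b)) has_real_derivative
        2 * \<epsilon> * k * \<mu>\<^sup>2 * (c + t) * (1 - \<mu>\<^sup>2 * (s + 2 * t * c + t\<^sup>2)) powr (- k - 1)) (at t)"
      unfolding eq by eventually_elim (rule has_real_derivative_barrier)
    show "((\<lambda>t. 2 * \<epsilon> * k * \<mu>\<^sup>2 * (c + t) * (1 - \<mu>\<^sup>2 * (s + 2 * t * c + t\<^sup>2)) powr (- k - 1)) has_real_derivative
      (\<epsilon> * k * \<mu>\<^sup>2 * (2 * D powr (-k-1) + 4 * (k+1) * \<mu>\<^sup>2 * ((y - y0) \<bullet> b)\<^sup>2 * D powr (-k-2)))) (at 0)"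
      using has_real_derivative_barrier2[of \<mu> s \<epsilon> k c] D0 by (simp add: DD c_def)
  qed (simp add: DD c_def)
qed

lemma sum_inner_Basis_square: "(\<Sum>b\<in>Basis. (v \<bullet> b)\<^sup>2) = (norm v)\<^sup>2" for v :: "'a::euclidean_space"
  unfolding power2_norm_eq_inner euclidean_inner[of v v] by (simp add: power2_eq_square)

section \<open>Sums of a function of \<xi>1 and a function of \<xi>'\<close>

lemma dir2_split_fst:
  fixes f :: "real \<Rightarrow> real"
  assumes "\<forall>\<^sub>F t in nhds t0. (f has_real_derivative f' t) (at t)" "(f' has_real_derivative D) (at t0)"
  shows "dir2 (\<lambda>\<xi>. f (fst \<xi>) + U (snd \<xi>)) (1, 0) (t0, y) (f' t0) D"
proof (rule dir2I)
  have "((\<lambda>t. t0 + t) \<longlongrightarrow> t0 + 0) (nhds 0)" by (intro tendsto_intros filterlim_ident)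
  hence "filterlim (\<lambda>t. t0 + t) (nhds t0) (nhds 0)" by simp
  hence "\<forall>\<^sub>F t in nhds 0. (f has_real_derivative f' (t0 + t)) (at (t0 + t))"
    using assms(1) by (rule eventually_compose_filterlim[rotated])
  thus "\<forall>\<^sub>F t in nhds 0. ((\<lambda>t. f (fst ((t0, y) + t *\<^sub>R (1, 0))) + U (snd ((t0, y) + t *\<^sub>R (1, 0))))
      has_real_derivative f' (t0 + t)) (at t)"
  proof eventually_elim
    case (elim t)
    have "((\<lambda>t. f (t0 + t)) has_real_derivative f' (t0 + t)) (at t)"
      using DERIV_shift[of f "f' (t0 + t)" t t0] elim by (simp add: add.commute)
    thus ?case by (auto intro!: derivative_eq_intros)
  qed
  show "((\<lambda>t. f' (t0 + t)) has_real_derivative D) (at 0)"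
    using DERIV_shift[of f' D 0 t0] assms(2) by (simp add: add.commute)
qed simp

lemma dir2_split_snd:
  fixes f :: "real \<Rightarrow> real"
  assumes "dir2 U b y d1 d2"
  shows "dir2 (\<lambda>\<xi>. f (fst \<xi>) + U (snd \<xi>)) (0, b) (t0, y) d1 d2"
proof -
  obtain u' where u: "\<forall>\<^sub>F t in nhds 0. ((\<lambda>t. U (y + t *\<^sub>R b)) has_real_derivative u' t) (at t)"
    "u' 0 = d1" "(u' has_real_derivative d2) (at 0)"
    using assms unfolding dir2_def by blast
  show ?thesis
  proof (rule dir2I)
    show "\<forall>\<^sub>F t in nhds 0. ((\<lambda>t. f (fst ((t0, y) + t *\<^sub>R (0, b))) + U (snd ((t0, y) + t *\<^sub>R (0, b))))
      has_real_derivative u' t) (at t)"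
      using u(1) by eventually_elim (auto intro!: derivative_eq_intros)
  qed (use u in auto)
qed

lemma sum_Basis_half_space:
  fixes F :: "real \<times> 'b::euclidean_space \<Rightarrow> real"
  shows "(\<Sum>b\<in>Basis. F b) = F (1, 0) + (\<Sum>i\<in>Basis. F (0, i))"
proof -
  have "(\<Sum>b\<in>Basis. F b) = (\<Sum>b\<in>(\<lambda>u. (u, 0)) ` (Basis :: real set). F b) + (\<Sum>b\<in>(\<lambda>v. (0, v)) ` (Basis :: 'b set). F b)"
    unfolding Basis_prod_def by (intro sum.union_disjoint) auto
  also have "(\<Sum>b\<in>(\<lambda>v. (0::real, v)) ` (Basis :: 'b set). F b) = (\<Sum>i\<in>Basis. F (0, i))"
    by (subst sum.reindex) (auto simp: inj_on_def)
  finally show ?thesis by simp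
qed

section \<open>Comparison in the half space\<close>

text \<open>The boundary condition is left out: the comparison lemmas take the behaviour at the ends
  of the \<xi>1 range as premises, so that they serve finite and infinite \<open>M\<close> and also
  slabs away from the boundary.\<close>

locale half_space_solution =
  fixes q \<alpha> p \<beta> :: real and z :: "real \<times> (real^'m) \<Rightarrow> real"
  assumes q: "1 < q" "q \<le> 2" and alpha: "0 \<le> \<alpha>" and p: "0 < p" and beta: "0 < \<beta>"
    and C2: "C2_on half_space z"
    and eq: "\<And>\<xi>. \<xi> \<in> half_space \<Longrightarrow> laplacian z \<xi> = \<alpha> * z \<xi> powr p + \<beta> * norm (gradient z \<xi>) powr q"
    and nonneg: "\<And>\<xi>. \<xi> \<in> half_space \<Longrightarrow> 0 \<le> z \<xi>"

lemma open_half_space: "open half_space"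
  unfolding half_space_def by (intro open_Collect_less continuous_intros)

context half_space_solution
begin

lemma continuous_on_z: "continuous_on half_space z"
  using C2 unfolding C2_on_def by (auto intro: differentiable_imp_continuous_on)

lemma bounded_above_on_compact:
  assumes "compact K" "K \<subseteq> half_space"
  obtains B where "B > 0" "\<And>\<xi>. \<xi> \<in> K \<Longrightarrow> z \<xi> \<le> B"
proof -
  have "compact (z ` K)"
    using continuous_on_z assms by (meson compact_continuous_image continuous_on_subset)
  hence "bounded (z ` K)" by (rule compact_imp_bounded)
  then obtain B where "B > 0" "\<forall>x\<in>z ` K. norm x \<le> B" using bounded_pos by blast
  thus ?thesis by (intro that[of B]) (auto dest: bspec)
qed

text \<open>At a contact point the gradients agree; the two components of the gradient of the barrier
  \<open>f(\<xi>\<^sub>1) + U(\<xi>')\<close> are orthogonal, so its norm dominates both of them.\<close>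

lemma upper_comparison:
  assumes t: "0 < \<theta>" "\<theta> < 1" and ee: "0 < \<epsilon>" "0 < \<eta>"
  shows "\<exists>R>0. \<forall>f f' f'' a A t0 y0. 0 \<le> a \<longrightarrow> a < t0 \<longrightarrow> t0 < A \<longrightarrow>
     (\<forall>t. a < t \<and> t < A \<longrightarrow> (f has_real_derivative f' t) (at t) \<and> (f' has_real_derivative f'' t) (at t) \<and>
        0 \<le> f t \<and> f'' t + \<eta> < \<alpha> * (f t + \<epsilon>) powr p + \<theta> * \<beta> * \<bar>f' t\<bar> powr q) \<longrightarrow>
     (\<exists>a1>a. \<forall>t y. a < t \<and> t < a1 \<and> y \<in> cball y0 R \<longrightarrow> z (t, y) < f t + \<epsilon>) \<longrightarrow>
     (\<exists>A1<A. \<forall>t y. A1 < t \<and> t < A \<and> y \<in> cball y0 R \<longrightarrow> z (t, y) < f t + \<epsilon>) \<longrightarrow>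
     z (t0, y0) \<le> f t0 + \<epsilon>"
proof -
  define k where "k = 1 / (q - 1)"
  have k0: "k > 0" using q by (simp add: k_def)
  define n where "n = real (DIM(real^'m))"
  \<comment> \<open>The share 1 - \<theta> of the gradient term is reserved for the barrier. Besides
    the data of the equation, \<mu> depends on \<epsilon>, \<eta> and \<theta> only, so the radius
    is fixed before the profile \<open>f\<close> and the point are chosen.\<close>
  obtain \<mu> where mu: "\<mu> > 0" and bar: "\<And>r. 0 \<le> r \<Longrightarrow> \<mu> * r < 1 \<Longrightarrow>
     \<epsilon> * k * \<mu>\<^sup>2 * (2 * n * (1 - (\<mu> * r)\<^sup>2) powr (-k-1) + 4 * (k+1) * \<mu>\<^sup>2 * r\<^sup>2 * (1 - (\<mu> * r)\<^sup>2) powr (-k-2))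
     \<le> \<eta> + (1 - \<theta>) * \<beta> * (2 * \<epsilon> * k * \<mu>\<^sup>2 * r * (1 - (\<mu> * r)\<^sup>2) powr (-k-1)) powr q"
    using barrier_inequality[OF q ee, of "(1 - \<theta>) * \<beta>" n k] t beta by (auto simp: k_def n_def)
  show ?thesis
  proof (intro exI[of _ "1 / \<mu>"] conjI allI impI)
    show "1 / \<mu> > 0" using mu by simp
    fix f f' f'' :: "real \<Rightarrow> real" and a A t0 :: real and y0 :: "real^'m"
    assume a: "0 \<le> a" "a < t0" "t0 < A"
      and prof: "\<forall>t. a < t \<and> t < A \<longrightarrow> (f has_real_derivative f' t) (at t) \<and> (f' has_real_derivative f'' t) (at t) \<and>
        0 \<le> f t \<and> f'' t + \<eta> < \<alpha> * (f t + \<epsilon>) powr p + \<theta> * \<beta> * \<bar>f' t\<bar> powr q"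
      and bot: "\<exists>a1>a. \<forall>t y. a < t \<and> t < a1 \<and> y \<in> cball y0 (1 / \<mu>) \<longrightarrow> z (t, y) < f t + \<epsilon>"
      and top: "\<exists>A1<A. \<forall>t y. A1 < t \<and> t < A \<and> y \<in> cball y0 (1 / \<mu>) \<longrightarrow> z (t, y) < f t + \<epsilon>"
    obtain a1' where a1': "a1' > a" "\<And>t y. a < t \<Longrightarrow> t < a1' \<Longrightarrow> y \<in> cball y0 (1/\<mu>) \<Longrightarrow> z (t, y) < f t + \<epsilon>"
      using bot by blast
    obtain A1' where A1': "A1' < A" "\<And>t y. A1' < t \<Longrightarrow> t < A \<Longrightarrow> y \<in> cball y0 (1/\<mu>) \<Longrightarrow> z (t, y) < f t + \<epsilon>"
      using top by blast
    obtain a1 where a1: "a < a1" "a1 < min a1' t0" using a1'(1) a(2) dense[of a "min a1' t0"] by auto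
    obtain A1 where A1: "max A1' t0 < A1" "A1 < A" using A1'(1) a(3) dense[of "max A1' t0" A] by auto
    have sub: "{a1..A1} \<times> cball y0 (1/\<mu>) \<subseteq> half_space" using a1 a by (auto simp: half_space_def)
    obtain B where B: "B > 0" "\<And>\<xi>. \<xi> \<in> {a1..A1} \<times> cball y0 (1/\<mu>) \<Longrightarrow> z \<xi> \<le> B"
      using bounded_above_on_compact[OF compact_Times[OF compact_Icc compact_cball] sub] by blast
    \<comment> \<open>The barrier is infinite on the sphere of radius 1/\<mu>, so the cylinder is
      cut at the smaller radius \<open>R'\<close>, where 1 - (\<mu> R')^2 = D1 and the barrier has
      already reached \<open>B\<close>.\<close>
    define D1 where "D1 = min (1/2) ((B / \<epsilon>) powr (- (1 / k)))"
    have D1: "0 < D1" "D1 \<le> 1/2" using B ee by (auto simp: D1_def)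
    have "D1 powr (- k) \<ge> ((B / \<epsilon>) powr (- (1 / k))) powr (- k)"
      using D1 k0 by (intro powr_mono2') (auto simp: D1_def)
    hence D1B: "\<epsilon> * D1 powr (- k) \<ge> B"
      using k0 B ee by (simp add: powr_powr field_simps)
    define R' where "R' = sqrt (1 - D1) / \<mu>"
    have R': "0 < R'" "R' < 1/\<mu>" using D1 mu by (auto simp: R'_def divide_strict_right_mono)
    define W where "W = (\<lambda>\<xi>. f (fst \<xi>) + ball_barrier \<epsilon> \<mu> k y0 (snd \<xi>))"
    define C where "C = {a1..A1} \<times> cball y0 R'"
    have intC: "interior C = {a1<..<A1} \<times> ball y0 R'"
      by (simp add: C_def interior_Times)
    have mun: "\<mu> * norm (y - y0) < 1" if "y \<in> cball y0 R'" for y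
    proof -
      have "norm (y - y0) < 1 / \<mu>" using that R' by (simp add: dist_norm norm_minus_commute)
      thus ?thesis using mu by (simp add: field_simps)
    qed
    have mun2: "0 < 1 - (\<mu> * norm (y - y0))\<^sup>2" if "y \<in> cball y0 R'" for y
      using mun[OF that] mu by (simp add: power_less_one_iff)
    have UE: "\<epsilon> \<le> ball_barrier \<epsilon> \<mu> k y0 y" if "y \<in> cball y0 R'" for y
    proof -
      have "(1 - (\<mu> * norm (y - y0))\<^sup>2) powr (- k) \<ge> 1 powr (- k)"
        using k0 mun2[OF that] by (intro powr_mono2') auto
      thus ?thesis unfolding ball_barrier_def using ee by simp
    qed
    have UB: "B \<le> ball_barrier \<epsilon> \<mu> k y0 y" if "dist y0 y = R'" for y
    proof -
      have "(\<mu> * norm (y - y0))\<^sup>2 = 1 - D1" using that mu D1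
        by (simp add: dist_norm norm_minus_commute R'_def)
      thus ?thesis using D1B by (simp add: ball_barrier_def)
    qed
    show "z (t0, y0) \<le> f t0 + \<epsilon>"
    proof (rule ccontr)
      assume "\<not> z (t0, y0) \<le> f t0 + \<epsilon>"
      \<comment> \<open>At the centre the barrier equals \<epsilon>, the whole error allowed in the
        claim.\<close>
      hence pos: "0 < z (t0, y0) - W (t0, y0)" by (simp add: W_def ball_barrier_def)
      have fc: "continuous_on {a1..A1} f"
      proof (rule continuous_at_imp_continuous_on, rule ballI)
        fix t assume "t \<in> {a1..A1}"
        hence "(f has_real_derivative f' t) (at t)" using prof a1 A1 by auto
        thus "isCont f t" by (rule DERIV_isCont)
      qed
      have "continuous_on (cball y0 R') (ball_barrier \<epsilon> \<mu> k y0)"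
        unfolding ball_barrier_def using mun2
        by (intro continuous_intros ballI) (metis less_irrefl)
      hence "continuous_on C (\<lambda>\<xi>. ball_barrier \<epsilon> \<mu> k y0 (snd \<xi>))"
        by (rule continuous_on_compose2[OF _ continuous_on_snd[OF continuous_on_id]]) (auto simp: C_def)
      moreover have "continuous_on C (\<lambda>\<xi>. f (fst \<xi>))"
        by (rule continuous_on_compose2[OF fc continuous_on_fst[OF continuous_on_id]]) (auto simp: C_def)
      ultimately have Wc: "continuous_on C W" unfolding W_def by (intro continuous_on_add)
      have CH: "C \<subseteq> half_space" using sub R' by (auto simp: C_def)
      obtain \<xi> where xi: "\<xi> \<in> interior C" "0 < z \<xi> - W \<xi>" "\<forall>\<^sub>F w in nhds \<xi>. z w - W w \<le> z \<xi> - W \<xi>"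
      proof (rule compact_positive_max_interior[of C "\<lambda>\<xi>. z \<xi> - W \<xi>" "(t0, y0)"])
        show "compact C" by (auto simp: C_def intro: compact_Times)
        show "continuous_on C (\<lambda>\<xi>. z \<xi> - W \<xi>)"
          using continuous_on_z CH Wc by (auto intro: continuous_on_subset continuous_on_diff)
        show "(t0, y0) \<in> C" using a1 A1 R' by (auto simp: C_def)
        show "0 < z (t0, y0) - W (t0, y0)" by (rule pos)
        show "z w - W w \<le> 0" if "w \<in> C" "w \<notin> interior C" for w
        proof -
          obtain t y where w: "w = (t, y)" by (cases w)
          have ty: "t \<in> {a1..A1}" "y \<in> cball y0 R'" using that by (auto simp: C_def w)
          have yR: "y \<in> cball y0 (1/\<mu>)" using ty R' by auto
          have "t = a1 \<or> t = A1 \<or> dist y0 y = R'" using that ty unfolding intC by (auto simp: w)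
          thus ?thesis
          proof (elim disjE)
            assume "t = a1"
            hence "z w < f t + \<epsilon>" using a1'(2)[of t y] a1 yR by (simp add: w)
            thus ?thesis using UE[OF ty(2)] by (simp add: W_def w)
          next
            assume "t = A1"
            hence "z w < f t + \<epsilon>" using A1'(2)[of t y] A1 yR by (simp add: w)
            thus ?thesis using UE[OF ty(2)] by (simp add: W_def w)
          next
            assume "dist y0 y = R'"
            moreover have "z w \<le> B" using B(2)[of w] ty yR by (simp add: w)
            moreover have "0 \<le> f t" using prof ty a1 A1 by auto
            ultimately show ?thesis using UB[of y] by (simp add: W_def w)
          qed
        qed
      qed (use that in blast)
      obtain t y where w: "\<xi> = (t, y)" by (cases \<xi>)
      have ty: "a1 < t" "t < A1" "dist y0 y < R'" using xi(1) unfolding intC w by auto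
      have aA: "a < t" "t < A" using ty a1 A1 by auto
      have xiH: "\<xi> \<in> half_space" using xi(1) CH interior_subset by blast
      have yc: "y \<in> cball y0 R'" using ty by auto
      define r where "r = norm (y - y0)"
      define D where "D = 1 - (\<mu> * r)\<^sup>2"
      have r: "0 \<le> r" "\<mu> * r < 1" using mun[OF yc] by (auto simp: r_def)
      define g where "g = 2 * \<epsilon> * k * \<mu>\<^sup>2 * r * D powr (-k-1)"
      have g0: "0 \<le> g" using ee k0 r by (simp add: g_def)
      have evder: "\<forall>\<^sub>F t in nhds t. (f has_real_derivative f' t) (at t)"
        by (rule eventually_mono[OF eventually_nhds_in_open[of "{a<..<A}"]]) (use aA prof in auto)
      have e1: "partial_deriv (1, 0) z \<xi> = f' t" "partial_deriv (1, 0) (partial_deriv (1, 0) z) \<xi> \<le> f'' t"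
      proof -
        have "dir2 W (1, 0) \<xi> (f' t) (f'' t)"
          unfolding W_def w by (rule dir2_split_fst[OF evder]) (use prof aA in auto)
        from dir2_local_max[OF C2_on_dir2[OF C2 open_half_space xiH] this xi(3)]
        show "partial_deriv (1, 0) z \<xi> = f' t" "partial_deriv (1, 0) (partial_deriv (1, 0) z) \<xi> \<le> f'' t"
          by (auto simp: Basis_prod_def)
      qed
      have e2: "partial_deriv (0, i) z \<xi> = 2 * \<epsilon> * k * \<mu>\<^sup>2 * ((y - y0) \<bullet> i) * D powr (-k-1)"
          "partial_deriv (0, i) (partial_deriv (0, i) z) \<xi> \<le>
             \<epsilon> * k * \<mu>\<^sup>2 * (2 * D powr (-k-1) + 4 * (k+1) * \<mu>\<^sup>2 * ((y - y0) \<bullet> i)\<^sup>2 * D powr (-k-2))"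
        if i: "i \<in> Basis" for i
      proof -
        have "dir2 W (0, i) \<xi> (2 * \<epsilon> * k * \<mu>\<^sup>2 * ((y - y0) \<bullet> i) * D powr (-k-1))
            (\<epsilon> * k * \<mu>\<^sup>2 * (2 * D powr (-k-1) + 4 * (k+1) * \<mu>\<^sup>2 * ((y - y0) \<bullet> i)\<^sup>2 * D powr (-k-2)))"
          unfolding W_def w D_def r_def
          by (rule dir2_split_snd[OF dir2_ball_barrier[OF i]]) (use mu r in \<open>auto simp: r_def\<close>)
        from dir2_local_max[OF C2_on_dir2[OF C2 open_half_space xiH] this xi(3)] i
        show "partial_deriv (0, i) z \<xi> = 2 * \<epsilon> * k * \<mu>\<^sup>2 * ((y - y0) \<bullet> i) * D powr (-k-1)"
          "partial_deriv (0, i) (partial_deriv (0, i) z) \<xi> \<le>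
             \<epsilon> * k * \<mu>\<^sup>2 * (2 * D powr (-k-1) + 4 * (k+1) * \<mu>\<^sup>2 * ((y - y0) \<bullet> i)\<^sup>2 * D powr (-k-2))"
          by (auto simp: Basis_prod_def)
      qed
      have "laplacian z \<xi> \<le> f'' t + (\<Sum>i\<in>Basis. \<epsilon> * k * \<mu>\<^sup>2 * (2 * D powr (-k-1) + 4 * (k+1) * \<mu>\<^sup>2 * ((y - y0) \<bullet> i)\<^sup>2 * D powr (-k-2)))"
        unfolding laplacian_def sum_Basis_half_space using e1 e2 by (intro add_mono sum_mono) auto
      also have "\<dots> = f'' t + \<epsilon> * k * \<mu>\<^sup>2 * (2 * n * D powr (-k-1) + 4 * (k+1) * \<mu>\<^sup>2 * r\<^sup>2 * D powr (-k-2))"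
        by (simp add: sum_distrib_left[symmetric] sum.distrib sum_distrib_right[symmetric]
            sum_inner_Basis_square r_def n_def mult_ac)
      also have "\<dots> \<le> f'' t + (\<eta> + (1 - \<theta>) * \<beta> * g powr q)"
        using bar[OF r] by (simp add: D_def g_def)
      also have "\<dots> < \<alpha> * (f t + \<epsilon>) powr p + \<theta> * \<beta> * \<bar>f' t\<bar> powr q + (1 - \<theta>) * \<beta> * g powr q"
        using prof aA by force
      \<comment> \<open>The gradient term of \<open>z\<close> is split in the ratio \<theta> to 1 -
        \<theta>; the gradient norm is bounded below by |f'| in the first part and by
        \<open>g\<close> in the second. The absorption is handled by z > W \<ge> f + \<epsilon> at
        the contact point.\<close>
      also have "\<dots> \<le> \<alpha> * z \<xi> powr p + \<beta> * norm (gradient z \<xi>) powr q"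
      proof -
        have "f t + \<epsilon> \<le> z \<xi>" using xi(2) UE[OF yc] by (simp add: W_def w)
        hence 1: "\<alpha> * (f t + \<epsilon>) powr p \<le> \<alpha> * z \<xi> powr p"
          using prof aA alpha ee p by (intro mult_left_mono powr_mono2) (auto intro: add_nonneg_nonneg)
        have "(norm (gradient z \<xi>))\<^sup>2 = (f' t)\<^sup>2 + (\<Sum>i\<in>Basis. (2 * \<epsilon> * k * \<mu>\<^sup>2 * D powr (-k-1))\<^sup>2 * ((y - y0) \<bullet> i)\<^sup>2)"
          unfolding norm_gradient_square sum_Basis_half_space using e1 e2
          by (simp add: power_mult_distrib mult_ac)
        also have "\<dots> = (f' t)\<^sup>2 + g\<^sup>2"
          unfolding sum_distrib_left[symmetric] sum_inner_Basis_square r_def[symmetric]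
          by (simp add: g_def power_mult_distrib)
        finally have G: "(norm (gradient z \<xi>))\<^sup>2 = (f' t)\<^sup>2 + g\<^sup>2" .
        have "\<bar>f' t\<bar> \<le> norm (gradient z \<xi>)" by (rule abs_le_square_iff[THEN iffD2, of "f' t" "norm (gradient z \<xi>)", simplified]) (simp add: G)
        hence 2: "\<theta> * \<beta> * \<bar>f' t\<bar> powr q \<le> \<theta> * \<beta> * norm (gradient z \<xi>) powr q"
          using t beta q by (intro mult_left_mono powr_mono2) auto
        have "g \<le> norm (gradient z \<xi>)" by (rule power2_le_imp_le) (auto simp: G)
        hence "(1 - \<theta>) * \<beta> * g powr q \<le> (1 - \<theta>) * \<beta> * norm (gradient z \<xi>) powr q"
          using t beta q g0 by (intro mult_left_mono powr_mono2) auto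
        with 1 2 show ?thesis by (simp add: algebra_simps)
      qed
      finally show False using eq[OF xiH] by simp
    qed
  qed
qed

section \<open>Comparison from below, with a barrier of linear growth\<close>

lemma powr_add_le_add_powr:
  fixes a b r :: real
  assumes "0 \<le> a" "0 \<le> b" "0 < r" "r \<le> 1"
  shows "(a + b) powr r \<le> a powr r + b powr r"
proof (cases "a = 0 \<or> b = 0")
  case False
  hence ab: "0 < a" "0 < b" using assms by auto
  have "(a + b) powr r = (a + b) * (a + b) powr (r - 1)" using ab by (simp add: powr_diff)
  also have "\<dots> = a * (a + b) powr (r - 1) + b * (a + b) powr (r - 1)" by (simp add: algebra_simps)
  also have "\<dots> \<le> a * a powr (r - 1) + b * b powr (r - 1)"
    using ab assms by (intro add_mono mult_left_mono powr_mono2') auto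
  also have "\<dots> = a powr r + b powr r" using ab by (simp add: powr_diff)
  finally show ?thesis .
qed auto

text \<open>Unlike r, the function sqrt (1 + r^2) is smooth at the centre; it still grows linearly,
  and its first and second derivatives have size at most 1. The barrier therefore costs a multiple
  of \<eta> in the Laplacian and at most \<eta> in the gradient.\<close>

lemma dir2_sqrt_barrier:
  fixes y y0 :: "'a::euclidean_space"
  assumes b: "b \<in> Basis"
  defines "s \<equiv> (norm (y - y0))\<^sup>2" and "c \<equiv> (y - y0) \<bullet> b"
  shows "dir2 (\<lambda>y. - (\<epsilon> + \<eta> * (sqrt (1 + (norm (y - y0))\<^sup>2) - 1))) b y (- \<eta> * c / sqrt (1 + s))
     (- \<eta> * (1 / sqrt (1 + s) - c\<^sup>2 / ((1 + s) * sqrt (1 + s))))"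
proof -
  have nn: "(norm (y + t *\<^sub>R b - y0))\<^sup>2 = s + 2 * t * c + t\<^sup>2" for t
    unfolding s_def c_def by (rule norm_add_Basis_square[OF b])
  have pos: "0 < 1 + (s + 2 * t * c + t\<^sup>2)" for t
    unfolding nn[symmetric] by (simp add: add_pos_nonneg)
  have pos0: "0 < 1 + s" by (simp add: s_def add_pos_nonneg)
  have half: "inverse r / 2 * (2 * x) = x / r" for r x :: real
    by (simp add: field_simps)
  have quot: "(r - c * (c / r)) / (r * r) = 1 / r - c\<^sup>2 / ((r * r) * r)" if "r > 0" for r
    using that by (simp add: field_simps power2_eq_square)
  have dsq: "((\<lambda>t. sqrt (1 + (s + 2 * t * c + t\<^sup>2))) has_real_derivative
      (c + t) / sqrt (1 + (s + 2 * t * c + t\<^sup>2))) (at t)" for t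
  proof -
    have "((\<lambda>t. 1 + (s + 2 * t * c + t\<^sup>2)) has_real_derivative 2 * (c + t)) (at t)"
      by (auto intro!: derivative_eq_intros)
    from DERIV_chain2[OF DERIV_real_sqrt[OF pos] this] show ?thesis
      by (rule DERIV_cong) (rule half)
  qed
  show ?thesis
  proof (rule dir2I)
    show "\<forall>\<^sub>F t in nhds 0. ((\<lambda>t. - (\<epsilon> + \<eta> * (sqrt (1 + (norm (y + t *\<^sub>R b - y0))\<^sup>2) - 1))) has_real_derivative
       - \<eta> * ((c + t) / sqrt (1 + (s + 2 * t * c + t\<^sup>2)))) (at t)"
      unfolding nn
      by (intro always_eventually allI
            DERIV_cong[OF DERIV_minus[OF DERIV_add[OF DERIV_const DERIV_cmult[OF DERIV_diff[OF dsq DERIV_const]]]]]) simp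
    have "((\<lambda>t. (c + t) / sqrt (1 + (s + 2 * t * c + t\<^sup>2))) has_real_derivative
        (1 * sqrt (1 + (s + 2 * 0 * c + 0\<^sup>2)) - (c + 0) * ((c + 0) / sqrt (1 + (s + 2 * 0 * c + 0\<^sup>2)))) /
        (sqrt (1 + (s + 2 * 0 * c + 0\<^sup>2)) * sqrt (1 + (s + 2 * 0 * c + 0\<^sup>2)))) (at 0)"
      using pos0 by (intro DERIV_divide dsq) (auto intro!: derivative_eq_intros)
    from DERIV_cmult[OF this, of "- \<eta>"]
    show "((\<lambda>t. - \<eta> * ((c + t) / sqrt (1 + (s + 2 * t * c + t\<^sup>2)))) has_real_derivative
        - \<eta> * (1 / sqrt (1 + s) - c\<^sup>2 / ((1 + s) * sqrt (1 + s)))) (at 0)"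
      by (rule DERIV_cong) (use quot[of "sqrt (1 + s)"] pos0 in simp)
  qed simp
qed

text \<open>The bound \<open>m \<le> z\<close> replaces blow-up of the barrier: since
  \<open>f \<le> B\<close>, a slow linear descent in \<xi>' brings the comparison function below
  \<open>m\<close> on a large sphere. At a contact point \<open>f - \<epsilon>\<close> still exceeds
  \<open>z\<close>, hence \<open>f > m + \<epsilon>\<close>, and the differential inequality is
  demanded only there. Its extra terms are the cost of the barrier: n \<eta> for the Laplacian and
  \<beta> \<eta>^q for the gradient.\<close>

lemma lower_comparison:
  assumes m: "0 \<le> m" "\<And>\<xi>. \<xi> \<in> half_space \<Longrightarrow> m \<le> z \<xi>" and ee: "0 < \<epsilon>" "0 < \<eta>"
    and f1: "\<And>t. 0 < t \<Longrightarrow> (f has_real_derivative f' t) (at t)"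
    and f2: "\<And>t. 0 < t \<Longrightarrow> (f' has_real_derivative f'' t) (at t)"
    and fB: "\<And>t. 0 < t \<Longrightarrow> f t \<le> B"
    and ineq: "\<And>t. 0 < t \<Longrightarrow> m + \<epsilon> < f t \<Longrightarrow>
       \<alpha> * f t powr p + \<beta> * \<bar>f' t\<bar> powr q + (real (DIM(real^'m)) * \<eta> + \<beta> * \<eta> powr q) < f'' t"
    and top: "\<forall>\<^sub>F t in at_top. f t \<le> m + \<epsilon>"
    and bot: "\<And>K. compact K \<Longrightarrow> \<forall>\<^sub>F t in at_right 0. \<forall>y\<in>K. f t - \<epsilon> < z (t, y)"
    and t0: "0 < t0"
  shows "f t0 - \<epsilon> \<le> z (t0, y0)"
proof (rule ccontr)
  assume contra: "\<not> f t0 - \<epsilon> \<le> z (t0, y0)"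
  define n where "n = real (DIM(real^'m))"
  define U where "U = (\<lambda>y::real^'m. - (\<epsilon> + \<eta> * (sqrt (1 + (norm (y - y0))\<^sup>2) - 1)))"
  define W where "W = (\<lambda>\<xi>. f (fst \<xi>) + U (snd \<xi>))"
  have UE: "U y \<le> - \<epsilon>" for y using ee by (simp add: U_def)
  \<comment> \<open>Large enough for \<eta> (sqrt (1 + \<rho>^2) - 1) \<ge> |B - m|, because sqrt (1
    + \<rho>^2) \<ge> \<rho>.\<close>
  define \<rho> where "\<rho> = \<bar>B - m\<bar> / \<eta> + 1"
  have rho: "0 < \<rho>" using ee by (simp add: \<rho>_def add_nonneg_pos)
  have UB: "B + U y \<le> m" if "dist y0 y = \<rho>" for y
  proof -
    have "\<rho> \<le> sqrt (1 + (norm (y - y0))\<^sup>2)"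
      using that rho by (intro real_le_rsqrt) (simp add: dist_norm norm_minus_commute)
    hence "\<eta> * (\<bar>B - m\<bar> / \<eta>) \<le> \<eta> * (sqrt (1 + (norm (y - y0))\<^sup>2) - 1)"
      using ee by (intro mult_left_mono) (auto simp: \<rho>_def)
    thus ?thesis using ee by (simp add: U_def)
  qed
  obtain a' where a': "a' > 0" "\<And>t y. 0 < t \<Longrightarrow> t < a' \<Longrightarrow> y \<in> cball y0 \<rho> \<Longrightarrow> f t - \<epsilon> < z (t, y)"
    using bot[of "cball y0 \<rho>"] unfolding eventually_at_right_field by auto
  obtain A' where A': "\<And>t. A' \<le> t \<Longrightarrow> f t \<le> m + \<epsilon>"
    using top unfolding eventually_at_top_linorder by blast
  define a A where "a = min a' t0 / 2" and "A = max A' t0 + 1"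
  have aA: "0 < a" "a < a'" "a < t0" "t0 < A" "A' \<le> A" using a'(1) t0 by (auto simp: a_def A_def)
  define C where "C = {a..A} \<times> cball y0 \<rho>"
  have intC: "interior C = {a<..<A} \<times> ball y0 \<rho>"
    by (simp add: C_def interior_Times)
  have CH: "C \<subseteq> half_space" using aA by (auto simp: C_def half_space_def)
  have fc: "continuous_on {a..A} f"
    using DERIV_isCont[OF f1] aA by (intro continuous_at_imp_continuous_on) auto
  have "continuous_on C (\<lambda>\<xi>. f (fst \<xi>))"
    by (rule continuous_on_compose2[OF fc continuous_on_fst[OF continuous_on_id]]) (auto simp: C_def)
  hence Wc: "continuous_on C W" unfolding W_def U_def by (intro continuous_intros)
  obtain \<xi> where xi: "\<xi> \<in> interior C" "0 < W \<xi> - z \<xi>" "\<forall>\<^sub>F w in nhds \<xi>. W w - z w \<le> W \<xi> - z \<xi>"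
  proof (rule compact_positive_max_interior[of C "\<lambda>\<xi>. W \<xi> - z \<xi>" "(t0, y0)"])
    show "compact C" by (auto simp: C_def intro: compact_Times)
    show "continuous_on C (\<lambda>\<xi>. W \<xi> - z \<xi>)"
      using continuous_on_z CH Wc by (auto intro: continuous_on_subset continuous_on_diff)
    show "(t0, y0) \<in> C" using aA rho by (auto simp: C_def)
    show "0 < W (t0, y0) - z (t0, y0)" using contra by (simp add: W_def U_def)
    show "W w - z w \<le> 0" if "w \<in> C" "w \<notin> interior C" for w
    proof -
      obtain t y where w: "w = (t, y)" by (cases w)
      have ty: "t \<in> {a..A}" "y \<in> cball y0 \<rho>" using that by (auto simp: C_def w)
      have zm: "m \<le> z w" using m CH that by blast
      have "t = a \<or> t = A \<or> dist y0 y = \<rho>" using that ty unfolding intC by (auto simp: w)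
      thus ?thesis
      proof (elim disjE)
        assume "t = a"
        hence "f t - \<epsilon> < z w" using a'(2)[of t y] aA ty by (simp add: w)
        thus ?thesis using UE[of y] by (simp add: W_def w)
      next
        assume "t = A"
        hence "f t \<le> m + \<epsilon>" using A' aA by simp
        thus ?thesis using UE[of y] zm by (simp add: W_def w)
      next
        assume "dist y0 y = \<rho>"
        moreover have "f t \<le> B" using fB ty aA by auto
        ultimately show ?thesis using UB[of y] zm by (simp add: W_def w)
      qed
    qed
  qed (use that in blast)
  obtain t y where w: "\<xi> = (t, y)" by (cases \<xi>)
  have t: "0 < t" using xi(1) aA unfolding intC w by auto
  have xiH: "\<xi> \<in> half_space" using xi(1) CH interior_subset by blast
  define s where "s = (norm (y - y0))\<^sup>2"
  have s0: "0 \<le> s" by (simp add: s_def)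
  have evder: "\<forall>\<^sub>F t in nhds t. (f has_real_derivative f' t) (at t)"
    by (rule eventually_mono[OF eventually_nhds_in_open[of "{0<..}"]]) (use t f1 in auto)
  have e1: "f' t = partial_deriv (1, 0) z \<xi>" "f'' t \<le> partial_deriv (1, 0) (partial_deriv (1, 0) z) \<xi>"
  proof -
    have "dir2 W (1, 0) \<xi> (f' t) (f'' t)"
      unfolding W_def w by (rule dir2_split_fst[OF evder f2[OF t]])
    from dir2_local_max[OF this C2_on_dir2[OF C2 open_half_space xiH] xi(3)]
    show "f' t = partial_deriv (1, 0) z \<xi>" "f'' t \<le> partial_deriv (1, 0) (partial_deriv (1, 0) z) \<xi>"
      by (auto simp: Basis_prod_def)
  qed
  have e2: "- \<eta> * ((y - y0) \<bullet> i) / sqrt (1 + s) = partial_deriv (0, i) z \<xi>"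
      "- \<eta> * (1 / sqrt (1 + s) - ((y - y0) \<bullet> i)\<^sup>2 / ((1 + s) * sqrt (1 + s))) \<le> partial_deriv (0, i) (partial_deriv (0, i) z) \<xi>"
    if i: "i \<in> Basis" for i
  proof -
    have "dir2 W (0, i) \<xi> (- \<eta> * ((y - y0) \<bullet> i) / sqrt (1 + s))
        (- \<eta> * (1 / sqrt (1 + s) - ((y - y0) \<bullet> i)\<^sup>2 / ((1 + s) * sqrt (1 + s))))"
      unfolding W_def w U_def s_def by (rule dir2_split_snd[OF dir2_sqrt_barrier[OF i]])
    from dir2_local_max[OF this C2_on_dir2[OF C2 open_half_space xiH] xi(3)] i
    show "- \<eta> * ((y - y0) \<bullet> i) / sqrt (1 + s) = partial_deriv (0, i) z \<xi>"
      "- \<eta> * (1 / sqrt (1 + s) - ((y - y0) \<bullet> i)\<^sup>2 / ((1 + s) * sqrt (1 + s))) \<le> partial_deriv (0, i) (partial_deriv (0, i) z) \<xi>"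
      by (auto simp: Basis_prod_def)
  qed
  have "f'' t + - n * \<eta> \<le> f'' t + (\<Sum>i::real^'m\<in>Basis. - \<eta> * (1 / sqrt (1 + s) - ((y - y0) \<bullet> i)\<^sup>2 / ((1 + s) * sqrt (1 + s))))"
  proof -
    have "- \<eta> \<le> - \<eta> * (1 / sqrt (1 + s) - ((y - y0) \<bullet> i)\<^sup>2 / ((1 + s) * sqrt (1 + s)))" for i
    proof -
      have "1 / sqrt (1 + s) \<le> 1" using s0 by simp
      moreover have "0 \<le> ((y - y0) \<bullet> i)\<^sup>2 / ((1 + s) * sqrt (1 + s))" using s0 by simp
      ultimately have "1 / sqrt (1 + s) - ((y - y0) \<bullet> i)\<^sup>2 / ((1 + s) * sqrt (1 + s)) \<le> 1" by linarith
      thus ?thesis using ee mult_left_mono[of _ 1 \<eta>] by simp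
    qed
    hence "(\<Sum>i::real^'m\<in>Basis. - \<eta>) \<le> (\<Sum>i::real^'m\<in>Basis. - \<eta> * (1 / sqrt (1 + s) - ((y - y0) \<bullet> i)\<^sup>2 / ((1 + s) * sqrt (1 + s))))"
      by (intro sum_mono)
    thus ?thesis by (simp add: n_def)
  qed
  also have "\<dots> \<le> laplacian z \<xi>"
    unfolding laplacian_def sum_Basis_half_space using e1 e2 by (intro add_mono sum_mono) auto
  finally have lap: "f'' t - n * \<eta> \<le> laplacian z \<xi>" by simp
  have fz: "z \<xi> < f t - \<epsilon>" using xi(2) UE[of y] by (simp add: W_def w)
  have zm: "m \<le> z \<xi>" by (rule m(2)[OF xiH])
  have "(norm (gradient z \<xi>))\<^sup>2 = (f' t)\<^sup>2 + (\<Sum>i\<in>Basis. (\<eta>\<^sup>2 / (1 + s)) * ((y - y0) \<bullet> i)\<^sup>2)"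
    unfolding norm_gradient_square sum_Basis_half_space e1(1)[symmetric] using e2(1)[symmetric] s0
    by (simp add: power_mult_distrib power_divide)
  also have "\<dots> = (f' t)\<^sup>2 + (\<eta>\<^sup>2 / (1 + s)) * s"
    unfolding sum_distrib_left[symmetric] sum_inner_Basis_square s_def[symmetric] ..
  also have "(\<eta>\<^sup>2 / (1 + s)) * s \<le> \<eta>\<^sup>2" using s0 by (simp add: field_simps)
  finally have G: "(norm (gradient z \<xi>))\<^sup>2 \<le> (f' t)\<^sup>2 + \<eta>\<^sup>2" by simp
  \<comment> \<open>Rewritten as powers of squares, the orthogonal sum in \<open>G\<close> can be
    split by subadditivity of the power q/2, which is at most 1 because q \<le> 2.\<close>
  have sq: "(x\<^sup>2) powr (q / 2) = \<bar>x\<bar> powr q" for x :: real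
  proof (cases "x = 0")
    case False
    hence "x\<^sup>2 = \<bar>x\<bar> powr 2" by (simp add: powr_numeral)
    hence "(x\<^sup>2) powr (q / 2) = (\<bar>x\<bar> powr 2) powr (q / 2)" by (simp only:)
    thus ?thesis unfolding powr_powr by simp
  qed simp
  have "norm (gradient z \<xi>) powr q = ((norm (gradient z \<xi>))\<^sup>2) powr (q/2)" by (simp add: sq)
  also have "\<dots> \<le> ((f' t)\<^sup>2 + \<eta>\<^sup>2) powr (q/2)" using G q by (intro powr_mono2) auto
  also have "\<dots> \<le> ((f' t)\<^sup>2) powr (q/2) + (\<eta>\<^sup>2) powr (q/2)" using q by (intro powr_add_le_add_powr) auto
  also have "\<dots> = \<bar>f' t\<bar> powr q + \<eta> powr q" using ee by (simp add: sq)
  finally have "\<beta> * norm (gradient z \<xi>) powr q \<le> \<beta> * (\<bar>f' t\<bar> powr q + \<eta> powr q)"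
    using beta by (intro mult_left_mono) auto
  moreover have "\<alpha> * z \<xi> powr p \<le> \<alpha> * f t powr p"
    using fz zm m ee alpha p by (intro mult_left_mono powr_mono2) auto
  moreover have "\<alpha> * f t powr p + \<beta> * \<bar>f' t\<bar> powr q + (n * \<eta> + \<beta> * \<eta> powr q) < f'' t"
    unfolding n_def using ineq[OF t] fz zm by simp
  ultimately show False using lap eq[OF xiH] by (simp add: algebra_simps)
qed

end

section \<open>Interior gradient bound\<close>

lemma powr_ge_tangent:
  fixes q t s :: real
  assumes q: "1 \<le> q" and "0 < s" "0 \<le> t"
  shows "s powr q + q * s powr (q - 1) * (t - s) \<le> t powr q"
proof (cases "t = 0")
  case True
  have "s powr q = s powr (q - 1) * s" using assms by (simp add: powr_diff)
  hence "s powr q + q * s powr (q - 1) * (t - s) = (1 - q) * s powr q" using True by (simp add: algebra_simps)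
  thus ?thesis using q True by (simp add: mult_nonpos_nonneg)
next
  case False
  hence t: "0 < t" using assms by simp
  have "q * s powr (q - 1) * (t - s) \<le> t powr q - s powr q"
  proof (rule f''_imp_f'[where C = "{0<..}" and f' = "\<lambda>x. q * x powr (q - 1)" and f'' = "\<lambda>x. q * ((q - 1) * x powr (q - 2))"])
    show "((\<lambda>x. x powr q) has_real_derivative q * x powr (q - 1)) (at x)" if "x \<in> {0<..}" for x
      using that has_real_derivative_powr[of x q] by simp
    show "((\<lambda>x. q * x powr (q - 1)) has_real_derivative q * ((q - 1) * x powr (q - 2))) (at x)" if "x \<in> {0<..}" for x
      using that DERIV_cmult[OF has_real_derivative_powr[of x "q - 1"], of q] by (simp add: algebra_simps)
  qed (use q t assms in auto)
  thus ?thesis by simp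
qed

text \<open>Cauchy-Schwarz gives norm (b + v) - norm b \<ge> (b \<bullet> v) / norm b, which reduces
  the claim to the scalar tangent inequality.\<close>

lemma norm_powr_ge_tangent:
  fixes b v :: "'a::real_inner"
  assumes q: "1 \<le> q" and b: "b \<noteq> 0"
  shows "norm b powr q + q * norm b powr (q - 2) * (b \<bullet> v) \<le> norm (b + v) powr q"
proof -
  have nb: "0 < norm b" using b by simp
  have "norm b * norm (b + v) \<ge> b \<bullet> (b + v)" by (rule norm_cauchy_schwarz)
  hence "norm b * (norm (b + v) - norm b) \<ge> b \<bullet> v"
    by (simp add: inner_add_right power2_norm_eq_inner[symmetric] power2_eq_square algebra_simps)
  hence "q * norm b powr (q - 2) * (b \<bullet> v) \<le> q * norm b powr (q - 2) * (norm b * (norm (b + v) - norm b))"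
    using q by (intro mult_left_mono) auto
  also have "norm b powr (q - 2) * norm b = norm b powr (q - 1)"
    using nb powr_add[of "norm b" "q - 2" 1] by simp
  hence "q * norm b powr (q - 2) * (norm b * (norm (b + v) - norm b)) = q * norm b powr (q - 1) * (norm (b + v) - norm b)"
    by (metis mult.assoc)
  finally show ?thesis using powr_ge_tangent[OF q nb, of "norm (b + v)"] by simp
qed

text \<open>The function C x^2 - (1 + x)^(-\<gamma>) is convex on x \<ge> -1/2, because there (1 +
  x)^(-\<gamma>-2) \<le> 2^(\<gamma>+2); the claim is its tangent inequality at 0. This fixes the
  constant.\<close>

lemma one_plus_powr_neg_le:
  fixes \<gamma> d :: real
  assumes g: "0 < \<gamma>" and d: "- (1 / 2) \<le> d"
  shows "(1 + d) powr (- \<gamma>) \<le> 1 - \<gamma> * d + \<gamma> * (\<gamma> + 1) * 2 powr (\<gamma> + 2) * d\<^sup>2"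
proof -
  define C where "C = \<gamma> * (\<gamma> + 1) * 2 powr (\<gamma> + 2)"
  define f where "f = (\<lambda>x. C * x\<^sup>2 - (1 + x) powr (- \<gamma>))"
  have "(\<lambda>x. 2 * C * x + \<gamma> * (1 + x) powr (- \<gamma> - 1)) 0 * (d - 0) \<le> f d - f 0"
  proof (rule f''_imp_f'[where C = "{- (1/2)..}" and f'' = "\<lambda>x. 2 * C - \<gamma> * (\<gamma> + 1) * (1 + x) powr (- \<gamma> - 2)"])
    fix x :: real assume x: "x \<in> {- (1/2)..}"
    have p: "0 < 1 + x" using x by simp
    have l: "((\<lambda>x. 1 + x) has_real_derivative 1) (at x)" by (auto intro!: derivative_eq_intros)
    have d1: "((\<lambda>x. (1 + x) powr r) has_real_derivative r * (1 + x) powr (r - 1)) (at x)" for r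
      using DERIV_fun_powr[OF l p, of r] by simp
    show "(f has_real_derivative 2 * C * x + \<gamma> * (1 + x) powr (- \<gamma> - 1)) (at x)"
      unfolding f_def
      by (rule DERIV_cong[OF DERIV_diff[OF DERIV_cmult[OF DERIV_pow] d1]]) simp
    show "((\<lambda>x. 2 * C * x + \<gamma> * (1 + x) powr (- \<gamma> - 1)) has_real_derivative
        2 * C - \<gamma> * (\<gamma> + 1) * (1 + x) powr (- \<gamma> - 2)) (at x)"
      by (rule DERIV_cong[OF DERIV_add[OF DERIV_cmult[OF DERIV_ident] DERIV_cmult[OF d1]]]) (simp add: algebra_simps)
    have "(1 + x) powr (- \<gamma> - 2) \<le> (1/2) powr (- \<gamma> - 2)" using x g by (intro powr_mono2') auto
    also have "\<dots> = 2 powr (\<gamma> + 2)" using powr_minus[of 2 "- \<gamma> - 2"] by (simp add: powr_divide inverse_eq_divide add.commute)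
    finally have "\<gamma> * (\<gamma> + 1) * (1 + x) powr (- \<gamma> - 2) \<le> C"
      unfolding C_def using g by (intro mult_left_mono) auto
    moreover have "C \<ge> 0" using g by (simp add: C_def)
    ultimately show "0 \<le> 2 * C - \<gamma> * (\<gamma> + 1) * (1 + x) powr (- \<gamma> - 2)" by simp
  qed (use d in auto)
  thus ?thesis unfolding f_def C_def by simp
qed

section \<open>Affine increments and the Bernstein inequality\<close>

lemma dir2_quadratic:
  fixes x x0 :: "'a::euclidean_space"
  assumes b: "b \<in> Basis"
  shows "dir2 (\<lambda>x. A * (1 + u \<bullet> (x - x0) + \<Lambda> * (norm (x - x0))\<^sup>2)) b x
    (A * (u \<bullet> b + 2 * \<Lambda> * ((x - x0) \<bullet> b))) (A * (2 * \<Lambda>))"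
proof -
  have eq: "u \<bullet> (x + t *\<^sub>R b - x0) = u \<bullet> (x - x0) + t * (u \<bullet> b)" for t
    by (simp add: inner_diff_right inner_add_right algebra_simps)
  show ?thesis
  proof (rule dir2I)
    show "\<forall>\<^sub>F t in nhds 0. ((\<lambda>t. A * (1 + u \<bullet> (x + t *\<^sub>R b - x0) + \<Lambda> * (norm (x + t *\<^sub>R b - x0))\<^sup>2)) has_real_derivative
        A * (u \<bullet> b + \<Lambda> * (2 * ((x - x0) \<bullet> b) + 2 * t))) (at t)"
      unfolding eq norm_add_Basis_square[OF b]
      by (intro always_eventually allI) (auto intro!: derivative_eq_intros)
    show "((\<lambda>t. A * (u \<bullet> b + \<Lambda> * (2 * ((x - x0) \<bullet> b) + 2 * t))) has_real_derivative A * (2 * \<Lambda>)) (at 0)"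
      by (auto intro!: derivative_eq_intros)
  qed (simp add: algebra_simps)
qed

lemma gradient_mean_value:
  fixes z :: "'a::euclidean_space \<Rightarrow> real"
  assumes z: "z differentiable_on S" "open S" and sub: "closed_segment x (x + h) \<subseteq> S"
  obtains \<xi> where "\<xi> \<in> closed_segment x (x + h)" "z (x + h) - z x = gradient z \<xi> \<bullet> h"
proof -
  have "((\<lambda>t. z (x + t *\<^sub>R h)) has_real_derivative gradient z (x + t *\<^sub>R h) \<bullet> h) (at t)" if "0 \<le> t" "t \<le> 1" for t
  proof -
    have "x + t *\<^sub>R h \<in> closed_segment x (x + h)"
      unfolding closed_segment_def using that by (intro CollectI exI[of _ t]) (simp add: algebra_simps)
    hence "(z has_derivative (\<lambda>v. gradient z (x + t *\<^sub>R h) \<bullet> v)) (at (x + t *\<^sub>R h))"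
      using sub by (intro frechet_derivative_eq_gradient[OF z]) auto
    moreover have "((\<lambda>t. x + t *\<^sub>R h) has_derivative (\<lambda>t. t *\<^sub>R h)) (at t)"
      by (auto intro!: derivative_eq_intros)
    ultimately have "((\<lambda>t. z (x + t *\<^sub>R h)) has_derivative (\<lambda>s. gradient z (x + t *\<^sub>R h) \<bullet> (s *\<^sub>R h))) (at t)"
      by (rule has_derivative_compose[rotated])
    thus ?thesis unfolding has_field_derivative_def by (simp add: mult.commute[of _ "gradient z (x + t *\<^sub>R h) \<bullet> h"])
  qed
  from MVT2[OF zero_less_one this] obtain t where t: "0 < t" "t < 1"
    "z (x + 1 *\<^sub>R h) - z (x + 0 *\<^sub>R h) = (1 - 0) * (gradient z (x + t *\<^sub>R h) \<bullet> h)" by blast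
  show ?thesis
  proof (rule that)
    show "x + t *\<^sub>R h \<in> closed_segment x (x + h)"
      unfolding closed_segment_def using t by (intro CollectI exI[of _ t]) (simp add: algebra_simps)
  qed (use t in simp)
qed

text \<open>The Bernstein argument for a solution that is only twice differentiable: instead of differentiating
  the equation, apply the maximum principle to the increment of \<open>z\<close> under the affine map
  \<open>x \<mapsto> x + \<epsilon> (e + \<kappa> (x - x0))\<close>. Its dilation part \<open>\<kappa>\<close> produces the coercive term.\<close>

lemma increment_maximum:
  fixes z :: "'a::euclidean_space \<Rightarrow> real"
  assumes C2: "C2_on S z" and S: "open S"
    and P: "P = norm (gradient z x0)" "0 < P" and e: "e = gradient z x0 /\<^sub>R P"
    and kap: "0 \<le> \<kappa>" and Lam: "\<Lambda> < \<Lambda>'" and rho: "0 < \<rho>"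
    and sub: "cball x0 (2 * \<rho>) \<subseteq> S"
    and bnd: "\<And>y. norm y \<le> \<rho> \<Longrightarrow> norm (gradient z (x0 + y)) * ((1 + (norm (e + \<kappa> *\<^sub>R y))\<^sup>2) / 2)
        \<le> P * (1 + (g + \<kappa> *\<^sub>R e) \<bullet> y + \<Lambda> * (norm y)\<^sup>2)"
  shows "\<exists>\<epsilon> x x'. 0 < \<epsilon> \<and> \<epsilon> < \<rho> \<and> norm (x - x0) < \<rho> \<and> x' \<in> S \<and>
     (1 + \<epsilon> * \<kappa>) *\<^sub>R gradient z x' = gradient z x + \<epsilon> *\<^sub>R (P *\<^sub>R (g + \<kappa> *\<^sub>R e + (2 * \<Lambda>') *\<^sub>R (x - x0))) \<and>
     (1 + \<epsilon> * \<kappa>)\<^sup>2 * laplacian z x' - laplacian z x \<le> \<epsilon> * P * (2 * real DIM('a) * \<Lambda>')"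
proof -
  define M where "M = 1 + \<kappa> * \<rho>"
  have M: "1 \<le> M" using kap rho by (simp add: M_def)
  have ne: "norm e = 1" using P e by simp
  have ge: "gradient z x0 \<bullet> e = P"
    using P e by (simp add: power2_norm_eq_inner[symmetric] power2_eq_square)
  have diff: "z differentiable_on S" using C2 by (simp add: C2_on_def)
  have gc: "continuous_on (cball x0 (2 * \<rho>)) (gradient z)"
    using C2_on_gradient_continuous[OF C2] sub continuous_on_subset by blast
  \<comment> \<open>Allowed oscillation of the gradient along one displacement. Relative to the step
    length, the error is at most \<delta> M on the sphere and \<delta> at the centre, together less
    than the gain P (\<Lambda>' - \<Lambda>) \<rho>^2 from raising \<Lambda> to \<Lambda>'.\<close>
  define \<delta> where "\<delta> = P * (\<Lambda>' - \<Lambda>) * \<rho>\<^sup>2 / (2 * (M + 1))"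
  have del: "0 < \<delta>" using P Lam rho M by (simp add: \<delta>_def)
  have del2: "\<delta> * M + \<delta> < P * (\<Lambda>' - \<Lambda>) * \<rho>\<^sup>2"
  proof -
    have "\<delta> * (2 * (M + 1)) = P * (\<Lambda>' - \<Lambda>) * \<rho>\<^sup>2" using M by (simp add: \<delta>_def)
    moreover have "0 < \<delta> * (M + 1)" using del M by simp
    ultimately show ?thesis by (simp add: algebra_simps)
  qed
  have "uniformly_continuous_on (cball x0 (2 * \<rho>)) (gradient z)"
    using gc by (intro compact_uniformly_continuous) auto
  then obtain d where d: "d > 0" "\<And>x x'. x \<in> cball x0 (2 * \<rho>) \<Longrightarrow> x' \<in> cball x0 (2 * \<rho>) \<Longrightarrow> dist x' x < d \<Longrightarrow>
      dist (gradient z x') (gradient z x) < \<delta>"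
    using del unfolding uniformly_continuous_on_def by metis
  \<comment> \<open>The displacement has length at most \<epsilon> M: shorter than \<open>d\<close>
    for uniform continuity, and shorter than \<rho> to stay in the doubled ball.\<close>
  define \<epsilon> where "\<epsilon> = min d \<rho> / (2 * M)"
  have eps: "0 < \<epsilon>" "\<epsilon> * M < d" "\<epsilon> * M < \<rho>" using d rho M by (auto simp: \<epsilon>_def)
  have eps2: "\<epsilon> < \<rho>" using eps mult_left_mono[OF M, of \<epsilon>] by linarith
  define h where "h = (\<lambda>x. \<epsilon> *\<^sub>R (e + \<kappa> *\<^sub>R (x - x0)))"
  have hM: "norm (e + \<kappa> *\<^sub>R (x - x0)) \<le> M" if "norm (x - x0) \<le> \<rho>" for x
  proof -
    have "norm (e + \<kappa> *\<^sub>R (x - x0)) \<le> norm e + norm (\<kappa> *\<^sub>R (x - x0))" by (rule norm_triangle_ineq)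
    also have "\<dots> \<le> M" using ne kap that by (simp add: M_def mult_left_mono)
    finally show ?thesis .
  qed
  have seg: "closed_segment x (x + h x) \<subseteq> cball x0 (2 * \<rho>)"
    and near: "\<And>\<xi>. \<xi> \<in> closed_segment x (x + h x) \<Longrightarrow> norm (gradient z \<xi> - gradient z x) < \<delta>"
    if "norm (x - x0) \<le> \<rho>" for x
  proof -
    have nh: "norm (h x) \<le> \<epsilon> * M" using hM[OF that] eps by (simp add: h_def)
    have "x \<in> cball x0 (2 * \<rho>)" "x + h x \<in> cball x0 (2 * \<rho>)"
      using that nh eps rho norm_triangle_ineq[of "x - x0" "h x"]
      by (auto simp: dist_norm norm_minus_commute[of x0] algebra_simps)
    thus 1: "closed_segment x (x + h x) \<subseteq> cball x0 (2 * \<rho>)"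
      by (intro closed_segment_subset) auto
    fix \<xi> assume xi: "\<xi> \<in> closed_segment x (x + h x)"
    have "dist \<xi> x \<le> norm (h x)" using segment_bound1[OF xi] by (simp add: dist_norm)
    hence "dist \<xi> x < d" using nh eps by simp
    thus "norm (gradient z \<xi> - gradient z x) < \<delta>"
      using d(2)[of x \<xi>] 1 xi subsetD[OF 1, of x] by (auto simp: dist_norm[of "gradient z \<xi>"])
  qed
  define Q where "Q = (\<lambda>x. \<epsilon> * P * (1 + (g + \<kappa> *\<^sub>R e) \<bullet> (x - x0) + \<Lambda>' * (norm (x - x0))\<^sup>2))"
  define F where "F = (\<lambda>x. (z (x + h x) - z x) - Q x)"
  \<comment> \<open>A separating level: F \<le> L on the sphere of radius \<rho> while L < F x0, so
    the maximum of F - L is interior.\<close>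
  define L where "L = \<epsilon> * (\<delta> * M - P * (\<Lambda>' - \<Lambda>) * \<rho>\<^sup>2)"
  have bd: "F x \<le> L" if x: "norm (x - x0) = \<rho>" for x
  proof -
    obtain \<xi> where xi: "\<xi> \<in> closed_segment x (x + h x)" "z (x + h x) - z x = gradient z \<xi> \<bullet> h x"
      using gradient_mean_value[OF diff S] seg[of x] sub x by (metis dual_order.trans order_refl)
    define m where "m = norm (e + \<kappa> *\<^sub>R (x - x0))"
    have "norm (gradient z \<xi>) \<le> norm (gradient z x) + \<delta>"
      using near[OF _ xi(1)] x norm_triangle_sub[of "gradient z \<xi>" "gradient z x"] by simp
    hence "gradient z \<xi> \<bullet> h x \<le> (norm (gradient z x) + \<delta>) * (\<epsilon> * m)"
      using norm_cauchy_schwarz[of "gradient z \<xi>" "h x"] eps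
        mult_right_mono[of "norm (gradient z \<xi>)" "norm (gradient z x) + \<delta>" "\<epsilon> * m"]
      by (simp add: h_def m_def)
    also have "\<dots> = \<epsilon> * (norm (gradient z x) * m + \<delta> * m)" by (simp add: algebra_simps)
    also have "\<dots> \<le> \<epsilon> * (norm (gradient z x) * ((1 + m\<^sup>2) / 2) + \<delta> * M)"
    proof (intro mult_left_mono add_mono)
      \<comment> \<open>Trades the length of the displacement direction for the polynomial weight in
        \<open>bnd\<close>. Equality holds at m = 1, the value at the centre, so nothing is lost to
        first order.\<close>
      show "m \<le> (1 + m\<^sup>2) / 2" using zero_le_power2[of "m - 1"] by (simp add: power2_eq_square algebra_simps)
      show "m \<le> M" using hM x by (simp add: m_def)
    qed (use eps del in auto)
    also have "\<dots> \<le> \<epsilon> * (P * (1 + (g + \<kappa> *\<^sub>R e) \<bullet> (x - x0) + \<Lambda> * \<rho>\<^sup>2) + \<delta> * M)"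
      using bnd[of "x - x0"] x eps del by (intro mult_left_mono add_mono) (auto simp: m_def)
    finally show ?thesis unfolding F_def Q_def L_def xi(2) using x by (simp add: algebra_simps)
  qed
  have F0: "L < F x0"
  proof -
    obtain \<xi> where xi: "\<xi> \<in> closed_segment x0 (x0 + h x0)" "z (x0 + h x0) - z x0 = gradient z \<xi> \<bullet> h x0"
      using gradient_mean_value[OF diff S] seg[of x0] sub rho by (metis dual_order.trans norm_zero diff_self order_less_imp_le)
    have "norm (gradient z \<xi> - gradient z x0) \<le> \<delta>" using near[OF _ xi(1)] rho by simp
    hence "\<bar>(gradient z \<xi> - gradient z x0) \<bullet> e\<bar> \<le> \<delta>"
      using Cauchy_Schwarz_ineq2[of "gradient z \<xi> - gradient z x0" e] ne by simp
    hence "P - \<delta> \<le> gradient z \<xi> \<bullet> e" using ge by (simp add: inner_diff_left)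
    hence "\<epsilon> * (P - \<delta>) \<le> gradient z \<xi> \<bullet> h x0"
      using eps by (simp add: h_def mult_left_mono)
    hence "- \<epsilon> * \<delta> \<le> F x0" unfolding F_def Q_def xi(2) by (simp add: algebra_simps)
    moreover have "L < - \<epsilon> * \<delta>"
    proof -
      have "\<epsilon> * (\<delta> * M + \<delta>) < \<epsilon> * (P * (\<Lambda>' - \<Lambda>) * \<rho>\<^sup>2)" using eps del2 by (intro mult_strict_left_mono) auto
      thus ?thesis by (simp add: L_def algebra_simps)
    qed
    ultimately show ?thesis by simp
  qed
  \<comment> \<open>The displaced point is an affine function of x, which brings
    \<open>C2_on_dir2_affine\<close> into play.\<close>
  define s c where "s = 1 + \<epsilon> * \<kappa>" and "c = \<epsilon> *\<^sub>R (e - \<kappa> *\<^sub>R x0)"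
  have xh: "x + h x = c + s *\<^sub>R x" for x
    by (simp add: h_def s_def c_def algebra_simps)
  have hin: "x + h x \<in> S" "x \<in> S" if "norm (x - x0) \<le> \<rho>" for x
    using seg[OF that] sub by auto
  have zc: "continuous_on S z" using diff by (rule differentiable_imp_continuous_on)
  have hc: "continuous_on (cball x0 \<rho>) (\<lambda>x. x + h x)" unfolding h_def by (intro continuous_intros)
  have nb: "norm (x - x0) \<le> \<rho>" if "x \<in> cball x0 \<rho>" for x using that by (simp add: dist_norm norm_minus_commute)
  have c1: "continuous_on (cball x0 \<rho>) (\<lambda>x. z (x + h x))"
    by (rule continuous_on_compose2[OF zc hc]) (use hin nb in auto)
  have c2: "continuous_on (cball x0 \<rho>) z"
    by (rule continuous_on_subset[OF zc]) (use hin nb in auto)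
  have Fc: "continuous_on (cball x0 \<rho>) F"
    unfolding F_def Q_def using c1 c2 by (intro continuous_intros)
  obtain x where x: "x \<in> interior (cball x0 \<rho>)" "0 < F x - L" "\<forall>\<^sub>F w in nhds x. F w - L \<le> F x - L"
  proof (rule compact_positive_max_interior[of "cball x0 \<rho>" "\<lambda>x. F x - L" x0])
    show "continuous_on (cball x0 \<rho>) (\<lambda>x. F x - L)" using Fc by (intro continuous_intros)
    show "F y - L \<le> 0" if "y \<in> cball x0 \<rho>" "y \<notin> interior (cball x0 \<rho>)" for y
      using bd[of y] that by (auto simp: dist_norm norm_minus_commute)
  qed (use F0 rho in auto)
  have xr: "norm (x - x0) < \<rho>" using x(1) by (simp add: dist_norm norm_minus_commute)
  have xS: "c + s *\<^sub>R x \<in> S" "x \<in> S" using hin[of x] xr by (auto simp: xh)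
  have mx: "\<forall>\<^sub>F w in nhds x. (z (c + s *\<^sub>R w) - z w) - Q w \<le> (z (c + s *\<^sub>R x) - z x) - Q x"
    using x(3) unfolding F_def xh by (simp add: algebra_simps)
  have D: "s * partial_deriv b z (c + s *\<^sub>R x) - partial_deriv b z x =
        \<epsilon> * P * ((g + \<kappa> *\<^sub>R e) \<bullet> b + 2 * \<Lambda>' * ((x - x0) \<bullet> b))"
      "s\<^sup>2 * partial_deriv b (partial_deriv b z) (c + s *\<^sub>R x) - partial_deriv b (partial_deriv b z) x \<le> \<epsilon> * P * (2 * \<Lambda>')"
    if b: "b \<in> Basis" for b
    using dir2_local_max[OF dir2_diff[OF C2_on_dir2_affine[OF C2 S xS(1) b] C2_on_dir2[OF C2 S xS(2) b]] _ mx]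
      dir2_quadratic[OF b] unfolding Q_def by blast+
  have "s *\<^sub>R gradient z (c + s *\<^sub>R x) = gradient z x + \<epsilon> *\<^sub>R (P *\<^sub>R (g + \<kappa> *\<^sub>R e + (2 * \<Lambda>') *\<^sub>R (x - x0)))"
  proof (rule euclidean_eqI)
    fix b :: 'a assume b: "b \<in> Basis"
    show "(s *\<^sub>R gradient z (c + s *\<^sub>R x)) \<bullet> b = (gradient z x + \<epsilon> *\<^sub>R (P *\<^sub>R (g + \<kappa> *\<^sub>R e + (2 * \<Lambda>') *\<^sub>R (x - x0)))) \<bullet> b"
      using D(1)[OF b] by (simp add: inner_add_left gradient_inner_Basis[OF b] mult.assoc)
  qed
  moreover have "s\<^sup>2 * laplacian z (c + s *\<^sub>R x) - laplacian z x \<le> \<epsilon> * P * (2 * real DIM('a) * \<Lambda>')"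
  proof -
    have "s\<^sup>2 * laplacian z (c + s *\<^sub>R x) - laplacian z x =
        (\<Sum>b\<in>Basis. s\<^sup>2 * partial_deriv b (partial_deriv b z) (c + s *\<^sub>R x) - partial_deriv b (partial_deriv b z) x)"
      by (simp add: laplacian_def sum_distrib_left sum_subtractf)
    also have "\<dots> \<le> (\<Sum>b\<in>(Basis::'a set). \<epsilon> * P * (2 * \<Lambda>'))" using D(2) by (intro sum_mono)
    finally show ?thesis by (simp add: algebra_simps)
  qed
  ultimately show ?thesis using eps eps2 xr xS unfolding s_def by blast
qed

text \<open>Divide the second-order condition of \<open>increment_maximum\<close> by \<epsilon> and
  shrink the ball. By the equation, its left side is \<beta> times a difference of gradient powers
  with the factor s^2, s = 1 + \<epsilon> \<kappa>. The dilation contributes (2 - q) \<kappa> and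
  the change of the gradient q (\<kappa> + e \<bullet> g), so q cancels from the coefficient of
  \<kappa> and the coercive term is 2 \<kappa> for every q.\<close>

lemma bernstein_inequality:
  fixes z :: "'a::euclidean_space \<Rightarrow> real"
  assumes q: "1 < q" "q \<le> 2" and beta: "0 < \<beta>"
    and C2: "C2_on S z" and S: "open S"
    and eq: "\<And>x. x \<in> S \<Longrightarrow> laplacian z x = \<beta> * norm (gradient z x) powr q"
    and P: "P = norm (gradient z x0)" "0 < P" and e: "e = gradient z x0 /\<^sub>R P"
    and kap: "0 < \<kappa>" and Lam: "\<Lambda> < \<Lambda>'" and rho: "0 < \<rho>"
    and sub: "cball x0 (2 * \<rho>) \<subseteq> S"
    and bnd: "\<And>y. norm y \<le> \<rho> \<Longrightarrow> norm (gradient z (x0 + y)) * ((1 + (norm (e + \<kappa> *\<^sub>R y))\<^sup>2) / 2)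
        \<le> P * (1 + (g + \<kappa> *\<^sub>R e) \<bullet> y + \<Lambda> * (norm y)\<^sup>2)"
  shows "\<beta> * P powr q * (2 * \<kappa> + q * (e \<bullet> g)) \<le> P * (2 * real DIM('a) * \<Lambda>')"
proof -
  define T where "T = P * (2 * real DIM('a) * \<Lambda>')"
  define w where "w = (\<lambda>x. P *\<^sub>R (g + \<kappa> *\<^sub>R e + (2 * \<Lambda>') *\<^sub>R (x - x0)))"
  \<comment> \<open>Shrinking radii force the step lengths to tend to 0 and the maximum points to
    tend to \<open>x0\<close>.\<close>
  define \<rho>s where "\<rho>s = (\<lambda>n. \<rho> / real (Suc n))"
  have rs: "0 < \<rho>s n" "\<rho>s n \<le> \<rho>" for n using rho by (auto simp: \<rho>s_def field_simps)
  have "\<exists>\<epsilon> x x'. 0 < \<epsilon> \<and> \<epsilon> < \<rho>s n \<and> norm (x - x0) < \<rho>s n \<and> x' \<in> S \<and>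
     (1 + \<epsilon> * \<kappa>) *\<^sub>R gradient z x' = gradient z x + \<epsilon> *\<^sub>R w x \<and>
     (1 + \<epsilon> * \<kappa>)\<^sup>2 * laplacian z x' - laplacian z x \<le> \<epsilon> * T" for n
  proof -
    have s1: "cball x0 (2 * \<rho>s n) \<subseteq> S" using sub rs(2)[of n] by auto
    have s2: "norm (gradient z (x0 + y)) * ((1 + (norm (e + \<kappa> *\<^sub>R y))\<^sup>2) / 2)
        \<le> P * (1 + (g + \<kappa> *\<^sub>R e) \<bullet> y + \<Lambda> * (norm y)\<^sup>2)" if "norm y \<le> \<rho>s n" for y
      using bnd[of y] that rs(2)[of n] by simp
    have "0 \<le> \<kappa>" using kap by simp
    from increment_maximum[OF C2 S P e this Lam rs(1)[of n] s1 s2]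
    show ?thesis unfolding w_def T_def by (simp only: mult.assoc)
  qed
  then obtain \<epsilon> x x' where X: "\<And>n. 0 < \<epsilon> n" "\<And>n. \<epsilon> n < \<rho>s n" "\<And>n. norm (x n - x0) < \<rho>s n" "\<And>n. x' n \<in> S"
     "\<And>n. (1 + \<epsilon> n * \<kappa>) *\<^sub>R gradient z (x' n) = gradient z (x n) + \<epsilon> n *\<^sub>R w (x n)"
     "\<And>n. (1 + \<epsilon> n * \<kappa>)\<^sup>2 * laplacian z (x' n) - laplacian z (x n) \<le> \<epsilon> n * T"
    by metis
  have rlim: "\<rho>s \<longlonglongrightarrow> 0"
    unfolding \<rho>s_def using LIMSEQ_Suc[OF lim_const_over_n[of \<rho>]] by simp
  have elim: "\<epsilon> \<longlonglongrightarrow> 0"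
    by (rule tendsto_sandwich[OF _ _ tendsto_const rlim]) (auto intro!: always_eventually less_imp_le X(1,2))
  have xlim: "x \<longlonglongrightarrow> x0"
  proof -
    have "(\<lambda>n. norm (x n - x0)) \<longlonglongrightarrow> 0"
      by (rule tendsto_sandwich[OF _ _ tendsto_const rlim]) (auto intro!: always_eventually less_imp_le X(3))
    thus ?thesis by (simp add: LIM_zero_iff tendsto_norm_zero_iff)
  qed
  have x0S: "x0 \<in> S" using sub rho by auto
  have xS: "x n \<in> S" for n
  proof -
    have "norm (x n - x0) \<le> 2 * \<rho>" using X(3)[of n] rs(2)[of n] rho by linarith
    thus ?thesis using sub by (auto simp: dist_norm norm_minus_commute)
  qed
  have glim: "(\<lambda>n. gradient z (x n)) \<longlonglongrightarrow> gradient z x0"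
    by (rule continuous_on_tendsto_compose[OF C2_on_gradient_continuous[OF C2] xlim x0S]) (simp add: xS)
  have wlim: "(\<lambda>n. w (x n)) \<longlonglongrightarrow> w x0"
    unfolding w_def by (intro tendsto_intros xlim)
  \<comment> \<open>From s^2 = s^r s^q: the factor s^q moves into the gradient power, where the
    first-order condition controls s times the displaced gradient, and s^r remains outside.\<close>
  define r where "r = 2 - q"
  have ineq: "\<beta> * (((1 + \<epsilon> n * \<kappa>) powr r - 1) / \<epsilon> n * norm (gradient z (x n)) powr q +
      (1 + \<epsilon> n * \<kappa>) powr r * (q * norm (gradient z (x n)) powr (q - 2) * (gradient z (x n) \<bullet> w (x n)))) \<le> T"
    if nz: "gradient z (x n) \<noteq> 0" for n
  proof -
    define s where "s = 1 + \<epsilon> n * \<kappa>"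
    have s: "0 < s" using X(1)[of n] kap by (simp add: s_def add_pos_nonneg)
    define b where "b = gradient z (x n)"
    define B where "B = norm b powr q"
    define E where "E = q * norm b powr (q - 2) * (b \<bullet> w (x n))"
    \<comment> \<open>Convexity has the right direction: the power of the displaced gradient is
      bounded below by its tangent at \<open>b\<close>.\<close>
    have "B + q * norm b powr (q - 2) * (b \<bullet> (\<epsilon> n *\<^sub>R w (x n))) \<le> norm (b + \<epsilon> n *\<^sub>R w (x n)) powr q"
      unfolding B_def by (rule norm_powr_ge_tangent) (use q nz in \<open>auto simp: b_def\<close>)
    hence t: "B + \<epsilon> n * E \<le> norm (s *\<^sub>R gradient z (x' n)) powr q"
      unfolding s_def X(5) b_def[symmetric] by (simp add: E_def algebra_simps)
    have "s\<^sup>2 = s powr r * s powr q" using s by (simp add: r_def powr_add[symmetric] powr_numeral)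
    hence "s\<^sup>2 * norm (gradient z (x' n)) powr q = s powr r * norm (s *\<^sub>R gradient z (x' n)) powr q"
      using s by (simp add: powr_mult)
    hence "s powr r * (B + \<epsilon> n * E) \<le> s\<^sup>2 * norm (gradient z (x' n)) powr q"
      using mult_left_mono[OF t, of "s powr r"] by simp
    hence "\<beta> * (s powr r * (B + \<epsilon> n * E) - B) \<le> \<beta> * (s\<^sup>2 * norm (gradient z (x' n)) powr q - B)"
      using beta by (intro mult_left_mono) auto
    also have "\<dots> = s\<^sup>2 * laplacian z (x' n) - laplacian z (x n)"
      using eq[OF X(4)[of n]] eq[OF xS[of n]] by (simp add: B_def b_def algebra_simps)
    also have "\<dots> \<le> \<epsilon> n * T" using X(6)[of n] by (simp add: s_def)
    finally have "\<beta> * (s powr r * (B + \<epsilon> n * E) - B) / \<epsilon> n \<le> T"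
      using X(1)[of n] by (simp add: field_simps)
    moreover have "\<beta> * (s powr r * (B + \<epsilon> n * E) - B) / \<epsilon> n = \<beta> * ((s powr r - 1) / \<epsilon> n * B + s powr r * E)"
      using X(1)[of n] by (simp add: field_simps)
    ultimately show ?thesis unfolding s_def B_def E_def b_def by simp
  qed
  have g0: "gradient z x0 \<noteq> 0" using P by auto
  have ev: "\<forall>\<^sub>F n in sequentially. gradient z (x n) \<noteq> 0"
    using tendsto_imp_eventually_ne[OF glim g0] .
  have dlim: "(\<lambda>n. ((1 + \<epsilon> n * \<kappa>) powr r - 1) / \<epsilon> n) \<longlonglongrightarrow> r * \<kappa>"
  proof -
    have l: "((\<lambda>t. 1 + t * \<kappa>) has_real_derivative \<kappa>) (at 0)" by (auto intro!: derivative_eq_intros)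
    have "((\<lambda>t. (1 + t * \<kappa>) powr r) has_real_derivative r * \<kappa>) (at 0)"
      using DERIV_fun_powr[OF l, of r] by simp
    hence "((\<lambda>h. ((1 + h * \<kappa>) powr r - 1) / h) \<longlongrightarrow> r * \<kappa>) (at 0)"
      unfolding DERIV_def by simp
    moreover have "filterlim \<epsilon> (at 0) sequentially"
      using elim X(1) by (auto simp: filterlim_at less_imp_neq[symmetric] intro!: always_eventually)
    ultimately show ?thesis by (rule filterlim_compose)
  qed
  have slim: "(\<lambda>n. (1 + \<epsilon> n * \<kappa>) powr r) \<longlonglongrightarrow> 1"
  proof -
    have "(\<lambda>n. (1 + \<epsilon> n * \<kappa>) powr r) \<longlonglongrightarrow> (1 + 0 * \<kappa>) powr r"
      by (intro tendsto_intros elim) auto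
    thus ?thesis by simp
  qed
  have "(\<lambda>n. \<beta> * (((1 + \<epsilon> n * \<kappa>) powr r - 1) / \<epsilon> n * norm (gradient z (x n)) powr q +
      (1 + \<epsilon> n * \<kappa>) powr r * (q * norm (gradient z (x n)) powr (q - 2) * (gradient z (x n) \<bullet> w (x n))))) \<longlonglongrightarrow>
      \<beta> * (r * \<kappa> * norm (gradient z x0) powr q +
      1 * (q * norm (gradient z x0) powr (q - 2) * (gradient z x0 \<bullet> w x0)))"
    by (intro tendsto_intros dlim slim glim wlim) (use g0 in auto)
  hence "\<beta> * (r * \<kappa> * norm (gradient z x0) powr q +
      1 * (q * norm (gradient z x0) powr (q - 2) * (gradient z x0 \<bullet> w x0))) \<le> T"
    by (rule tendsto_upperbound) (use ev ineq in \<open>auto elim: eventually_mono\<close>)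
  moreover have "gradient z x0 \<bullet> w x0 = P\<^sup>2 * (e \<bullet> g + \<kappa>)"
  proof -
    have "gradient z x0 = P *\<^sub>R e" using P e by simp
    moreover have "e \<bullet> e = 1" using P e by (simp add: power2_norm_eq_inner[symmetric] dot_square_norm)
    ultimately show ?thesis by (simp add: w_def inner_add_right power2_eq_square algebra_simps)
  qed
  moreover have "P powr (q - 2) * P\<^sup>2 = P powr q"
    using P(2) by (simp add: powr_add[symmetric] flip: powr_numeral)
  hence "q * P powr (q - 2) * (P\<^sup>2 * (e \<bullet> g + \<kappa>)) = q * P powr q * (e \<bullet> g + \<kappa>)"
    by (metis mult.assoc)
  ultimately have "\<beta> * (r * \<kappa> * P powr q + q * P powr q * (e \<bullet> g + \<kappa>)) \<le> T"
    by (simp add: P(1)[symmetric])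
  moreover have "\<beta> * (r * \<kappa> * P powr q + q * P powr q * (e \<bullet> g + \<kappa>)) = \<beta> * P powr q * (2 * \<kappa> + q * (e \<bullet> g))"
    by (simp add: r_def algebra_simps)
  ultimately show ?thesis by (simp add: T_def)
qed

text \<open>Second-order expansion of the majorant that appears at a maximum of the gradient norm
  times D^\<gamma>. In that application D (x0 + y) = D0 (1 + d), \<open>g\<close> is the logarithmic
  gradient of D^(-\<gamma>) at \<open>x0\<close>, and s = 1 / (R D0) is, up to a factor 2, the
  inverse distance to the sphere. All quadratic errors are collected under s^2 + \<kappa>^2, so a
  single \<Lambda> serves.\<close>

lemma weight_majorant:
  fixes y u e g :: "'a::euclidean_space"
  assumes gam: "1 \<le> \<gamma>" and R: "0 < R" and D0: "0 < D0" "D0 \<le> 1" and u: "norm u \<le> R"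
    and e: "norm e = 1" and kap: "0 < \<kappa>"
    and s: "s = 1 / (R * D0)" and g: "g = (2 * \<gamma> / (R\<^sup>2 * D0)) *\<^sub>R u"
    and d: "d = - ((2 * (u \<bullet> y) + (norm y)\<^sup>2) / (R\<^sup>2 * D0))"
    and y: "6 * s * norm y \<le> 1" "\<kappa> * norm y \<le> 1"
    and C: "C = \<gamma> * (\<gamma> + 1) * 2 powr (\<gamma> + 2)"
  shows "- (1 / 2) \<le> d"
    and "(1 + d) powr (- \<gamma>) * ((1 + (norm (e + \<kappa> *\<^sub>R y))\<^sup>2) / 2)
       \<le> 1 + (g + \<kappa> *\<^sub>R e) \<bullet> y + (3 * (\<gamma> + 9 * C) + 2 * \<gamma> + 1) * (s\<^sup>2 + \<kappa>\<^sup>2) * (norm y)\<^sup>2"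
proof -
  define n where "n = norm y"
  have n0: "0 \<le> n" by (simp add: n_def)
  have s0: "0 < s" using R D0 by (simp add: s)
  have sn: "s * n \<le> 1 / 6" using y by (simp add: n_def)
  have kn: "\<kappa> * n \<le> 1" using y by (simp add: n_def)
  have C0: "0 \<le> C" using gam by (simp add: C)
  have sRD: "s * (R * D0) = 1" using R D0 by (simp add: s)
  have inv: "1 / (R\<^sup>2 * D0) = s / R" using R D0 by (simp add: s power2_eq_square)
  have gk: "2 * \<gamma> / (R\<^sup>2 * D0) = 2 * \<gamma> * (s / R)" unfolding inv[symmetric] by simp
  have sR: "1 / R \<le> s" using R D0 by (simp add: s field_simps)
  have nR: "n \<le> R"
  proof -
    have "n / R \<le> s * n" using sR n0 mult_right_mono[of "1 / R" s n] by simp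
    hence "n / R \<le> 1" using sn by simp
    thus ?thesis using R by simp
  qed
  have uy: "\<bar>u \<bullet> y\<bar> \<le> R * n"
    using Cauchy_Schwarz_ineq2[of u y] mult_right_mono[OF u n0] by (simp add: n_def)
  have dd: "d = - ((2 * (u \<bullet> y) + n\<^sup>2) * (s / R))" unfolding d inv[symmetric] n_def by simp
  have "\<bar>2 * (u \<bullet> y) + n\<^sup>2\<bar> \<le> 3 * (R * n)"
  proof (rule abs_leI)
    have "0 \<le> n\<^sup>2" "n\<^sup>2 \<le> R * n" using mult_right_mono[OF nR n0] by (simp_all add: power2_eq_square)
    moreover have "u \<bullet> y \<le> R * n" "- (u \<bullet> y) \<le> R * n" using uy by (simp_all add: abs_le_iff)
    ultimately show "2 * (u \<bullet> y) + n\<^sup>2 \<le> 3 * (R * n)" "- (2 * (u \<bullet> y) + n\<^sup>2) \<le> 3 * (R * n)"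
      by linarith+
  qed
  hence "\<bar>2 * (u \<bullet> y) + n\<^sup>2\<bar> * (s / R) \<le> 3 * (R * n) * (s / R)"
    using s0 R by (intro mult_right_mono) auto
  hence dabs: "\<bar>d\<bar> \<le> 3 * s * n" using s0 R by (simp add: dd abs_mult mult_ac)
  thus dh: "- (1 / 2) \<le> d" using sn by (simp add: abs_le_iff)
  have "d\<^sup>2 \<le> (3 * s * n)\<^sup>2" using dabs by (metis abs_ge_zero power2_abs power_mono)
  hence d2: "d\<^sup>2 \<le> 9 * s\<^sup>2 * n\<^sup>2" by (simp add: power_mult_distrib)
  have "(1 + d) powr (- \<gamma>) \<le> 1 - \<gamma> * d + C * d\<^sup>2"
    unfolding C using gam by (intro one_plus_powr_neg_le dh) auto
  also have "\<dots> \<le> 1 + (g \<bullet> y + \<gamma> * (s\<^sup>2 * n\<^sup>2)) + C * (9 * s\<^sup>2 * n\<^sup>2)"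
  proof -
    have "- \<gamma> * d = g \<bullet> y + \<gamma> * (n\<^sup>2 * (s / R))"
      unfolding dd g gk by (simp add: algebra_simps)
    moreover have "s / R \<le> s\<^sup>2" using mult_left_mono[OF sR, of s] s0 by (simp add: power2_eq_square)
    hence "\<gamma> * (n\<^sup>2 * (s / R)) \<le> \<gamma> * (n\<^sup>2 * s\<^sup>2)" using gam by (intro mult_left_mono) auto
    moreover have "C * d\<^sup>2 \<le> C * (9 * s\<^sup>2 * n\<^sup>2)" using d2 C0 by (rule mult_left_mono)
    ultimately show ?thesis by (simp add: mult_ac)
  qed
  finally have A: "(1 + d) powr (- \<gamma>) \<le> 1 + g \<bullet> y + (\<gamma> + 9 * C) * s\<^sup>2 * n\<^sup>2" by (simp add: algebra_simps)
  define m where "m = \<kappa> * (e \<bullet> y) + \<kappa>\<^sup>2 * n\<^sup>2 / 2"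
  define C2 where "C2 = \<gamma> + 9 * C"
  have C20: "0 \<le> C2" using gam C0 by (simp add: C2_def)
  have M: "(1 + (norm (e + \<kappa> *\<^sub>R y))\<^sup>2) / 2 = 1 + m"
  proof -
    have "e \<bullet> e = 1" using e by (simp add: dot_square_norm)
    thus ?thesis unfolding power2_norm_eq_inner m_def n_def
      by (simp add: inner_add_left inner_add_right inner_commute[of y e] power2_eq_square field_simps)
  qed
  have "(1 + d) powr (- \<gamma>) * (1 + m) \<le> (1 + g \<bullet> y + C2 * s\<^sup>2 * n\<^sup>2) * (1 + m)"
    unfolding M[symmetric] C2_def by (intro mult_right_mono A) auto
  also have "\<dots> = 1 + (g + \<kappa> *\<^sub>R e) \<bullet> y + \<kappa>\<^sup>2 * n\<^sup>2 / 2 + C2 * s\<^sup>2 * n\<^sup>2 + (g \<bullet> y) * m + C2 * s\<^sup>2 * n\<^sup>2 * m"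
    by (simp add: m_def inner_add_left algebra_simps)
  also have "\<dots> \<le> 1 + (g + \<kappa> *\<^sub>R e) \<bullet> y + (3 * C2 + 2 * \<gamma> + 1) * (s\<^sup>2 + \<kappa>\<^sup>2) * n\<^sup>2"
  proof -
    have ey: "\<bar>e \<bullet> y\<bar> \<le> n" using Cauchy_Schwarz_ineq2[of e y] e by (simp add: n_def)
    have "\<kappa>\<^sup>2 * n\<^sup>2 = (\<kappa> * n) * (\<kappa> * n)" by (simp add: power2_eq_square)
    also have "\<dots> \<le> \<kappa> * n" using kn kap n0 mult_right_mono[OF kn, of "\<kappa> * n"] by simp
    finally have k2: "\<kappa>\<^sup>2 * n\<^sup>2 \<le> \<kappa> * n" .
    have "\<bar>\<kappa> * (e \<bullet> y)\<bar> \<le> \<kappa> * n" using ey kap by (simp add: abs_mult)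
    moreover have "0 \<le> \<kappa>\<^sup>2 * n\<^sup>2" by simp
    ultimately have m1: "\<bar>m\<bar> \<le> 3 / 2 * (\<kappa> * n)" unfolding m_def using k2 by linarith
    hence m2: "m \<le> 3 / 2" using kn by linarith
    have gy: "\<bar>g \<bullet> y\<bar> \<le> 2 * \<gamma> * (s * n)"
    proof -
      have "\<bar>g \<bullet> y\<bar> = 2 * \<gamma> * (s / R) * \<bar>u \<bullet> y\<bar>"
        unfolding g gk using gam R s0 by (simp add: abs_mult)
      also have "\<dots> \<le> 2 * \<gamma> * (s / R) * (R * n)" using gam s0 R by (intro mult_left_mono uy) auto
      finally show ?thesis using R by simp
    qed
    \<comment> \<open>The cross term of the two expansions has size s \<kappa> |y|^2 and is absorbed
      by 2 s \<kappa> \<le> s^2 + \<kappa>^2.\<close>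
    have "(g \<bullet> y) * m \<le> \<bar>g \<bullet> y\<bar> * \<bar>m\<bar>" by (metis abs_ge_self abs_mult)
    also have "\<dots> \<le> 2 * \<gamma> * (s * n) * (3 / 2 * (\<kappa> * n))" using gam s0 n0 by (intro mult_mono gy m1) auto
    also have "\<dots> = 3 / 2 * \<gamma> * n\<^sup>2 * (2 * (s * \<kappa>))" by (simp add: power2_eq_square)
    also have "\<dots> \<le> 3 / 2 * \<gamma> * n\<^sup>2 * (s\<^sup>2 + \<kappa>\<^sup>2)"
      using gam sum_squares_bound[of s \<kappa>] by (intro mult_left_mono) (auto simp: mult_ac)
    also have "\<dots> \<le> 2 * \<gamma> * ((s\<^sup>2 + \<kappa>\<^sup>2) * n\<^sup>2)" using gam by (simp add: mult_ac mult_right_mono)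
    finally have t1: "(g \<bullet> y) * m \<le> 2 * \<gamma> * ((s\<^sup>2 + \<kappa>\<^sup>2) * n\<^sup>2)" .
    have "C2 * s\<^sup>2 * n\<^sup>2 * m \<le> C2 * s\<^sup>2 * n\<^sup>2 * (3 / 2)" using C20 by (intro mult_left_mono m2) auto
    hence "C2 * s\<^sup>2 * n\<^sup>2 + C2 * s\<^sup>2 * n\<^sup>2 * m \<le> 5 / 2 * C2 * (s\<^sup>2 * n\<^sup>2)"
      by (simp add: algebra_simps)
    also have "\<dots> \<le> 3 * C2 * ((s\<^sup>2 + \<kappa>\<^sup>2) * n\<^sup>2)"
      using C20 by (intro mult_mono) (auto simp: algebra_simps)
    finally have t2: "C2 * s\<^sup>2 * n\<^sup>2 + C2 * s\<^sup>2 * n\<^sup>2 * m \<le> 3 * C2 * ((s\<^sup>2 + \<kappa>\<^sup>2) * n\<^sup>2)" .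
    have "0 \<le> s\<^sup>2 * n\<^sup>2" "0 \<le> \<kappa>\<^sup>2 * n\<^sup>2" by auto
    hence t3: "\<kappa>\<^sup>2 * n\<^sup>2 / 2 \<le> (s\<^sup>2 + \<kappa>\<^sup>2) * n\<^sup>2" unfolding distrib_right by linarith
    have "(3 * C2 + 2 * \<gamma> + 1) * (s\<^sup>2 + \<kappa>\<^sup>2) * n\<^sup>2 =
        3 * C2 * ((s\<^sup>2 + \<kappa>\<^sup>2) * n\<^sup>2) + 2 * \<gamma> * ((s\<^sup>2 + \<kappa>\<^sup>2) * n\<^sup>2) + (s\<^sup>2 + \<kappa>\<^sup>2) * n\<^sup>2"
      by (simp add: algebra_simps)
    with t1 t2 t3 show ?thesis by linarith
  qed
  finally show "(1 + d) powr (- \<gamma>) * ((1 + (norm (e + \<kappa> *\<^sub>R y))\<^sup>2) / 2)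
       \<le> 1 + (g + \<kappa> *\<^sub>R e) \<bullet> y + (3 * (\<gamma> + 9 * C) + 2 * \<gamma> + 1) * (s\<^sup>2 + \<kappa>\<^sup>2) * (norm y)\<^sup>2"
    unfolding M C2_def n_def .
qed

text \<open>Maximize the gradient norm times (1 - |x - xc|^2 / R^2)^\<gamma> over the ball, with
  \<gamma> = 1/(q-1). At the maximum, \<open>bernstein_inequality\<close> becomes a quadratic
  inequality for X = P^(q-1) against the scale s = 1 / (R D0), hence X \<le> C5 s; with this
  \<gamma> the maximum is exactly (X D0)^\<gamma>. No bound on \<open>z\<close> enters, so the
  constant depends on q, \<beta> and the dimension only.\<close>

theorem interior_gradient_bound:
  fixes q \<beta> :: real
  assumes q: "1 < q" "q \<le> 2" and beta: "0 < \<beta>"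
  shows "\<exists>C>0. \<forall>(z :: 'a::euclidean_space \<Rightarrow> real) S xc R. C2_on S z \<longrightarrow> open S \<longrightarrow>
     (\<forall>x\<in>S. laplacian z x = \<beta> * norm (gradient z x) powr q) \<longrightarrow> 0 < R \<longrightarrow> cball xc R \<subseteq> S \<longrightarrow>
     norm (gradient z xc) \<le> (C / R) powr (1 / (q - 1))"
proof -
  define \<gamma> where "\<gamma> = 1 / (q - 1)"
  have gam: "1 \<le> \<gamma>" using q by (simp add: \<gamma>_def)
  have gq: "\<gamma> * (q - 1) = 1" using q by (simp add: \<gamma>_def)
  define C1 where "C1 = \<gamma> * (\<gamma> + 1) * 2 powr (\<gamma> + 2)"
  have C10: "0 \<le> C1" using gam by (simp add: C1_def)
  define C3 where "C3 = 3 * (\<gamma> + 9 * C1) + 2 * \<gamma> + 1"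
  define C4 where "C4 = C3 + 1"
  have C4: "0 < C4" using gam C10 by (simp add: C4_def C3_def)
  define N where "N = real DIM('a)"
  have N: "0 < N" by (simp add: N_def)
  \<comment> \<open>With \<kappa> = \<theta> X the error 2 N C4 \<kappa>^2 equals \<beta> X
    \<kappa>, half of the coercive term 2 \<beta> X \<kappa>.\<close>
  define \<theta> where "\<theta> = \<beta> / (2 * N * C4)"
  have th: "0 < \<theta>" using N C4 beta by (simp add: \<theta>_def)
  \<comment> \<open>Read off from \<open>i4\<close>: if X > C5 s \<ge> s, its right side is less
    than \<beta> \<theta> C5 s X, which is less than \<beta> \<theta> X^2.\<close>
  define C5 where "C5 = 2 * q * \<gamma> / \<theta> + 2 * N * C4 / (\<beta> * \<theta>) + 1"
  have C5: "1 \<le> C5" using q gam th beta N C4 by (simp add: C5_def)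
  have C5e: "\<beta> * \<theta> * C5 = 2 * \<beta> * q * \<gamma> + 2 * N * C4 + \<beta> * \<theta>"
    using th beta by (simp add: C5_def field_simps)
  show ?thesis
  proof (intro exI[of _ C5] conjI allI impI)
    show "0 < C5" using C5 by simp
    fix z :: "'a \<Rightarrow> real" and S xc R
    assume C2: "C2_on S z" and S: "open S" and eq: "\<forall>x\<in>S. laplacian z x = \<beta> * norm (gradient z x) powr q"
      and R: "0 < R" and sub: "cball xc R \<subseteq> S"
    define D where "D = (\<lambda>x. 1 - (norm (x - xc))\<^sup>2 / R\<^sup>2)"
    have Dnn: "0 \<le> D x" if "x \<in> cball xc R" for x
    proof -
      have "(norm (x - xc))\<^sup>2 \<le> R\<^sup>2" using that R by (intro power_mono) (auto simp: dist_norm norm_minus_commute)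
      thus ?thesis using R by (simp add: D_def)
    qed
    have Dpos: "x \<in> cball xc R" "norm (x - xc) < R" if "0 < D x" for x
    proof -
      have "(norm (x - xc))\<^sup>2 < R\<^sup>2" using that R by (simp add: D_def)
      hence "norm (x - xc) < R" using R power2_less_imp_less by fastforce
      thus "x \<in> cball xc R" "norm (x - xc) < R" by (auto simp: dist_norm norm_minus_commute)
    qed
    define G where "G = (\<lambda>x. norm (gradient z x) * D x powr \<gamma>)"
    have "continuous_on (cball xc R) (gradient z)"
      using C2_on_gradient_continuous[OF C2] sub continuous_on_subset by blast
    moreover have "continuous_on (cball xc R) (\<lambda>x. D x powr \<gamma>)"
      using Dnn gam R by (intro continuous_on_powr' continuous_on_const)
        (auto simp: D_def intro!: continuous_intros)
    ultimately have "continuous_on (cball xc R) G" unfolding G_def by (intro continuous_on_mult continuous_on_norm)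
    then obtain x0 where x0: "x0 \<in> cball xc R" "\<And>x. x \<in> cball xc R \<Longrightarrow> G x \<le> G x0"
      using continuous_attains_sup[of "cball xc R" G] R by auto
    have Gc: "G xc = norm (gradient z xc)" by (simp add: G_def D_def)
    show "norm (gradient z xc) \<le> (C5 / R) powr (1 / (q - 1))"
    proof (cases "G x0 = 0")
      case True
      hence "norm (gradient z xc) \<le> 0" using x0(2)[of xc] R Gc by simp
      thus ?thesis by (simp add: order_trans[OF _ powr_ge_zero])
    next
      case False
      define P where "P = norm (gradient z x0)"
      define D0 where "D0 = D x0"
      have P0: "0 < P" using False by (auto simp: G_def P_def)
      have D00: "0 < D0" using False Dnn[OF x0(1)] by (auto simp: G_def D0_def order_le_less)
      have D01: "D0 \<le> 1" by (simp add: D0_def D_def)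
      define u where "u = x0 - xc"
      have uR: "norm u < R" using Dpos(2) D00 by (simp add: u_def D0_def)
      define s where "s = 1 / (R * D0)"
      have s0: "0 < s" using R D00 by (simp add: s_def)
      define g where "g = (2 * \<gamma> / (R\<^sup>2 * D0)) *\<^sub>R u"
      define X where "X = P powr (q - 1)"
      have X0: "0 < X" using P0 by (simp add: X_def)
      define \<kappa> where "\<kappa> = \<theta> * X"
      have kap: "0 < \<kappa>" using th X0 by (simp add: \<kappa>_def)
      define e where "e = gradient z x0 /\<^sub>R P"
      have ne: "norm e = 1" using P0 by (simp add: e_def P_def)
      obtain r where r: "0 < r" "cball x0 r \<subseteq> S" using S x0(1) sub open_contains_cball by blast
      \<comment> \<open>The first bound keeps the doubled ball in \<open>S\<close>; the other two
        are the smallness conditions of \<open>weight_majorant\<close>.\<close>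
      define \<rho> where "\<rho> = min (r / 2) (min (1 / (6 * s)) (1 / \<kappa>))"
      have rho: "0 < \<rho>" using r s0 kap by (simp add: \<rho>_def)
      have rsub: "cball x0 (2 * \<rho>) \<subseteq> S" using r(2) by (auto simp: \<rho>_def)
      have bnd: "norm (gradient z (x0 + y)) * ((1 + (norm (e + \<kappa> *\<^sub>R y))\<^sup>2) / 2)
          \<le> P * (1 + (g + \<kappa> *\<^sub>R e) \<bullet> y + (C3 * (s\<^sup>2 + \<kappa>\<^sup>2)) * (norm y)\<^sup>2)"
        if y: "norm y \<le> \<rho>" for y
      proof -
        define d where "d = - ((2 * (u \<bullet> y) + (norm y)\<^sup>2) / (R\<^sup>2 * D0))"
        have y1: "6 * s * norm y \<le> 1" "\<kappa> * norm y \<le> 1"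
          using y s0 kap by (auto simp: \<rho>_def field_simps)
        note wm = weight_majorant[OF gam R D00 D01 less_imp_le[OF uR] ne kap s_def g_def d_def y1 C1_def]
        have nn: "(norm (x0 + y - xc))\<^sup>2 = (norm u)\<^sup>2 + 2 * (u \<bullet> y) + (norm y)\<^sup>2"
        proof -
          have uy: "x0 + y - xc = u + y" by (simp add: u_def)
          show ?thesis unfolding uy power2_norm_eq_inner by (simp add: inner_add_left inner_add_right inner_commute[of y u])
        qed
        have "D (x0 + y) = D0 - (2 * (u \<bullet> y) + (norm y)\<^sup>2) / R\<^sup>2"
          unfolding D0_def D_def nn u_def[symmetric] by (simp add: add_divide_distrib diff_divide_distrib)
        moreover have "D0 * d = - ((2 * (u \<bullet> y) + (norm y)\<^sup>2) / R\<^sup>2)" using D00 by (simp add: d_def)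
        ultimately have Dy: "D (x0 + y) = D0 * (1 + d)" by (simp add: distrib_left)
        have d1: "0 < 1 + d" using wm(1) by simp
        hence Dyp: "0 < D (x0 + y)" using D00 Dy by simp
        \<comment> \<open>Maximality of \<open>G\<close> at \<open>x0\<close> becomes a bound of the
          nearby gradient by P (1 + d)^(-\<gamma>).\<close>
        have "G (x0 + y) \<le> G x0" by (rule x0(2)[OF Dpos(1)[OF Dyp]])
        hence "norm (gradient z (x0 + y)) * (1 + d) powr \<gamma> * D0 powr \<gamma> \<le> P * D0 powr \<gamma>"
          using D00 d1 unfolding G_def Dy P_def[symmetric] D0_def[symmetric] by (simp add: powr_mult mult_ac)
        hence "norm (gradient z (x0 + y)) * (1 + d) powr \<gamma> \<le> P" using D00 by simp
        hence "norm (gradient z (x0 + y)) \<le> P * (1 + d) powr (- \<gamma>)"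
          using d1 by (simp add: powr_minus_divide field_simps)
        hence "norm (gradient z (x0 + y)) * ((1 + (norm (e + \<kappa> *\<^sub>R y))\<^sup>2) / 2) \<le>
            P * (1 + d) powr (- \<gamma>) * ((1 + (norm (e + \<kappa> *\<^sub>R y))\<^sup>2) / 2)"
          by (rule mult_right_mono) simp
        also have "\<dots> \<le> P * (1 + (g + \<kappa> *\<^sub>R e) \<bullet> y + (C3 * (s\<^sup>2 + \<kappa>\<^sup>2)) * (norm y)\<^sup>2)"
          using mult_left_mono[OF wm(2), of P] P0 by (simp add: C3_def mult.assoc)
        finally show ?thesis .
      qed
      \<comment> \<open>The strict step from \<Lambda> to \<Lambda>' is the reason for C4 = C3 +
        1.\<close>
      have "C3 * (s\<^sup>2 + \<kappa>\<^sup>2) < C4 * (s\<^sup>2 + \<kappa>\<^sup>2)" using s0 by (simp add: C4_def add_pos_nonneg)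
      from bernstein_inequality[OF q beta C2 S _ P_def P0 e_def kap this rho rsub bnd] eq
      have ineq: "\<beta> * P powr q * (2 * \<kappa> + q * (e \<bullet> g)) \<le> P * (2 * N * (C4 * (s\<^sup>2 + \<kappa>\<^sup>2)))"
        by (simp add: N_def)
      have "P powr q = P * X" using P0 by (simp add: X_def powr_diff)
      hence "P * (\<beta> * X * (2 * \<kappa> + q * (e \<bullet> g))) \<le> P * (2 * N * (C4 * (s\<^sup>2 + \<kappa>\<^sup>2)))"
        using ineq by (simp add: mult_ac)
      hence i2: "\<beta> * X * (2 * \<kappa> + q * (e \<bullet> g)) \<le> 2 * N * (C4 * (s\<^sup>2 + \<kappa>\<^sup>2))"
        using P0 by simp
      have "e \<bullet> g \<ge> - (2 * \<gamma> * s)"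
      proof -
        have "\<bar>e \<bullet> g\<bar> \<le> norm g" using Cauchy_Schwarz_ineq2[of e g] ne by simp
        also have "\<dots> = 2 * \<gamma> / (R\<^sup>2 * D0) * norm u" using gam D00 by (simp add: g_def)
        also have "\<dots> \<le> 2 * \<gamma> / (R\<^sup>2 * D0) * R" using gam D00 uR by (intro mult_left_mono) auto
        also have "\<dots> = 2 * \<gamma> * s" using R by (simp add: s_def power2_eq_square)
        finally show ?thesis by (simp add: abs_le_iff)
      qed
      hence "\<beta> * X * (2 * \<kappa> + q * (- (2 * \<gamma> * s))) \<le> \<beta> * X * (2 * \<kappa> + q * (e \<bullet> g))"
        using beta X0 q by (intro mult_left_mono add_left_mono) auto
      from order_trans[OF this i2]
      have i3: "\<beta> * X * (2 * \<kappa>) \<le> \<beta> * X * (q * (2 * \<gamma> * s)) + 2 * N * C4 * s\<^sup>2 + 2 * N * C4 * \<kappa>\<^sup>2"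
        by (simp add: algebra_simps)
      have "2 * N * C4 * \<kappa>\<^sup>2 = \<beta> * X * \<kappa>"
      proof -
        have "2 * N * C4 * \<theta> = \<beta>" using N C4 by (simp add: \<theta>_def)
        hence "2 * N * C4 * \<theta> * (X * \<kappa>) = \<beta> * (X * \<kappa>)" by (simp only:)
        thus ?thesis by (simp add: \<kappa>_def power2_eq_square mult_ac)
      qed
      with i3 have i4: "\<beta> * \<theta> * X * X \<le> 2 * \<beta> * q * \<gamma> * s * X + 2 * N * C4 * s\<^sup>2"
        by (simp add: \<kappa>_def algebra_simps)
      have XC: "X \<le> C5 * s"
      proof (rule ccontr)
        assume c: "\<not> X \<le> C5 * s"
        moreover have "1 * s \<le> C5 * s" using C5 s0 by (intro mult_right_mono) auto
        ultimately have "s < X" by simp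
        hence "2 * N * C4 * s * s < 2 * N * C4 * s * X" using N C4 s0 by (intro mult_strict_left_mono) auto
        moreover have "\<beta> * \<theta> * X * (C5 * s) < \<beta> * \<theta> * X * X"
          using c beta th X0 by (intro mult_strict_left_mono) auto
        moreover have "\<beta> * \<theta> * X * (C5 * s) = (\<beta> * \<theta> * C5) * (s * X)" by simp
        moreover have "0 < \<beta> * \<theta> * (s * X)" using beta th s0 X0 by simp
        ultimately show False using i4 unfolding C5e by (simp add: algebra_simps power2_eq_square)
      qed
      hence "X * D0 \<le> C5 / R" using R D00 by (simp add: s_def field_simps)
      hence "(X * D0) powr \<gamma> \<le> (C5 / R) powr \<gamma>" using X0 D00 gam by (intro powr_mono2) auto
      moreover have "(X * D0) powr \<gamma> = G x0"
      proof -
        have "X powr \<gamma> = P" using P0 gq by (simp add: X_def powr_powr mult.commute)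
        thus ?thesis using X0 D00 by (simp add: G_def powr_mult P_def D0_def)
      qed
      ultimately show ?thesis using x0(2)[of xc] R Gc by (simp add: \<gamma>_def)
    qed
  qed
qed

section \<open>One-dimensional solutions\<close>

lemma has_real_derivative_of_indefinite_integral:
  fixes F :: "real \<Rightarrow> real"
  assumes "continuous_on {a..b} F" "a < t" "t < b" and eq: "\<And>s. a < s \<Longrightarrow> s < b \<Longrightarrow> f s = c + integral {a..s} F"
  shows "(f has_real_derivative F t) (at t)"
proof -
  have "((\<lambda>s. integral {a..s} F) has_real_derivative F t) (at t within {a..b})"
    using assms by (intro integral_has_real_derivative) auto
  hence "((\<lambda>s. integral {a..s} F) has_real_derivative F t) (at t)"
    using assms(2,3) by (simp add: at_within_Icc_at)
  hence d: "((\<lambda>s. c + integral {a..s} F) has_real_derivative F t) (at t)"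
    by (auto intro!: derivative_eq_intros)
  show ?thesis
    by (rule has_field_derivative_transform_within_open[OF d, of "{a<..<b}"]) (use assms in auto)
qed

text \<open>The fundamental theorem of calculus tolerates one exceptional point, so \<open>f\<close>
  is an integral of the continuous \<open>F\<close> across \<open>T\<close>. It is needed where a
  solution reaches 0, at the edge of its dead core.\<close>

lemma has_real_derivative_removable:
  fixes f F :: "real \<Rightarrow> real"
  assumes f: "continuous_on {a<..} f" and F: "continuous_on {a<..} F" and t: "a < t"
    and d: "\<And>s. a < s \<Longrightarrow> s \<noteq> T \<Longrightarrow> (f has_real_derivative F s) (at s)"
  shows "(f has_real_derivative F t) (at t)"
proof (rule has_real_derivative_of_indefinite_integral[where a = "(a + t) / 2" and b = "t + 1" and c = "f ((a + t) / 2)"])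
  show "continuous_on {(a + t) / 2..t + 1} F"
    by (rule continuous_on_subset[OF F]) (use t in \<open>auto simp: field_simps\<close>)
  show "f s = f ((a + t) / 2) + integral {(a + t) / 2..s} F" if "(a + t) / 2 < s" "s < t + 1" for s
  proof -
    have "(F has_integral (f s - f ((a + t) / 2))) {(a + t) / 2..s}"
    proof (rule fundamental_theorem_of_calculus_interior_strong[of "{T}"])
      show "continuous_on {(a + t) / 2..s} f"
        by (rule continuous_on_subset[OF f]) (use t in \<open>auto simp: field_simps\<close>)
      show "(f has_vector_derivative F x) (at x)" if "x \<in> {(a + t) / 2<..<s} - {T}" for x
        using d[of x] that t by (auto simp: has_real_derivative_iff_has_vector_derivative field_simps)
    qed (use that in auto)
    thus ?thesis by (simp add: integral_unique)
  qed
qed (use t in \<open>auto simp: field_simps\<close>)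

lemma continuous_on_half_lineI:
  fixes h :: "real \<Rightarrow> 'a::topological_space"
  assumes "\<And>b. continuous_on {0..b} h"
  shows "continuous_on {0..} h"
  unfolding continuous_on_eq_continuous_within
proof
  fix x :: real assume x: "x \<in> {0..}"
  have "continuous (at x within {0..x+1}) h"
    using assms[of "x+1"] x by (auto simp: continuous_on_eq_continuous_within)
  moreover have "at x within {0..} = at x within {0..x+1}"
    by (rule at_within_nhd[of x "{..<x+1}"]) auto
  ultimately show "continuous (at x within {0..}) h" by simp
qed

section \<open>The energy equation, obtained by differentiating h(\<phi>) = \<phi>'^2 / 2, with h(0)
  = 0\<close>

primrec energy_iterate :: "real \<Rightarrow> real \<Rightarrow> real \<Rightarrow> real \<Rightarrow> nat \<Rightarrow> real \<Rightarrow> real" where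
  "energy_iterate q \<alpha> p \<beta> 0 = (\<lambda>z. 0)"
| "energy_iterate q \<alpha> p \<beta> (Suc n) =
     (\<lambda>z. integral {0..z} (\<lambda>s. \<alpha> * s powr p + \<beta> * (2 * energy_iterate q \<alpha> p \<beta> n s) powr (q / 2)))"

text \<open>Here \<open>h\<close> is the energy \<open>\<phi>'\<^sup>2 / 2\<close> of a solution of \<open>\<phi>'' = \<alpha> \<phi>\<^sup>p + \<beta> \<bar>\<phi>'\<bar>\<^sup>q\<close> as a function of the value of \<open>\<phi>\<close>.
  Its equation is not Lipschitz at \<open>h = 0\<close> but monotone in \<open>h\<close>, so the iteration from \<open>0\<close> increases.\<close>

lemma energy_exists:
  assumes q: "1 < q" "q \<le> 2" and al: "0 < \<alpha>" and p: "0 < p" and be: "0 < \<beta>"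
  obtains h :: "real \<Rightarrow> real" where "continuous_on {0..} h" "h 0 = 0" "\<And>z. 0 < z \<Longrightarrow> 0 < h z"
    "\<And>z. 0 < z \<Longrightarrow> (h has_real_derivative (\<alpha> * z powr p + \<beta> * (2 * h z) powr (q / 2))) (at z)"
proof -
  define H where "H = energy_iterate q \<alpha> p \<beta>"
  define G where "G = (\<lambda>h s :: real. \<alpha> * s powr p + \<beta> * (2 * h s) powr (q / 2))"
  have H0: "H 0 = (\<lambda>z. 0)" and HS: "H (Suc n) = (\<lambda>z. integral {0..z} (G (H n)))" for n
    by (simp_all add: H_def G_def)
  have Gc: "continuous_on {0..} (G h)" if "continuous_on {0..} h" "\<And>s. 0 \<le> s \<Longrightarrow> 0 \<le> h s" for h
    unfolding G_def using that p q
    by (intro continuous_on_add continuous_on_mult continuous_on_const continuous_on_powr' continuous_on_id) auto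
  have Gnn: "0 \<le> G h s" for h s using al be by (simp add: G_def)
  have nn: "continuous_on {0..} (H n) \<and> (\<forall>s\<ge>0. 0 \<le> H n s)" for n
  proof (induction n)
    case (Suc n)
    have c: "continuous_on {0..} (G (H n))" using Gc Suc by blast
    have i: "G (H n) integrable_on {0..z}" for z
      by (intro integrable_continuous_real continuous_on_subset[OF c]) auto
    have "continuous_on {0..b} (H (Suc n))" for b
      unfolding HS by (rule indefinite_integral_continuous_1[OF i])
    hence "continuous_on {0..} (H (Suc n))" by (rule continuous_on_half_lineI)
    moreover have "0 \<le> H (Suc n) s" for s unfolding HS using Gnn by (intro integral_nonneg i) auto
    ultimately show ?case by blast
  qed (simp add: H0)
  have Gi: "G (H n) integrable_on {0..z}" for n z
    using Gc[of "H n"] nn[of n] by (intro integrable_continuous_real) (auto intro: continuous_on_subset)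
  have mono: "\<forall>s\<ge>0. H n s \<le> H (Suc n) s" for n
  proof (induction n)
    case 0 thus ?case using nn[of "Suc 0"] by (simp add: H0)
  next
    case (Suc n)
    have "G (H n) s \<le> G (H (Suc n)) s" if "0 \<le> s" for s
      unfolding G_def using Suc that nn[of n] be q by (intro add_left_mono mult_left_mono powr_mono2) auto
    thus ?case unfolding HS[of n] HS[of "Suc n"] by (auto intro!: integral_le Gi simp flip: HS)
  qed
  \<comment> \<open>The exponential comes from a linear majorant of the equation: (2 h)^(q/2) \<le>
    1 + 2 h, as q/2 \<le> 1. The bound is uniform in \<open>n\<close>, so the increasing iterates
    converge.\<close>
  have bound: "\<forall>s\<in>{0..Z}. H n s \<le> (\<alpha> * Z powr p + \<beta>) * Z * exp (2 * \<beta> * s)" if "0 \<le> Z" for n Z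
  proof (induction n)
    case 0 thus ?case using that al be by (simp add: H0)
  next
    case (Suc n)
    define A where "A = \<alpha> * Z powr p + \<beta>"
    define C where "C = A * Z"
    have AC: "0 \<le> A" "0 \<le> C" using al be that by (simp_all add: A_def C_def)
    show ?case
    proof
      fix z assume z: "z \<in> {0..Z}"
      have I1: "((\<lambda>s. A + C * (2 * \<beta>) * exp (2 * \<beta> * s)) has_integral
          ((A * z + C * exp (2 * \<beta> * z)) - (A * 0 + C * exp (2 * \<beta> * 0)))) {0..z}"
        by (rule fundamental_theorem_of_calculus)
          (use z in \<open>auto intro!: derivative_eq_intros simp flip: has_real_derivative_iff_has_vector_derivative\<close>)
      have I2: "(G (H n) has_integral H (Suc n) z) {0..z}"
        unfolding HS by (rule integrable_integral[OF Gi])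
      have "G (H n) s \<le> A + C * (2 * \<beta>) * exp (2 * \<beta> * s)" if s: "s \<in> {0..z}" for s
      proof -
        have hs: "0 \<le> H n s" using nn s by auto
        have "(2 * H n s) powr (q / 2) \<le> 1 + 2 * H n s"
        proof (cases "2 * H n s \<le> 1")
          case True
          hence "(2 * H n s) powr (q / 2) \<le> 1 powr (q / 2)" using hs q by (intro powr_mono2) auto
          thus ?thesis using hs by simp
        next
          case False
          hence "(2 * H n s) powr (q / 2) \<le> (2 * H n s) powr 1" using q by (intro powr_mono) auto
          thus ?thesis using False by simp
        qed
        hence "\<beta> * (2 * H n s) powr (q / 2) \<le> \<beta> * (1 + 2 * H n s)"
          using be by (intro mult_left_mono) auto
        also have "\<dots> \<le> \<beta> + \<beta> * 2 * (C * exp (2 * \<beta> * s))"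
        proof -
          have "H n s \<le> C * exp (2 * \<beta> * s)" using Suc s z by (auto simp: C_def A_def)
          hence "\<beta> * 2 * H n s \<le> \<beta> * 2 * (C * exp (2 * \<beta> * s))" using be by (intro mult_left_mono) auto
          thus ?thesis by (simp add: algebra_simps)
        qed
        finally have 1: "\<beta> * (2 * H n s) powr (q / 2) \<le> \<beta> + \<beta> * 2 * (C * exp (2 * \<beta> * s))" .
        have "\<alpha> * s powr p \<le> \<alpha> * Z powr p" using s z al p by (intro mult_left_mono powr_mono2) auto
        with 1 show ?thesis by (simp add: G_def A_def algebra_simps)
      qed
      from has_integral_le[OF I2 I1 this]
      have "H (Suc n) z \<le> (A * z + C * exp (2 * \<beta> * z)) - (A * 0 + C * exp (2 * \<beta> * 0))" .
      moreover have "A * z \<le> C" using AC z by (simp add: C_def mult_left_mono)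
      ultimately show "H (Suc n) z \<le> (\<alpha> * Z powr p + \<beta>) * Z * exp (2 * \<beta> * z)"
        by (simp add: C_def A_def)
    qed
  qed
  define h where "h = (\<lambda>z. lim (\<lambda>n. H n z))"
  have lim: "(\<lambda>n. H n z) \<longlonglongrightarrow> h z" if "0 \<le> z" for z
  proof -
    have "incseq (\<lambda>n. H n z)" using mono that by (intro incseq_SucI) auto
    moreover have "H n z \<le> (\<alpha> * z powr p + \<beta>) * z * exp (2 * \<beta> * z)" for n using bound[of z n] that by auto
    ultimately obtain L where "(\<lambda>n. H n z) \<longlonglongrightarrow> L" using incseq_convergent by blast
    thus ?thesis unfolding h_def by (simp add: limI)
  qed
  have hnn: "0 \<le> h z" if "0 \<le> z" for z
    by (rule LIMSEQ_le_const[OF lim[OF that]]) (use nn that in auto)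
  have Glim: "(\<lambda>n. G (H n) s) \<longlonglongrightarrow> G h s" if "0 \<le> s" for s
    unfolding G_def using q that nn
    by (intro tendsto_add tendsto_mult tendsto_const tendsto_powr' lim) (auto intro!: always_eventually)
  \<comment> \<open>Monotone convergence is used because nothing is known yet about the continuity
    of the limit; continuity follows afterwards from the integral equation.\<close>
  have "G h integrable_on {0..z} \<and> (\<lambda>n. integral {0..z} (G (H n))) \<longlonglongrightarrow> integral {0..z} (G h)" if z: "0 \<le> z" for z
  proof (rule monotone_convergence_increasing)
    show "G (H n) integrable_on {0..z}" for n by (rule Gi)
    show "G (H n) s \<le> G (H (Suc n)) s" if "s \<in> {0..z}" for n s
      unfolding G_def using mono[of n] that nn[of n] be q by (intro add_left_mono mult_left_mono powr_mono2) auto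
    show "(\<lambda>n. G (H n) s) \<longlonglongrightarrow> G h s" if "s \<in> {0..z}" for s using Glim that by auto
    have "norm (integral {0..z} (G (H n))) \<le> (\<alpha> * z powr p + \<beta>) * z * exp (2 * \<beta> * z)" for n
      using bound[OF z, of "Suc n"] z nn[of "Suc n"] by (auto simp: HS)
    thus "bounded (range (\<lambda>n. integral {0..z} (G (H n))))" by (intro boundedI) auto
  qed
  hence hi: "G h integrable_on {0..z}" and "(\<lambda>n. H (Suc n) z) \<longlonglongrightarrow> integral {0..z} (G h)" if "0 \<le> z" for z
    using that by (auto simp: HS)
  hence heq: "h z = integral {0..z} (G h)" if "0 \<le> z" for z
    using LIMSEQ_unique[OF LIMSEQ_Suc[OF lim[OF that]]] that by blast
  have hcb: "continuous_on {0..b} h" if "0 \<le> b" for b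
    by (rule continuous_on_eq[OF indefinite_integral_continuous_1[OF hi[OF that]]]) (simp add: heq)
  have hc: "continuous_on {0..} h"
    by (rule continuous_on_half_lineI) (metis hcb continuous_on_empty atLeastatMost_empty not_le)
  have d: "(h has_real_derivative G h z) (at z)" if "0 < z" for z
  proof (rule has_real_derivative_of_indefinite_integral[where a = 0 and b = "z + 1" and c = 0])
    show "continuous_on {0..z + 1} (G h)" by (rule continuous_on_subset[OF Gc[OF hc hnn]]) auto
  qed (use that heq in auto)
  have h0: "h 0 = 0" using heq[of 0] by simp
  \<comment> \<open>The source \<alpha> z^p makes the derivative positive. Here \<alpha> > 0
    excludes the zero solution.\<close>
  have hpos: "0 < h z" if z: "0 < z" for z
  proof -
    have "\<exists>l x. 0 < x \<and> x < z \<and> DERIV h x :> l \<and> h z - h 0 = (z - 0) * l"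
      using z d by (intro MVT continuous_on_subset[OF hc]) (auto simp: real_differentiable_def)
    then obtain l x where x: "0 < x" "DERIV h x :> l" "h z - h 0 = (z - 0) * l" by blast
    have "l = G h x" by (rule DERIV_unique[OF x(2) d[OF x(1)]])
    hence "0 < l" using x al be by (simp add: G_def add_pos_nonneg)
    thus ?thesis using x(3) h0 z by simp
  qed
  show ?thesis using that[OF hc h0 hpos] d unfolding G_def by blast
qed

section \<open>Time as a quadrature of the value, and its generalized inverse\<close>

lemma antiderivative_half_line:
  fixes f :: "real \<Rightarrow> real"
  assumes f: "continuous_on {0<..} f"
  obtains F where "\<And>z. 0 < z \<Longrightarrow> (F has_real_derivative f z) (at z)"
proof
  \<comment> \<open>The base point is 1 because \<open>f\<close> need not be integrable at 0; at
    least one of the two integrals runs over an empty or degenerate interval.\<close>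
  define F where "F = (\<lambda>z. integral {1..z} f - integral {z..1} f)"
  fix z :: real assume z: "0 < z"
  define a b where "a = min z 1 / 2" and "b = z + 1"
  have ab: "0 < a" "a < z" "a < 1" "z < b" using z by (auto simp: a_def b_def)
  have cont: "continuous_on {c..d} f" if "0 < c" for c d
    by (rule continuous_on_subset[OF f]) (use that in auto)
  have int: "f integrable_on {c..d}" if "0 < c" for c d
    using cont[OF that] by (rule integrable_continuous_real)
  show "(F has_real_derivative f z) (at z)"
  proof (rule has_real_derivative_of_indefinite_integral[where a = a and b = b and c = "- integral {a..1} f"])
    show "continuous_on {a..b} f" by (rule cont[OF ab(1)])
    show "F s = - integral {a..1} f + integral {a..s} f" if "a < s" "s < b" for s
    proof (cases "s \<le> 1")
      case True
      have "integral {a..s} f + integral {s..1} f = integral {a..1} f"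
        using True that ab by (intro Henstock_Kurzweil_Integration.integral_combine int) auto
      moreover have "integral {1..s} f = 0" using True by (cases "s = 1") auto
      ultimately show ?thesis by (simp add: F_def)
    next
      case False
      have "integral {a..1} f + integral {1..s} f = integral {a..s} f"
        using False that ab by (intro Henstock_Kurzweil_Integration.integral_combine int) auto
      thus ?thesis using False by (simp add: F_def)
    qed
  qed (use ab in auto)
qed

text \<open>The range of \<open>\<tau>\<close> may be bounded above; beyond it \<open>\<psi> = 0\<close>, which produces the dead core of the solution.\<close>

lemma extended_inverse_exists:
  fixes \<tau> g :: "real \<Rightarrow> real"
  assumes d: "\<And>z. 0 < z \<Longrightarrow> (\<tau> has_real_derivative - (1 / g z)) (at z)"
    and g: "\<And>z. 0 < z \<Longrightarrow> 0 < g z" and bdd: "bdd_below (\<tau> ` {0<..})"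
  defines "Tm \<equiv> Inf (\<tau> ` {0<..})"
  shows "\<exists>\<psi>. (\<forall>z>0. Tm < \<tau> z) \<and> (\<forall>t>Tm. 0 \<le> \<psi> t) \<and>
    (\<forall>t>Tm. \<forall>z>0. z \<le> \<psi> t \<longleftrightarrow> t \<le> \<tau> z) \<and> (\<forall>z>0. \<psi> (\<tau> z) = z) \<and> (\<forall>t>Tm. isCont \<psi> t) \<and>
    (\<forall>t>Tm. 0 < \<psi> t \<longrightarrow> (\<psi> has_real_derivative - g (\<psi> t)) (at t))"
proof -
  have dec: "\<tau> y < \<tau> x" if "0 < x" "x < y" for x y
  proof (rule DERIV_neg_imp_decreasing[OF that(2)])
    fix z assume "x \<le> z" "z \<le> y"
    hence "0 < z" using that by simp
    thus "\<exists>y. (\<tau> has_real_derivative y) (at z) \<and> y < 0" using d[of z] g[of z] by (intro exI[of _ "- (1 / g z)"]) simp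
  qed
  have dec_iff: "\<tau> y < \<tau> x \<longleftrightarrow> x < y" "\<tau> y \<le> \<tau> x \<longleftrightarrow> x \<le> y" if "0 < x" "0 < y" for x y
    using dec[of x y] dec[of y x] that by (metis less_asym linorder_neqE less_irrefl, metis less_asym linorder_neqE less_irrefl not_le)
  have cont: "isCont \<tau> z" if "0 < z" for z using d[OF that] by (rule DERIV_isCont)
  have Tlt: "Tm < \<tau> z" if "0 < z" for z
  proof -
    have "Tm \<le> \<tau> (z + 1)" unfolding Tm_def using that by (intro cInf_lower bdd) auto
    also have "\<dots> < \<tau> z" using dec that by simp
    finally show ?thesis .
  qed
  \<comment> \<open>The inserted 0 becomes the value at times \<open>t\<close> that lie above the
    whole range of \<tau>.\<close>
  define \<psi> where "\<psi> = (\<lambda>t. Sup (insert 0 {z. 0 < z \<and> t \<le> \<tau> z}))"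
  have bdda: "bdd_above (insert 0 {z. 0 < z \<and> t \<le> \<tau> z})" if "Tm < t" for t
  proof -
    have "\<exists>y\<in>\<tau> ` {0<..}. y < t" using that cInf_less_iff[OF _ bdd, of t] unfolding Tm_def by simp
    then obtain Z where Z: "0 < Z" "\<tau> Z < t" by auto
    show ?thesis
    proof (rule bdd_aboveI)
      fix z assume "z \<in> insert 0 {z. 0 < z \<and> t \<le> \<tau> z}"
      thus "z \<le> Z" using Z dec_iff(2)[of z Z] by auto
    qed
  qed
  have psi0: "0 \<le> \<psi> t" if "Tm < t" for t unfolding \<psi>_def using bdda[OF that] by (intro cSup_upper) auto
  \<comment> \<open>An adjunction between \<psi> and \<tau>, from which the inverse property and the
    continuity of \<psi> are read off.\<close>
  have gal: "z \<le> \<psi> t \<longleftrightarrow> t \<le> \<tau> z" if "Tm < t" "0 < z" for t z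
  proof
    assume "t \<le> \<tau> z" thus "z \<le> \<psi> t" unfolding \<psi>_def using bdda that by (intro cSup_upper) auto
  next
    assume le: "z \<le> \<psi> t"
    show "t \<le> \<tau> z"
    proof (rule ccontr)
      assume "\<not> t \<le> \<tau> z"
      hence "\<tau> z < t" by simp
      with cont[OF that(2)] have "\<forall>\<^sub>F y in at z. \<tau> y < t"
        unfolding isCont_def by (rule order_tendstoD(2))
      then obtain r where r: "r > 0" "\<And>y. y \<noteq> z \<Longrightarrow> dist y z < r \<Longrightarrow> \<tau> y < t"
        unfolding eventually_at by auto
      define z' where "z' = z - min r z / 2"
      have z': "0 < z'" "z' < z" "\<tau> z' < t" using r(1) that(2) r(2)[of z'] by (auto simp: z'_def dist_real_def)
      have "\<psi> t \<le> z'" unfolding \<psi>_def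
      proof (rule cSup_least)
        fix x assume "x \<in> insert 0 {z. 0 < z \<and> t \<le> \<tau> z}"
        thus "x \<le> z'" using z' dec_iff(2)[of x z'] by auto
      qed simp
      thus False using le z' by simp
    qed
  qed
  have inv: "\<psi> (\<tau> z) = z" if "0 < z" for z
  proof (rule antisym)
    show "z \<le> \<psi> (\<tau> z)" using gal[OF Tlt] that by auto
    show "\<psi> (\<tau> z) \<le> z"
    proof (rule ccontr)
      assume "\<not> \<psi> (\<tau> z) \<le> z"
      moreover from this have "\<tau> z \<le> \<tau> (\<psi> (\<tau> z))" using gal[OF Tlt[OF that], of "\<psi> (\<tau> z)"] that by simp
      ultimately show False using dec[of z "\<psi> (\<tau> z)"] that by simp
    qed
  qed
  have psic: "isCont \<psi> t" if t: "Tm < t" for t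
    unfolding isCont_def
  proof (rule order_tendstoI)
    fix a assume a: "\<psi> t < a"
    hence a0: "0 < a" using psi0[OF t] by simp
    hence "\<tau> a < t" using gal[OF t a0] a by simp
    hence "\<forall>\<^sub>F s in nhds t. \<tau> a < s" by (intro eventually_nhds_in_open[of "{\<tau> a<..}", simplified]) 
    hence "\<forall>\<^sub>F s in nhds t. \<psi> s < a"
      by eventually_elim (use gal[of _ a] a0 Tlt[OF a0] in \<open>force simp: not_le[symmetric]\<close>)
    thus "\<forall>\<^sub>F s in at t. \<psi> s < a" by (simp add: eventually_at_filter eventually_mono)
  next
    fix a assume a: "a < \<psi> t"
    have evT: "\<forall>\<^sub>F s in nhds t. Tm < s" using t by (intro eventually_nhds_in_open[of "{Tm<..}", simplified])
    have "\<forall>\<^sub>F s in nhds t. a < \<psi> s"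
    proof (cases "a < 0")
      case True
      from evT show ?thesis by eventually_elim (use psi0 True in force)
    next
      case False
      define y where "y = \<psi> t"
      define z where "z = (a + y) / 2"
      have z: "a < z" "z < y" "0 < z" using a False by (auto simp: z_def y_def)
      have "t \<le> \<tau> y" using gal[OF t, of y] z by (simp add: y_def)
      also have "\<dots> < \<tau> z" using dec z by simp
      finally have "\<forall>\<^sub>F s in nhds t. s < \<tau> z" by (intro eventually_nhds_in_open[of "{..<\<tau> z}", simplified])
      with evT show ?thesis
      proof eventually_elim
        case (elim s)
        hence "z \<le> \<psi> s" using gal[of s z] z by simp
        thus ?case using z by simp
      qed
    qed
    thus "\<forall>\<^sub>F s in at t. a < \<psi> s" by (simp add: eventually_at_filter eventually_mono)
  qed
  have inv2: "\<tau> (\<psi> t) = t" if t: "Tm < t" "0 < \<psi> t" for t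
  proof (rule antisym)
    show "t \<le> \<tau> (\<psi> t)" using gal[OF t] by simp
    show "\<tau> (\<psi> t) \<le> t"
    proof (rule ccontr)
      assume "\<not> \<tau> (\<psi> t) \<le> t"
      hence "t < \<tau> (\<psi> t)" by simp
      with cont[OF t(2)] have "\<forall>\<^sub>F y in at (\<psi> t). t < \<tau> y"
        unfolding isCont_def by (rule order_tendstoD(1))
      then obtain r where r: "r > 0" "\<And>y. y \<noteq> \<psi> t \<Longrightarrow> dist y (\<psi> t) < r \<Longrightarrow> t < \<tau> y"
        unfolding eventually_at by auto
      have "t < \<tau> (\<psi> t + r / 2)" using r by (intro r(2)) (auto simp: dist_real_def)
      hence "\<psi> t + r / 2 \<le> \<psi> t" using gal[OF t(1), of "\<psi> t + r / 2"] t r by simp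
      thus False using r by simp
    qed
  qed
  have psid: "(\<psi> has_real_derivative - g (\<psi> t)) (at t)" if t: "Tm < t" "0 < \<psi> t" for t
  proof -
    define y where "y = \<psi> t"
    have y: "0 < y" using t by (simp add: y_def)
    have ty: "\<tau> y = t" using inv2 t by (simp add: y_def)
    have "(\<psi> has_real_derivative inverse (- (1 / g y))) (at t)"
    proof (rule DERIV_inverse_function[of \<tau> _ \<psi> t "\<tau> (2 * y)" "\<tau> (y / 2)"])
      show "(\<tau> has_real_derivative - (1 / g y)) (at (\<psi> t))" using d[OF y] by (simp add: y_def)
      show "- (1 / g y) \<noteq> 0" using g[OF y] by simp
      show "\<tau> (2 * y) < t" "t < \<tau> (y / 2)" using dec y by (auto simp flip: ty)
      show "\<tau> (\<psi> s) = s" if "\<tau> (2 * y) < s" "s < \<tau> (y / 2)" for s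
      proof (rule inv2)
        show T: "Tm < s" using that Tlt[of "2 * y"] y by simp
        have "y / 2 \<le> \<psi> s" using gal[OF T, of "y / 2"] y that by simp
        thus "0 < \<psi> s" using y by simp
      qed
      show "isCont \<psi> t" by (rule psic[OF t(1)])
    qed
    thus ?thesis using g[OF y] by (simp add: y_def)
  qed
  show ?thesis by (intro exI[of _ \<psi>] conjI allI impI Tlt psi0 gal inv psic psid)
qed

section \<open>Profiles: nonincreasing one-dimensional solutions with limit 0\<close>

definition profile :: "real \<Rightarrow> real \<Rightarrow> real \<Rightarrow> real \<Rightarrow> (real \<Rightarrow> real) \<Rightarrow> (real \<Rightarrow> real) \<Rightarrow> bool" where
  "profile q \<alpha> p \<beta> \<phi> \<phi>' \<longleftrightarrow>
     (\<forall>t>0. (\<phi> has_real_derivative \<phi>' t) (at t) \<and>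
        (\<phi>' has_real_derivative (\<alpha> * \<phi> t powr p + \<beta> * \<bar>\<phi>' t\<bar> powr q)) (at t) \<and> 0 \<le> \<phi> t \<and> \<phi>' t \<le> 0) \<and>
     (\<phi> \<longlongrightarrow> 0) at_top"

definition profile_limit :: "ennreal \<Rightarrow> (real \<Rightarrow> real) \<Rightarrow> bool" where
  "profile_limit M \<phi> \<longleftrightarrow>
     (if M = \<infinity> then filterlim \<phi> at_top (at_right 0) else (\<phi> \<longlongrightarrow> enn2real M) (at_right 0))"

text \<open>A decreasing solution satisfies \<phi>' = - g(\<phi>) with g = sqrt (2 h), so time is a
  quadrature \<tau> of -1/g in the value and \<phi> is its inverse. A single \<psi> serves all M > 0
  up to translation: it is started at its blow-up time \<open>Tm\<close> for M = \<infinity>, and at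
  \<open>\<tau> m\<close> for finite M = m. If \<tau> stays bounded as the value tends to 0, a dead
  core appears.\<close>

lemma profile_exists:
  assumes q: "1 < q" "q \<le> 2" and al: "0 < \<alpha>" and p: "0 < p" and be: "0 < \<beta>"
  shows "\<exists>\<phi> \<phi>'. profile q \<alpha> p \<beta> \<phi> \<phi>' \<and> profile_limit M \<phi>"
proof (cases "M = 0")
  \<comment> \<open>The quadrature lives on positive values, so M = 0 is served by the zero
    profile.\<close>
  case True
  show ?thesis
    by (rule exI[of _ "\<lambda>t. 0"], rule exI[of _ "\<lambda>t. 0"]) (simp add: profile_def profile_limit_def True)
next
  case False
  obtain h :: "real \<Rightarrow> real" where h: "continuous_on {0..} h" "h 0 = 0" "\<And>z. 0 < z \<Longrightarrow> 0 < h z"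
    "\<And>z. 0 < z \<Longrightarrow> (h has_real_derivative (\<alpha> * z powr p + \<beta> * (2 * h z) powr (q / 2))) (at z)"
    using energy_exists[OF q al p be] by blast
  define g where "g = (\<lambda>z. sqrt (2 * h z))"
  define E where "E = (\<lambda>z. \<alpha> * z powr p + \<beta> * g z powr q)"
  have g0: "g 0 = 0" by (simp add: g_def h)
  have gpos: "0 < g z" if "0 < z" for z using h(3)[OF that] by (simp add: g_def)
  have gnn: "0 \<le> g z" if "0 \<le> z" for z using gpos[of z] g0 that by (cases "z = 0") auto
  have gq: "(2 * h z) powr (q / 2) = g z powr q" if "0 < z" for z
    using h(3)[OF that] by (simp add: g_def powr_half_sqrt[symmetric] powr_powr)
  have gcont: "continuous_on {0..} g" unfolding g_def by (intro continuous_intros h(1))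
  have gder: "(g has_real_derivative E z / g z) (at z)" if z: "0 < z" for z
  proof -
    have "((\<lambda>z. 2 * h z) has_real_derivative 2 * (\<alpha> * z powr p + \<beta> * (2 * h z) powr (q / 2))) (at z)"
      by (rule DERIV_cmult[OF h(4)[OF z]])
    moreover have "0 < 2 * h z" using h(3)[OF z] by simp
    ultimately have "(g has_real_derivative inverse (sqrt (2 * h z)) / 2 * (2 * (\<alpha> * z powr p + \<beta> * (2 * h z) powr (q / 2)))) (at z)"
      unfolding g_def by (intro DERIV_chain2[OF DERIV_real_sqrt])
    thus ?thesis
      by (rule DERIV_cong) (simp add: gq[OF z] E_def, simp add: g_def divide_inverse)
  qed
  have "continuous_on {0<..} (\<lambda>z. - (1 / g z))"
  proof -
    have "continuous_on {0<..} g" by (rule continuous_on_subset[OF gcont]) auto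
    moreover have "g z \<noteq> 0" if "z \<in> {0<..}" for z using gpos[of z] that by auto
    ultimately show ?thesis by (intro continuous_intros ballI)
  qed
  then obtain \<tau> where \<tau>: "\<And>z. 0 < z \<Longrightarrow> (\<tau> has_real_derivative - (1 / g z)) (at z)"
    using antiderivative_half_line by blast
  \<comment> \<open>As g' = E / g \<ge> \<beta> g^(q-1), the derivative of g^(1-q) is at most -(q-1)
    \<beta> / g, so \<tau> - k g^(1-q) is nondecreasing. Hence \<tau> is bounded below: the gradient
    term alone forces a finite blow-up time, for every p.\<close>
  define k where "k = 1 / ((q - 1) * \<beta>)"
  have k: "0 < k" using q be by (simp add: k_def)
  have lowb: "\<tau> 1 - k * g 1 powr (1 - q) \<le> \<tau> z" if z: "0 < z" for z
  proof (cases "z \<le> 1")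
    case True
    have "\<tau> 1 \<le> \<tau> z"
    proof (rule DERIV_nonpos_imp_nonincreasing[OF True])
      fix x assume "z \<le> x" "x \<le> 1"
      thus "\<exists>y. (\<tau> has_real_derivative y) (at x) \<and> y \<le> 0"
        using \<tau>[of x] gpos[of x] z by (intro exI[of _ "- (1 / g x)"]) simp
    qed
    moreover have "0 \<le> k * g 1 powr (1 - q)" using k by simp
    ultimately show ?thesis by linarith
  next
    case False
    have "\<tau> 1 - k * g 1 powr (1 - q) \<le> \<tau> z - k * g z powr (1 - q)"
    proof (rule DERIV_nonneg_imp_nondecreasing[of 1 z "\<lambda>z. \<tau> z - k * g z powr (1 - q)"])
      fix x assume "1 \<le> x" "x \<le> z"
      hence x: "0 < x" by simp
      have "((\<lambda>z. \<tau> z - k * g z powr (1 - q)) has_real_derivative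
          - (1 / g x) - k * ((1 - q) * g x powr (1 - q - 1) * (E x / g x))) (at x)"
        using DERIV_diff[OF \<tau>[OF x] DERIV_cmult[OF DERIV_fun_powr[OF gder[OF x] gpos[OF x], of "1 - q"], of k]] by simp
      moreover have "0 \<le> - (1 / g x) - k * ((1 - q) * g x powr (1 - q - 1) * (E x / g x))"
      proof -
        have "k * (q - 1) = 1 / \<beta>" using q by (simp add: k_def)
        moreover have "- k * ((1 - q) * X * Y) = k * (q - 1) * X * Y" for X Y by (simp add: algebra_simps)
        moreover have "1 - q - 1 = - q" by simp
        ultimately have "- k * ((1 - q) * g x powr (1 - q - 1) * (E x / g x)) = 1 / \<beta> * g x powr (- q) * (E x / g x)"
          by metis
        moreover have "1 / \<beta> * g x powr (- q) * (\<beta> * g x powr q / g x) \<le> 1 / \<beta> * g x powr (- q) * (E x / g x)"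
          using be gpos[OF x] al by (intro mult_left_mono divide_right_mono) (auto simp: E_def)
        moreover have "1 / \<beta> * g x powr (- q) * (\<beta> * g x powr q / g x) = 1 / g x"
          using be gpos[OF x] by (simp add: powr_minus field_simps)
        ultimately show ?thesis by linarith
      qed
      ultimately show "\<exists>y. ((\<lambda>z. \<tau> z - k * g z powr (1 - q)) has_real_derivative y) (at x) \<and> 0 \<le> y" by blast
    qed (use False in auto)
    moreover have "0 \<le> k * g z powr (1 - q)" using k by simp
    ultimately show ?thesis by linarith
  qed
  hence bdd: "bdd_below (\<tau> ` {0<..})" by (intro bdd_belowI2[of _ "\<tau> 1 - k * g 1 powr (1 - q)"]) auto
  define Tm where "Tm = Inf (\<tau> ` {0<..})"
  obtain \<psi> where psi: "\<And>z. 0 < z \<Longrightarrow> Tm < \<tau> z" "\<And>t. Tm < t \<Longrightarrow> 0 \<le> \<psi> t"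
    "\<And>t z. Tm < t \<Longrightarrow> 0 < z \<Longrightarrow> z \<le> \<psi> t \<longleftrightarrow> t \<le> \<tau> z"
    "\<And>z. 0 < z \<Longrightarrow> \<psi> (\<tau> z) = z"
    "\<And>t. Tm < t \<Longrightarrow> isCont \<psi> t"
    "\<And>t. Tm < t \<Longrightarrow> 0 < \<psi> t \<Longrightarrow> (\<psi> has_real_derivative - g (\<psi> t)) (at t)"
    using extended_inverse_exists[OF \<tau> gpos bdd, folded Tm_def] by blast
  define Z where "Z = {t. Tm < t \<and> \<psi> t = 0}"
  \<comment> \<open>Edge of the dead core, the only point where the differential relations are not
    immediate. If \<open>Z\<close> is empty, \<open>Ts\<close> is some unspecified real, which does
    no harm because \<psi> is then positive throughout.\<close>
  define Ts where "Ts = Inf Z"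
  have Zup: "s \<in> Z" if "t \<in> Z" "t \<le> s" for s t
  proof -
    have s: "Tm < s" using that by (simp add: Z_def)
    have "\<not> 0 < \<psi> s"
    proof
      assume c: "0 < \<psi> s"
      hence "s \<le> \<tau> (\<psi> s)" using psi(3)[OF s c] by simp
      hence "\<psi> s \<le> \<psi> t" using psi(3)[of t "\<psi> s"] c that by (simp add: Z_def)
      thus False using c that by (simp add: Z_def)
    qed
    thus ?thesis using psi(2)[OF s] s by (simp add: Z_def)
  qed
  have Zb: "bdd_below Z" by (rule bdd_belowI[of _ Tm]) (simp add: Z_def)
  have dich: "0 < \<psi> t \<or> (\<forall>\<^sub>F s in nhds t. s \<in> Z)" if t: "Tm < t" "t \<noteq> Ts" for t
  proof (cases "t \<in> Z")
    case False thus ?thesis using psi(2)[OF t(1)] t by (auto simp: Z_def)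
  next
    case True
    hence "Ts \<le> t" unfolding Ts_def by (intro cInf_lower Zb)
    hence "Ts < t" using t by simp
    hence "\<exists>s\<in>Z. s < t" using True cInf_less_iff[OF _ Zb, of t] unfolding Ts_def by blast
    then obtain s where s: "s \<in> Z" "s < t" by blast
    have "\<forall>\<^sub>F x in nhds t. s < x" using s by (intro eventually_nhds_in_open[of "{s<..}", simplified])
    hence "\<forall>\<^sub>F x in nhds t. x \<in> Z" by eventually_elim (use Zup[OF s(1)] in auto)
    thus ?thesis ..
  qed
  have psicon: "continuous_on {Tm<..} \<psi>"
    using psi(5) by (intro continuous_at_imp_continuous_on) auto
  have gpsi: "continuous_on {Tm<..} (\<lambda>t. g (\<psi> t))"
    by (rule continuous_on_compose2[OF gcont psicon]) (use psi(2) in auto)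
  have D1: "(\<psi> has_real_derivative - g (\<psi> t)) (at t)" if t: "Tm < t" for t
  proof (rule has_real_derivative_removable[OF psicon _ t, where T = Ts])
    show "continuous_on {Tm<..} (\<lambda>t. - g (\<psi> t))" using gpsi by (intro continuous_intros)
    fix s assume s: "Tm < s" "s \<noteq> Ts"
    from dich[OF s] show "(\<psi> has_real_derivative - g (\<psi> s)) (at s)"
    proof
      assume ev: "\<forall>\<^sub>F s in nhds s. s \<in> Z"
      have "\<psi> s = 0" using eventually_nhds_x_imp_x[OF ev] by (simp add: Z_def)
      moreover from ev have "\<forall>\<^sub>F s in nhds s. \<psi> s = (\<lambda>_. 0) s" by eventually_elim (simp add: Z_def)
      hence "(\<psi> has_real_derivative 0) (at s)" using DERIV_cong_ev[of s s \<psi> "\<lambda>_. 0" 0 0] by simp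
      ultimately show ?thesis by (simp add: g0)
    qed (rule psi(6)[OF s(1)])
  qed
  have D2: "((\<lambda>t. - g (\<psi> t)) has_real_derivative E (\<psi> t)) (at t)" if t: "Tm < t" for t
  proof (rule has_real_derivative_removable[OF _ _ t, where T = Ts])
    show "continuous_on {Tm<..} (\<lambda>t. - g (\<psi> t))" using gpsi by (intro continuous_intros)
    show "continuous_on {Tm<..} (\<lambda>t. E (\<psi> t))"
      unfolding E_def using gpsi psicon psi(2) gnn p q
      by (intro continuous_on_add continuous_on_mult continuous_on_const continuous_on_powr') auto
    fix s assume s: "Tm < s" "s \<noteq> Ts"
    from dich[OF s] show "((\<lambda>t. - g (\<psi> t)) has_real_derivative E (\<psi> s)) (at s)"
    proof
      assume pos: "0 < \<psi> s"
      have "((\<lambda>t. g (\<psi> t)) has_real_derivative E (\<psi> s) / g (\<psi> s) * (- g (\<psi> s))) (at s)"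
        by (rule DERIV_chain2[OF gder[OF pos] psi(6)[OF s(1) pos]])
      from DERIV_minus[OF this] show ?thesis using gpos[OF pos] by simp
    next
      assume ev: "\<forall>\<^sub>F s in nhds s. s \<in> Z"
      have "\<psi> s = 0" using eventually_nhds_x_imp_x[OF ev] by (simp add: Z_def)
      moreover from ev have "\<forall>\<^sub>F s in nhds s. - g (\<psi> s) = (\<lambda>_. 0) s" by eventually_elim (simp add: Z_def g0)
      hence "((\<lambda>t. - g (\<psi> t)) has_real_derivative 0) (at s)"
        using DERIV_cong_ev[of s s "\<lambda>t. - g (\<psi> t)" "\<lambda>_. 0" 0 0] by simp
      ultimately show ?thesis using p q by (simp add: E_def g0)
    qed
  qed
  have prof: "profile q \<alpha> p \<beta> (\<lambda>t. \<psi> (t + t0)) (\<lambda>t. - g (\<psi> (t + t0)))" if t0: "Tm \<le> t0" for t0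
    unfolding profile_def
  proof (intro conjI allI impI)
    fix t :: real assume "0 < t"
    hence t: "Tm < t + t0" using t0 by simp
    show "((\<lambda>t. \<psi> (t + t0)) has_real_derivative - g (\<psi> (t + t0))) (at t)"
      using D1[OF t] by (simp add: DERIV_shift)
    show "((\<lambda>t. - g (\<psi> (t + t0))) has_real_derivative \<alpha> * \<psi> (t + t0) powr p + \<beta> * \<bar>- g (\<psi> (t + t0))\<bar> powr q) (at t)"
      using D2[OF t] DERIV_shift[of "\<lambda>t. - g (\<psi> t)" _ t t0] gnn[OF psi(2)[OF t]] by (simp add: E_def)
    show "0 \<le> \<psi> (t + t0)" using psi(2)[OF t] .
    show "- g (\<psi> (t + t0)) \<le> 0" using gnn[OF psi(2)[OF t]] by simp
  next
    show "((\<lambda>t. \<psi> (t + t0)) \<longlongrightarrow> 0) at_top"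
    proof (rule order_tendstoI)
      fix a :: real assume a: "a < 0"
      show "\<forall>\<^sub>F t in at_top. a < \<psi> (t + t0)"
        using eventually_gt_at_top[of "Tm - t0"]
      proof eventually_elim
        case (elim t)
        thus ?case using psi(2)[of "t + t0"] a by simp
      qed
    next
      fix a :: real assume a: "0 < a"
      show "\<forall>\<^sub>F t in at_top. \<psi> (t + t0) < a"
        using eventually_gt_at_top[of "\<tau> a - t0"]
      proof eventually_elim
        case (elim t)
        have "Tm < t + t0" using elim psi(1)[OF a] by simp
        from psi(3)[OF this a] show ?case using elim by simp
      qed
    qed
  qed
  show ?thesis
  proof (cases "M = \<infinity>")
    case True
    have "filterlim (\<lambda>t. \<psi> (t + Tm)) at_top (at_right 0)"
      unfolding filterlim_at_top_ge[of _ _ 1]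
    proof (intro allI impI)
      fix Y :: real assume "1 \<le> Y"
      hence Y: "0 < Y" by simp
      have "0 < \<tau> Y - Tm" using psi(1)[OF Y] by simp
      hence "\<forall>\<^sub>F t in at_right 0. t \<in> {0<..<\<tau> Y - Tm}" by (rule eventually_at_right_real)
      thus "\<forall>\<^sub>F t in at_right 0. Y \<le> \<psi> (t + Tm)"
      proof eventually_elim
        case (elim t)
        thus ?case using psi(3)[of "t + Tm" Y] Y by simp
      qed
    qed
    thus ?thesis using prof[of Tm] True unfolding profile_limit_def by auto
  next
    case MF: False
    define m where "m = enn2real M"
    have m: "0 < m" using MF False by (simp add: m_def enn2real_positive_iff less_top infinity_ennreal_def top.not_eq_extremum zero_less_iff_neq_zero)
    have "isCont \<psi> (\<tau> m)" using psi(5)[OF psi(1)[OF m]] .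
    hence "((\<lambda>t. \<psi> (t + \<tau> m)) \<longlongrightarrow> \<psi> (0 + \<tau> m)) (at 0)"
      using LIM_offset_zero[of \<psi> "\<psi> (\<tau> m)" "\<tau> m"] unfolding isCont_def by (simp add: add.commute)
    hence "((\<lambda>t. \<psi> (t + \<tau> m)) \<longlongrightarrow> m) (at_right 0)"
      using psi(4)[OF m] by (simp add: filterlim_at_split)
    thus ?thesis using prof[of "\<tau> m"] psi(1)[OF m] MF unfolding profile_limit_def m_def by auto
  qed
qed

section \<open>Comparison with one-dimensional solutions\<close>

lemma profileD:
  assumes "profile q \<alpha> p \<beta> \<phi> \<phi>'" "0 < t"
  shows "(\<phi> has_real_derivative \<phi>' t) (at t)"
    "(\<phi>' has_real_derivative (\<alpha> * \<phi> t powr p + \<beta> * \<bar>\<phi>' t\<bar> powr q)) (at t)" "0 \<le> \<phi> t" "\<phi>' t \<le> 0"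
  using assms unfolding profile_def by auto

lemma profile_antimono:
  assumes pr: "profile q \<alpha> p \<beta> \<phi> \<phi>'" and "0 < s" "s \<le> t"
  shows "\<phi> t \<le> \<phi> s"
proof (rule DERIV_nonpos_imp_nonincreasing[OF \<open>s \<le> t\<close>])
  fix x assume "s \<le> x" "x \<le> t"
  hence x: "0 < x" using assms by simp
  show "\<exists>y. (\<phi> has_real_derivative y) (at x) \<and> y \<le> 0" using profileD(1,4)[OF pr x] by blast
qed

lemma profile_le_limit:
  assumes pr: "profile q \<alpha> p \<beta> \<phi> \<phi>'" and lim: "(\<phi> \<longlongrightarrow> L) (at_right 0)" and t: "0 < t"
  shows "\<phi> t \<le> L"
proof (rule tendsto_lowerbound[OF lim])
  have "\<forall>\<^sub>F s in at_right 0. s \<in> {0<..<t}" by (rule eventually_at_right_real[OF t])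
  thus "\<forall>\<^sub>F s in at_right 0. \<phi> t \<le> \<phi> s"
    by eventually_elim (use profile_antimono[OF pr] in auto)
qed simp

lemma DERIV_scaled_shift:
  assumes "(f has_real_derivative D) (at ((t + d) / c))" "c \<noteq> 0"
  shows "((\<lambda>t. f ((t + d) / c)) has_real_derivative D / c) (at t)"
proof -
  have "((\<lambda>t. (t + d) / c) has_real_derivative 1 / c) (at t)"
    using assms(2) by (auto intro!: derivative_eq_intros)
  from DERIV_chain2[OF assms(1) this] show ?thesis by simp
qed

lemma DERIV_scaled_profile:
  assumes pr: "profile q \<alpha> p \<beta> \<phi> \<phi>'" and "0 < c" "0 < t + d"
  shows "((\<lambda>t. m + c * \<phi> ((t + d) / c)) has_real_derivative \<phi>' ((t + d) / c)) (at t)"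
    "((\<lambda>t. \<phi>' ((t + d) / c)) has_real_derivative
       (\<alpha> * \<phi> ((t + d) / c) powr p + \<beta> * \<bar>\<phi>' ((t + d) / c)\<bar> powr q) / c) (at t)"
proof -
  have s: "0 < (t + d) / c" using assms by simp
  show "((\<lambda>t. m + c * \<phi> ((t + d) / c)) has_real_derivative \<phi>' ((t + d) / c)) (at t)"
    using DERIV_add[OF DERIV_const DERIV_cmult[OF DERIV_scaled_shift[OF profileD(1)[OF pr s]]], of m c] assms by simp
  show "((\<lambda>t. \<phi>' ((t + d) / c)) has_real_derivative
       (\<alpha> * \<phi> ((t + d) / c) powr p + \<beta> * \<bar>\<phi>' ((t + d) / c)\<bar> powr q) / c) (at t)"
    using assms by (intro DERIV_scaled_shift[OF profileD(2)[OF pr s]]) auto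
qed

text \<open>Chooses the slope of the lower barrier so that its cost stays below a given surplus;
  \<eta> \<le> 1 lets \<eta>^q be replaced by \<eta>.\<close>

lemma ex_small_perturbation:
  fixes n \<beta> q g :: real
  assumes "0 \<le> n" "0 < \<beta>" "1 < q" "0 < g"
  shows "\<exists>\<eta>>0. n * \<eta> + \<beta> * \<eta> powr q < g"
proof -
  have nb: "0 < n + \<beta>" using assms by simp
  define \<eta> where "\<eta> = min 1 (g / (2 * (n + \<beta>)))"
  have eta: "0 < \<eta>" "\<eta> \<le> 1" using assms nb by (auto simp: \<eta>_def)
  have "\<eta> powr q \<le> \<eta> powr 1" using eta assms by (intro powr_mono') auto
  hence "\<beta> * \<eta> powr q \<le> \<beta> * \<eta>" using assms eta by (intro mult_left_mono) auto
  hence "n * \<eta> + \<beta> * \<eta> powr q \<le> (n + \<beta>) * \<eta>" by (simp add: algebra_simps)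
  also have "\<dots> \<le> (n + \<beta>) * (g / (2 * (n + \<beta>)))" using nb by (intro mult_left_mono) (auto simp: \<eta>_def)
  also have "x * (g / (2 * x)) = g / 2" if "x \<noteq> 0" for x :: real using that by simp
  hence "(n + \<beta>) * (g / (2 * (n + \<beta>))) = g / 2" using nb by (metis less_irrefl)
  also have "\<dots> < g" using assms by simp
  finally show ?thesis using eta by blast
qed

lemma filterlim_scaled_at_top: "0 < c \<Longrightarrow> filterlim (\<lambda>t. (t + d) / c :: real) at_top at_top"
  unfolding filterlim_at_top
proof
  fix Z assume c: "0 < c"
  show "\<forall>\<^sub>F t in at_top. Z \<le> (t + d) / c"
    using eventually_ge_at_top[of "Z * c - d"] by eventually_elim (use c in \<open>simp add: field_simps\<close>)
qed

lemma filterlim_scaled_at_right: "0 < c \<Longrightarrow> filterlim (\<lambda>t. (t - d) / c :: real) (at_right 0) (at_right d)"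
proof -
  assume c: "0 < c"
  have "((\<lambda>t. (t - d) / c) \<longlongrightarrow> (d - d) / c) (at_right d)" by (intro tendsto_intros) (use c in auto)
  moreover have "\<forall>\<^sub>F t in at_right d. (t - d) / c \<in> {0<..} \<and> (t - d) / c \<noteq> 0"
    using eventually_at_right_less[of d] by eventually_elim (use c in auto)
  ultimately show ?thesis by (simp add: filterlim_at)
qed

locale half_space_problem = half_space_solution q \<alpha> p \<beta> z
  for q \<alpha> p \<beta> :: real and z :: "real \<times> (real^'m) \<Rightarrow> real" +
  fixes M :: ennreal
  assumes bl: "boundary_limit M z"

lemma solves_P_imp_half_space_problem:
  assumes "1 < q" "q \<le> 2" "0 \<le> \<alpha>" "0 < p" "0 < \<beta>" "solves_P q \<alpha> p \<beta> M z"
  shows "half_space_problem q \<alpha> p \<beta> z M"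
  using assms unfolding solves_P_def by unfold_locales auto

context half_space_problem
begin

lemma boundary_infinite: "M = \<infinity> \<Longrightarrow> compact K \<Longrightarrow> \<forall>\<^sub>F t in at_right 0. \<forall>y\<in>K. A < z (t, y)"
  using bl unfolding boundary_limit_def by auto

lemma boundary_finite:
  assumes "M \<noteq> \<infinity>" "compact K" "0 < e"
  shows "\<forall>\<^sub>F t in at_right 0. \<forall>y\<in>K. \<bar>z (t, y) - enn2real M\<bar> < e"
  using bl assms unfolding boundary_limit_def uniform_limit_iff dist_real_def by auto

lemma lower_bound_by_profile:
  assumes pr: "profile q \<alpha> p \<beta> \<phi> \<phi>'"
    and m: "0 \<le> m" "0 < \<alpha> \<Longrightarrow> m = 0" "\<And>\<xi>. \<xi> \<in> half_space \<Longrightarrow> m \<le> z \<xi>"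
    and c: "0 < c" "c < 1" and e: "0 < \<epsilon>"
    and dM: "M = \<infinity> \<and> 0 < \<delta> \<or> M \<noteq> \<infinity> \<and> \<delta> = 0 \<and> (\<phi> \<longlongrightarrow> enn2real M - m) (at_right 0)"
    and gain: "0 < g" "\<And>s. 0 < s \<Longrightarrow> \<epsilon> < \<phi> s \<Longrightarrow> g \<le> \<alpha> * \<phi> s powr p + \<beta> * \<bar>\<phi>' s\<bar> powr q"
    and t: "0 < t"
  shows "m + c * \<phi> ((t + \<delta>) / c) - \<epsilon> \<le> z (t, y)"
proof -
  obtain \<eta> where eta: "0 < \<eta>" "real (DIM(real^'m)) * \<eta> + \<beta> * \<eta> powr q < (1 / c - 1) * g"
    using ex_small_perturbation[of "real (DIM(real^'m))" \<beta> q "(1 / c - 1) * g"] beta q c gain by auto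
  have d0: "0 \<le> \<delta>" using dM by auto
  \<comment> \<open>A bound for the comparison function that \<open>z\<close> exceeds, up to
    \<epsilon>, near the boundary.\<close>
  define B where "B = (if M = \<infinity> then m + c * \<phi> (\<delta> / c) else enn2real M)"
  have fB: "m + c * \<phi> ((t + \<delta>) / c) \<le> B" if "0 < t" for t
  proof (cases "M = \<infinity>")
    case True
    hence "0 < \<delta>" using dM by auto
    hence "\<phi> ((t + \<delta>) / c) \<le> \<phi> (\<delta> / c)" using c that
      by (intro profile_antimono[OF pr]) (auto simp: divide_right_mono)
    thus ?thesis using True c by (simp add: B_def)
  next
    case False
    hence "\<phi> ((t + \<delta>) / c) \<le> enn2real M - m" using dM c that by (intro profile_le_limit[OF pr]) auto
    moreover have "c * \<phi> ((t + \<delta>) / c) \<le> 1 * \<phi> ((t + \<delta>) / c)"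
      using c d0 that profileD(3)[OF pr, of "(t + \<delta>) / c"] by (intro mult_right_mono) auto
    ultimately show ?thesis using False by (simp add: B_def)
  qed
  show ?thesis
  proof (rule lower_comparison[where f = "\<lambda>t. m + c * \<phi> ((t + \<delta>) / c)" and f' = "\<lambda>t. \<phi>' ((t + \<delta>) / c)"
        and f'' = "\<lambda>t. (\<alpha> * \<phi> ((t + \<delta>) / c) powr p + \<beta> * \<bar>\<phi>' ((t + \<delta>) / c)\<bar> powr q) / c"])
    show "0 < \<eta>" by (rule eta(1))
    fix t :: real assume t: "0 < t" and mt: "m + \<epsilon> < m + c * \<phi> ((t + \<delta>) / c)"
    define s where "s = (t + \<delta>) / c"
    have s: "0 < s" using t d0 c by (simp add: s_def)
    have phi0: "0 \<le> \<phi> s" using profileD(3)[OF pr s] .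
    have cphi: "c * \<phi> s \<le> \<phi> s" using c phi0 mult_right_mono[of c 1 "\<phi> s"] by simp
    hence "\<epsilon> < \<phi> s" using mt by (simp add: s_def)
    hence G: "(1 / c - 1) * g \<le> (1 / c - 1) * (\<alpha> * \<phi> s powr p + \<beta> * \<bar>\<phi>' s\<bar> powr q)"
      using c by (intro mult_left_mono gain(2)[OF s]) auto
    have "\<alpha> * (m + c * \<phi> s) powr p \<le> \<alpha> * \<phi> s powr p"
    proof (cases "\<alpha> = 0")
      case False
      hence "m = 0" using m(2) alpha by simp
      thus ?thesis using alpha p c phi0 cphi by (intro mult_left_mono powr_mono2) auto
    qed simp
    thus "\<alpha> * (m + c * \<phi> ((t + \<delta>) / c)) powr p + \<beta> * \<bar>\<phi>' ((t + \<delta>) / c)\<bar> powr q + (real DIM(real^'m) * \<eta> + \<beta> * \<eta> powr q)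
         < (\<alpha> * \<phi> ((t + \<delta>) / c) powr p + \<beta> * \<bar>\<phi>' ((t + \<delta>) / c)\<bar> powr q) / c"
      using G eta(2) unfolding s_def[symmetric] by (simp add: left_diff_distrib)
  next
    have "((\<lambda>t. \<phi> ((t + \<delta>) / c)) \<longlongrightarrow> 0) at_top"
      by (rule filterlim_compose[OF _ filterlim_scaled_at_top[OF c(1)]]) (use pr in \<open>simp add: profile_def\<close>)
    hence "((\<lambda>t. m + c * \<phi> ((t + \<delta>) / c)) \<longlongrightarrow> m + c * 0) at_top"
      by (intro tendsto_add tendsto_mult tendsto_const)
    hence "\<forall>\<^sub>F t in at_top. m + c * \<phi> ((t + \<delta>) / c) < m + \<epsilon>" using e by (intro order_tendstoD(2)) auto
    thus "\<forall>\<^sub>F t in at_top. m + c * \<phi> ((t + \<delta>) / c) \<le> m + \<epsilon>" by eventually_elim simp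
  next
    fix K :: "(real^'m) set" assume K: "compact K"
    have pos: "\<forall>\<^sub>F t in at_right 0. (0::real) < t" by (rule eventually_at_right_less)
    have "\<forall>\<^sub>F t in at_right 0. \<forall>y\<in>K. B - \<epsilon> < z (t, y)"
    proof (cases "M = \<infinity>")
      case False
      from boundary_finite[OF False K e] show ?thesis
      proof eventually_elim
        case (elim t)
        thus ?case using False by (auto simp: B_def abs_less_iff dest!: bspec)
      qed
    qed (rule boundary_infinite[OF _ K])
    with pos show "\<forall>\<^sub>F t in at_right 0. \<forall>y\<in>K. m + c * \<phi> ((t + \<delta>) / c) - \<epsilon> < z (t, y)"
    proof eventually_elim
      case (elim t)
      show ?case using fB[OF elim(1)] elim(2) by force
    qed
  next
    fix t :: real assume "0 < t"
    hence t: "0 < t + \<delta>" using d0 by simp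
    show "((\<lambda>t. m + c * \<phi> ((t + \<delta>) / c)) has_real_derivative \<phi>' ((t + \<delta>) / c)) (at t)"
      "((\<lambda>t. \<phi>' ((t + \<delta>) / c)) has_real_derivative
       (\<alpha> * \<phi> ((t + \<delta>) / c) powr p + \<beta> * \<bar>\<phi>' ((t + \<delta>) / c)\<bar> powr q) / c) (at t)"
      using DERIV_scaled_profile[OF pr c(1) t] by blast+
  qed (use m e t fB in auto)
qed

text \<open>For M = \<infinity> the comparison starts at \<xi>1 = \<delta>, where \<open>z\<close>
  is bounded on compact sets while the shifted profile blows up. For finite M the limit m + c (M -
  m) is at least M, because c > 1 and m \<le> M.\<close>

lemma upper_boundary:
  assumes pr: "profile q \<alpha> p \<beta> \<phi> \<phi>'" and m: "0 \<le> m" and c: "1 < c" and e: "0 < \<epsilon>"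
    and dM: "M = \<infinity> \<and> 0 < \<delta> \<and> filterlim \<phi> at_top (at_right 0) \<or>
       M \<noteq> \<infinity> \<and> \<delta> = 0 \<and> m \<le> enn2real M \<and> (\<phi> \<longlongrightarrow> enn2real M - m) (at_right 0)"
  shows "\<exists>a1>\<delta>. \<forall>t y. \<delta> < t \<and> t < a1 \<and> y \<in> cball y0 R \<longrightarrow> z (t, y) < m + c * \<phi> ((t - \<delta>) / c) + \<epsilon>"
proof -
  have K: "compact (cball y0 R)" by simp
  have c0: "0 < c" using c by simp
  have "\<forall>\<^sub>F t in at_right \<delta>. \<forall>y\<in>cball y0 R. z (t, y) < m + c * \<phi> ((t - \<delta>) / c) + \<epsilon>"
    using dM
  proof (elim disjE conjE)
    assume d: "0 < \<delta>" and top: "filterlim \<phi> at_top (at_right 0)"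
    have "{\<delta>..\<delta>+1} \<times> cball y0 R \<subseteq> half_space" using d by (auto simp: half_space_def)
    from bounded_above_on_compact[OF compact_Times[OF compact_Icc K] this]
    obtain B where B: "\<And>\<xi>. \<xi> \<in> {\<delta>..\<delta>+1} \<times> cball y0 R \<Longrightarrow> z \<xi> \<le> B" by blast
    have "filterlim (\<lambda>t. \<phi> ((t - \<delta>) / c)) at_top (at_right \<delta>)"
      by (rule filterlim_compose[OF top filterlim_scaled_at_right[OF c0]])
    hence "\<forall>\<^sub>F t in at_right \<delta>. \<bar>B\<bar> \<le> \<phi> ((t - \<delta>) / c)" by (auto simp: filterlim_at_top)
    moreover have "\<forall>\<^sub>F t in at_right \<delta>. t \<in> {\<delta><..<\<delta>+1}" by (rule eventually_at_right_real) simp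
    ultimately show ?thesis
    proof eventually_elim
      case (elim t)
      have "1 * \<bar>B\<bar> \<le> c * \<phi> ((t - \<delta>) / c)" using elim c by (intro mult_mono) auto
      moreover have "z (t, y) \<le> B" if "y \<in> cball y0 R" for y using B[of "(t, y)"] elim that by auto
      ultimately show ?case using m e by force
    qed
  next
    assume MF: "M \<noteq> \<infinity>" and d: "\<delta> = 0" and mM: "m \<le> enn2real M" and lim: "(\<phi> \<longlongrightarrow> enn2real M - m) (at_right 0)"
    have "((\<lambda>t. m + c * \<phi> ((t - \<delta>) / c)) \<longlongrightarrow> m + c * (enn2real M - m)) (at_right \<delta>)"
      by (intro tendsto_intros filterlim_compose[OF lim filterlim_scaled_at_right[OF c0]])
    moreover have "enn2real M - \<epsilon> / 2 < m + c * (enn2real M - m)"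
      using mult_right_mono[of 1 c "enn2real M - m"] c mM e by simp
    ultimately have "\<forall>\<^sub>F t in at_right \<delta>. enn2real M - \<epsilon> / 2 < m + c * \<phi> ((t - \<delta>) / c)"
      by (rule order_tendstoD(1))
    moreover have "\<forall>\<^sub>F t in at_right \<delta>. \<forall>y\<in>cball y0 R. \<bar>z (t, y) - enn2real M\<bar> < \<epsilon> / 2"
      using boundary_finite[OF MF K, of "\<epsilon> / 2"] e d by simp
    ultimately show ?thesis
    proof eventually_elim
      case (elim t)
      show ?case
      proof
        fix y assume "y \<in> cball y0 R"
        hence "\<bar>z (t, y) - enn2real M\<bar> < \<epsilon> / 2" using elim(2) by blast
        thus "z (t, y) < m + c * \<phi> ((t - \<delta>) / c) + \<epsilon>" using elim(1) by linarith
      qed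
    qed
  qed
  thus ?thesis unfolding eventually_at_right_field by blast
qed

end

section \<open>Profiles as solutions in the half space\<close>

lemma profile_solves_P:
  fixes \<phi> \<phi>' :: "real \<Rightarrow> real"
  assumes q: "1 < q" and p: "0 < p"
    and pr: "profile q \<alpha> p \<beta> \<phi> \<phi>'" and lim: "profile_limit M \<phi>"
  shows "solves_P q \<alpha> p \<beta> M (\<lambda>\<xi> :: real \<times> (real^'m). \<phi> (fst \<xi>))"
proof -
  let ?H = "half_space :: (real \<times> (real^'m)) set"
  let ?z = "\<lambda>\<xi> :: real \<times> (real^'m). \<phi> (fst \<xi>)"
  define \<phi>'' where "\<phi>'' = (\<lambda>t. \<alpha> * \<phi> t powr p + \<beta> * \<bar>\<phi>' t\<bar> powr q)"
  have H: "0 < fst \<xi>" if "\<xi> \<in> ?H" for \<xi> using that by (simp add: half_space_def)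
  \<comment> \<open>The constant factor \<open>c\<close> lets one statement serve both
    \<phi>(\<xi>1) and its partial derivatives, which carry the factor \<open>fst b\<close>.\<close>
  have comp: "((\<lambda>\<xi> :: real \<times> (real^'m). F (fst \<xi>) * c) has_derivative (\<lambda>v. D * fst v * c)) (at \<xi>)"
    if "(F has_real_derivative D) (at (fst \<xi>))" for F D c \<xi>
  proof -
    have "(F has_derivative (\<lambda>h. D * h)) (at (fst \<xi>))" using that by (simp add: has_field_derivative_def)
    from has_derivative_compose[OF has_derivative_fst[OF has_derivative_ident] this]
    have "((\<lambda>\<xi> :: real \<times> (real^'m). F (fst \<xi>)) has_derivative (\<lambda>v. D * fst v)) (at \<xi>)" .
    from has_derivative_mult_left[OF this, of c] show ?thesis .
  qed
  have d0: "(?z has_derivative (\<lambda>v. \<phi>' (fst \<xi>) * fst v)) (at \<xi>)" if "\<xi> \<in> ?H" for \<xi>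
    using comp[OF profileD(1)[OF pr H[OF that]], of 1] by simp
  have p1: "partial_deriv b ?z \<xi> = \<phi>' (fst \<xi>) * fst b" if "\<xi> \<in> ?H" for \<xi> b
    unfolding partial_deriv_def frechet_derivative_at[OF d0[OF that], symmetric] ..
  have d1: "(partial_deriv b ?z has_derivative (\<lambda>v. \<phi>'' (fst \<xi>) * fst v * fst b)) (at \<xi>)" if xi: "\<xi> \<in> ?H" for \<xi> b
  proof -
    have "((\<lambda>\<xi> :: real \<times> (real^'m). \<phi>' (fst \<xi>) * fst b) has_derivative (\<lambda>v. \<phi>'' (fst \<xi>) * fst v * fst b)) (at \<xi>)"
      unfolding \<phi>''_def by (rule comp[OF profileD(2)[OF pr H[OF xi]]])
    thus ?thesis
      by (rule has_derivative_transform_within_open[OF _ open_half_space xi]) (simp add: p1)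
  qed
  have p2: "partial_deriv b' (partial_deriv b ?z) \<xi> = \<phi>'' (fst \<xi>) * fst b' * fst b" if "\<xi> \<in> ?H" for \<xi> b b'
    unfolding partial_deriv_def[of b'] frechet_derivative_at[OF d1[OF that], symmetric] ..
  have cont: "continuous_on {0<..} \<phi>" "continuous_on {0<..} \<phi>'"
    using DERIV_isCont[OF profileD(1)[OF pr]] DERIV_isCont[OF profileD(2)[OF pr]]
    by (auto intro!: continuous_at_imp_continuous_on)
  have cont'': "continuous_on {0<..} \<phi>''"
    unfolding \<phi>''_def using cont p q profileD(3)[OF pr]
    by (intro continuous_on_add continuous_on_mult continuous_on_const continuous_on_powr' continuous_on_rabs) auto
  have C2: "C2_on ?H ?z"
    unfolding C2_on_def
  proof (intro conjI ballI)
    show "?z differentiable_on ?H"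
      using d0 by (intro differentiable_at_imp_differentiable_on) (auto simp: differentiable_def)
    fix b b' :: "real \<times> (real^'m)"
    show "partial_deriv b ?z differentiable_on ?H"
    proof (rule differentiable_at_imp_differentiable_on)
      fix \<xi> assume "\<xi> \<in> ?H"
      from d1[OF this, of b] show "partial_deriv b ?z differentiable (at \<xi>)"
        unfolding differentiable_def by blast
    qed
    have "continuous_on ?H (\<lambda>\<xi>. \<phi>'' (fst \<xi>))"
      by (rule continuous_on_compose2[OF cont'' continuous_on_fst[OF continuous_on_id]]) (use H in auto)
    hence "continuous_on ?H (\<lambda>\<xi>. \<phi>'' (fst \<xi>) * fst b' * fst b)"
      by (intro continuous_on_mult continuous_on_const)
    thus "continuous_on ?H (partial_deriv b' (partial_deriv b ?z))"
      by (rule continuous_on_eq) (simp add: p2)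
  qed
  have eq: "- laplacian ?z \<xi> + \<alpha> * ?z \<xi> powr p + \<beta> * norm (gradient ?z \<xi>) powr q = 0" if "\<xi> \<in> ?H" for \<xi>
  proof -
    have "laplacian ?z \<xi> = \<phi>'' (fst \<xi>)"
      unfolding laplacian_def sum_Basis_half_space by (simp add: p2[OF that])
    moreover have "(norm (gradient ?z \<xi>))\<^sup>2 = \<bar>\<phi>' (fst \<xi>)\<bar>\<^sup>2"
      unfolding norm_gradient_square sum_Basis_half_space by (simp add: p1[OF that])
    hence "norm (gradient ?z \<xi>) = \<bar>\<phi>' (fst \<xi>)\<bar>" by (rule power2_eq_imp_eq) auto
    ultimately show ?thesis by (simp add: \<phi>''_def)
  qed
  have "boundary_limit M ?z"
    unfolding boundary_limit_def
  proof (intro allI impI)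
    fix K :: "(real^'m) set"
    show "if M = \<infinity> then \<forall>A. \<forall>\<^sub>F t in at_right 0. \<forall>y\<in>K. A < ?z (t, y)
       else uniform_limit K (\<lambda>t y. ?z (t, y)) (\<lambda>_. enn2real M) (at_right 0)"
    proof (cases "M = \<infinity>")
      case True
      hence "filterlim \<phi> at_top (at_right 0)" using lim by (simp add: profile_limit_def)
      hence "\<forall>\<^sub>F t in at_right 0. A < \<phi> t" for A by (simp add: filterlim_at_top_dense)
      thus ?thesis using True by (auto elim: eventually_mono)
    next
      case False
      hence "(\<phi> \<longlongrightarrow> enn2real M) (at_right 0)" using lim by (simp add: profile_limit_def)
      hence "\<forall>\<^sub>F t in at_right 0. dist (\<phi> t) (enn2real M) < e" if "0 < e" for e using that by (rule tendstoD)
      thus ?thesis using False by (auto simp: uniform_limit_iff elim: eventually_mono)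
    qed
  qed
  thus ?thesis unfolding solves_P_def using C2 eq profileD(3)[OF pr] H by auto
qed

section \<open>Removing the scaling, the shift and the error\<close>

lemma scaled_profile_tendsto:
  assumes pr: "profile q \<alpha> p \<beta> \<phi> \<phi>'" and t: "0 < t"
    and c: "c \<longlonglongrightarrow> 1" and d: "d \<longlonglongrightarrow> 0" and e: "e \<longlonglongrightarrow> 0"
  shows "(\<lambda>n. m + c n * \<phi> ((t + d n) / c n) + e n) \<longlonglongrightarrow> m + \<phi> t"
proof -
  have "(\<lambda>n. (t + d n) / c n) \<longlonglongrightarrow> (t + 0) / 1" by (intro tendsto_intros c d) simp
  hence "(\<lambda>n. \<phi> ((t + d n) / c n)) \<longlonglongrightarrow> \<phi> t"
    using DERIV_isCont[OF profileD(1)[OF pr t]] by (intro isCont_tendsto_compose[of t \<phi>]) auto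
  hence "(\<lambda>n. m + c n * \<phi> ((t + d n) / c n) + e n) \<longlonglongrightarrow> m + 1 * \<phi> t + 0"
    by (intro tendsto_add tendsto_mult tendsto_const c e)
  thus ?thesis by simp
qed

context half_space_problem
begin

text \<open>For c > 1 the second derivative of the scaled profile is only 1/c of the original one,
  which leaves room for \<eta> and for the reduced gradient coefficient \<theta> \<beta>. The
  premise \<open>top\<close> stands in for a boundary condition at infinity. The gain is required on
  (0, A) only: without absorption the slope tends to 0, and no uniform \<eta> exists on the whole
  half line.\<close>

lemma upper_bound_by_profile:
  assumes pr: "profile q \<alpha> p \<beta> \<phi> \<phi>'" and m: "0 \<le> m" and c: "1 < c" and e: "0 < \<epsilon>"
    and dM: "M = \<infinity> \<and> 0 < \<delta> \<and> filterlim \<phi> at_top (at_right 0) \<or>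
       M \<noteq> \<infinity> \<and> \<delta> = 0 \<and> m \<le> enn2real M \<and> (\<phi> \<longlongrightarrow> enn2real M - m) (at_right 0)"
    and t: "\<delta> < t" "t < A" and top: "S < A" "\<And>t y. S \<le> t \<Longrightarrow> z (t, y) < m + \<epsilon>"
    and gain: "0 < \<eta>" "0 < \<theta>" "\<theta> < 1" "\<And>s. 0 < s \<Longrightarrow> s < A \<Longrightarrow> (\<alpha> * \<phi> s powr p + \<beta> * \<bar>\<phi>' s\<bar> powr q) / c + \<eta> <
        \<alpha> * (m + c * \<phi> s + \<epsilon>) powr p + \<theta> * \<beta> * \<bar>\<phi>' s\<bar> powr q"
  shows "z (t, y) \<le> m + c * \<phi> ((t - \<delta>) / c) + \<epsilon>"
proof -
  have d0: "0 \<le> \<delta>" using dM by auto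
  have c0: "0 < c" using c by simp
  define f where "f = (\<lambda>t. m + c * \<phi> ((t + - \<delta>) / c))"
  define f' where "f' = (\<lambda>t. \<phi>' ((t + - \<delta>) / c))"
  define f'' where "f'' = (\<lambda>t. (\<alpha> * \<phi> ((t + - \<delta>) / c) powr p + \<beta> * \<bar>\<phi>' ((t + - \<delta>) / c)\<bar> powr q) / c)"
  obtain R where R: "R > 0" and cmp: "\<And>f f' f'' a A t0 y0. \<lbrakk>0 \<le> a; a < t0; t0 < A;
     \<forall>t. a < t \<and> t < A \<longrightarrow> (f has_real_derivative f' t) (at t) \<and> (f' has_real_derivative f'' t) (at t) \<and>
        0 \<le> f t \<and> f'' t + \<eta> < \<alpha> * (f t + \<epsilon>) powr p + \<theta> * \<beta> * \<bar>f' t\<bar> powr q;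
     \<exists>a1>a. \<forall>t y. a < t \<and> t < a1 \<and> y \<in> cball y0 R \<longrightarrow> z (t, y) < f t + \<epsilon>;
     \<exists>A1<A. \<forall>t y. A1 < t \<and> t < A \<and> y \<in> cball y0 R \<longrightarrow> z (t, y) < f t + \<epsilon>\<rbrakk> \<Longrightarrow>
     z (t0, y0) \<le> f t0 + \<epsilon>"
    using upper_comparison[OF gain(2,3) e gain(1)] by blast
  have fm: "m \<le> f s" if "\<delta> < s" for s
  proof -
    have "0 \<le> \<phi> ((s + - \<delta>) / c)" using profileD(3)[OF pr, of "(s + - \<delta>) / c"] that c0 by simp
    thus ?thesis using c0 by (simp add: f_def)
  qed
  have "z (t, y) \<le> f t + \<epsilon>"
  proof (rule cmp[OF d0 t])
    show "\<forall>t. \<delta> < t \<and> t < A \<longrightarrow> (f has_real_derivative f' t) (at t) \<and> (f' has_real_derivative f'' t) (at t) \<and>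
        0 \<le> f t \<and> f'' t + \<eta> < \<alpha> * (f t + \<epsilon>) powr p + \<theta> * \<beta> * \<bar>f' t\<bar> powr q"
    proof (intro allI impI)
      fix t assume t: "\<delta> < t \<and> t < A"
      have "0 < t + - \<delta>" using t by simp
      note D = DERIV_scaled_profile[OF pr c0 this]
      define s where "s = (t + - \<delta>) / c"
      have "(t + - \<delta>) / c \<le> t + - \<delta>" using divide_left_mono[of 1 c "t + - \<delta>"] c t by simp
      hence s: "0 < s" "s < A" using t c0 d0 by (auto simp: s_def)
      have "f'' t + \<eta> < \<alpha> * (f t + \<epsilon>) powr p + \<theta> * \<beta> * \<bar>f' t\<bar> powr q"
        unfolding f_def f'_def f''_def s_def[symmetric] by (rule gain(4)[OF s])
      thus "(f has_real_derivative f' t) (at t) \<and> (f' has_real_derivative f'' t) (at t) \<and>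
        0 \<le> f t \<and> f'' t + \<eta> < \<alpha> * (f t + \<epsilon>) powr p + \<theta> * \<beta> * \<bar>f' t\<bar> powr q"
        using D fm[of t] t m unfolding f_def f'_def f''_def by auto
    qed
    show "\<exists>a1>\<delta>. \<forall>t ya. \<delta> < t \<and> t < a1 \<and> ya \<in> cball y R \<longrightarrow> z (t, ya) < f t + \<epsilon>"
      using upper_boundary[OF pr m c e dM, of y R] by (simp add: f_def)
    show "\<exists>A1<A. \<forall>t ya. A1 < t \<and> t < A \<and> ya \<in> cball y R \<longrightarrow> z (t, ya) < f t + \<epsilon>"
    proof (intro exI[of _ "max S \<delta>"] conjI allI impI)
      show "max S \<delta> < A" using top t by simp
      fix s ya assume s: "max S \<delta> < s \<and> s < A \<and> ya \<in> cball y R"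
      have "z (s, ya) < m + \<epsilon>" using top(2) s by simp
      thus "z (s, ya) < f s + \<epsilon>" using fm[of s] s by simp
    qed
  qed
  thus ?thesis by (simp add: f_def)
qed

lemma le_profile_limit:
  assumes pr: "profile q \<alpha> p \<beta> \<phi> \<phi>'" and t: "0 < t"
    and b: "\<And>c \<epsilon> \<delta>. 1 < c \<Longrightarrow> 0 < \<epsilon> \<Longrightarrow> \<delta> < t \<Longrightarrow> (if M = \<infinity> then 0 < \<delta> else \<delta> = 0) \<Longrightarrow>
       z (t, y) \<le> m + c * \<phi> ((t - \<delta>) / c) + \<epsilon>"
  shows "z (t, y) \<le> m + \<phi> t"
proof -
  define r where "r = (\<lambda>n. inverse (real (Suc n)))"
  \<comment> \<open>Switches the shift on only for M = \<infinity>.\<close>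
  define \<sigma> :: real where "\<sigma> = (if M = \<infinity> then 1 else 0)"
  have r: "r \<longlonglongrightarrow> 0" unfolding r_def by (rule LIMSEQ_inverse_real_of_nat)
  have rp: "0 < r n" for n by (simp add: r_def)
  have d: "(\<lambda>n. - (\<sigma> * r n)) \<longlonglongrightarrow> 0" using tendsto_minus[OF tendsto_mult[OF tendsto_const r, of \<sigma>]] by simp
  have c: "(\<lambda>n. 1 + r n) \<longlonglongrightarrow> 1" using tendsto_add[OF tendsto_const r, of 1] by simp
  have "\<forall>\<^sub>F n in sequentially. - t < - (\<sigma> * r n)" using order_tendstoD(1)[OF d, of "- t"] t by simp
  hence "\<forall>\<^sub>F n in sequentially. z (t, y) \<le> m + (1 + r n) * \<phi> ((t + - (\<sigma> * r n)) / (1 + r n)) + r n"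
  proof eventually_elim
    case (elim n)
    thus ?case using b[of "1 + r n" "r n" "\<sigma> * r n"] rp[of n] by (auto simp: \<sigma>_def)
  qed
  thus ?thesis by (rule tendsto_lowerbound[OF scaled_profile_tendsto[OF pr t c d r]]) simp
qed

lemma ge_profile_limit:
  assumes pr: "profile q \<alpha> p \<beta> \<phi> \<phi>'" and t: "0 < t"
    and b: "\<And>c \<epsilon> \<delta>. 0 < c \<Longrightarrow> c < 1 \<Longrightarrow> 0 < \<epsilon> \<Longrightarrow> (if M = \<infinity> then 0 < \<delta> else \<delta> = 0) \<Longrightarrow>
       m + c * \<phi> ((t + \<delta>) / c) - \<epsilon> \<le> z (t, y)"
  shows "m + \<phi> t \<le> z (t, y)"
proof -
  define r where "r = (\<lambda>n. inverse (real (Suc n)))"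
  define \<sigma> :: real where "\<sigma> = (if M = \<infinity> then 1 else 0)"
  have r: "r \<longlonglongrightarrow> 0" unfolding r_def by (rule LIMSEQ_inverse_real_of_nat)
  have rp: "0 < r n" "r n \<le> 1" for n by (auto simp: r_def field_simps)
  have d: "(\<lambda>n. \<sigma> * r n) \<longlonglongrightarrow> 0" using tendsto_mult[OF tendsto_const r, of \<sigma>] by simp
  \<comment> \<open>Half of \<open>r n\<close>, because r 0 = 1 would make the first scaling factor
    0.\<close>
  have c: "(\<lambda>n. 1 - r n / 2) \<longlonglongrightarrow> 1" using tendsto_diff[OF tendsto_const tendsto_divide[OF r tendsto_const], of 2 1] by simp
  have e: "(\<lambda>n. - r n) \<longlonglongrightarrow> 0" using tendsto_minus[OF r] by simp
  have "m + (1 - r n / 2) * \<phi> ((t + \<sigma> * r n) / (1 - r n / 2)) + - r n \<le> z (t, y)" for n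
    using b[of "1 - r n / 2" "r n" "\<sigma> * r n"] rp[of n] by (auto simp: \<sigma>_def)
  hence "\<forall>\<^sub>F n in sequentially. m + (1 - r n / 2) * \<phi> ((t + \<sigma> * r n) / (1 - r n / 2)) + - r n \<le> z (t, y)"
    by (intro always_eventually allI)
  thus ?thesis by (rule tendsto_upperbound[OF scaled_profile_tendsto[OF pr t c d e]]) simp
qed

text \<open>A slab of half-width 1/\<mu> around \<xi>1 = t0 carries the one-dimensional version of
  the ball barrier, infinite on both faces, so nothing need be known about \<open>z\<close> outside
  it; the surplus comes from the absorption, at least \<alpha> \<epsilon>^p. At the centre the
  barrier and the error add up to 2 \<epsilon> = e. The width does not depend on the point, so the
  bound is uniform.\<close>

lemma decay:
  assumes al: "0 < \<alpha>" and e: "0 < e"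
  obtains T where "0 < T" "\<And>t y. T \<le> t \<Longrightarrow> z (t, y) \<le> e"
proof -
  define \<epsilon> where "\<epsilon> = e / 2"
  have ep: "0 < \<epsilon>" using e by (simp add: \<epsilon>_def)
  \<comment> \<open>A quarter, because \<eta> is spent twice, by the barrier and by the strict
    inequality, and 2 \<eta> < \<alpha> \<epsilon>^p is needed.\<close>
  define \<eta> where "\<eta> = \<alpha> * \<epsilon> powr p / 4"
  have eta: "0 < \<eta>" using al ep by (simp add: \<eta>_def)
  define k where "k = 1 / (q - 1)"
  have k0: "0 < k" using q by (simp add: k_def)
  have half: "0 < (1/2 :: real)" "(1/2 :: real) < 1" by simp_all
  obtain R where R: "R > 0" and cmp: "\<And>f f' f'' a A t0 y0. \<lbrakk>0 \<le> a; a < t0; t0 < A;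
     \<forall>t. a < t \<and> t < A \<longrightarrow> (f has_real_derivative f' t) (at t) \<and> (f' has_real_derivative f'' t) (at t) \<and>
        0 \<le> f t \<and> f'' t + \<eta> < \<alpha> * (f t + \<epsilon>) powr p + 1/2 * \<beta> * \<bar>f' t\<bar> powr q;
     \<exists>a1>a. \<forall>t y. a < t \<and> t < a1 \<and> y \<in> cball y0 R \<longrightarrow> z (t, y) < f t + \<epsilon>;
     \<exists>A1<A. \<forall>t y. A1 < t \<and> t < A \<and> y \<in> cball y0 R \<longrightarrow> z (t, y) < f t + \<epsilon>\<rbrakk> \<Longrightarrow>
     z (t0, y0) \<le> f t0 + \<epsilon>"
    using upper_comparison[OF half ep eta] by blast
  \<comment> \<open>The inequality in dimension 1, for a barrier acting in the \<xi>1
    direction.\<close>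
  obtain \<mu> where mu: "\<mu> > 0" and bar: "\<And>r. 0 \<le> r \<Longrightarrow> \<mu> * r < 1 \<Longrightarrow>
     \<epsilon> * k * \<mu>\<^sup>2 * (2 * 1 * (1 - (\<mu> * r)\<^sup>2) powr (-k-1) + 4 * (k+1) * \<mu>\<^sup>2 * r\<^sup>2 * (1 - (\<mu> * r)\<^sup>2) powr (-k-2))
     \<le> \<eta> + 1/2 * \<beta> * (2 * \<epsilon> * k * \<mu>\<^sup>2 * r * (1 - (\<mu> * r)\<^sup>2) powr (-k-1)) powr q"
    using barrier_inequality[OF q ep eta _ zero_le_one k_def, of "1/2 * \<beta>"] beta by auto
  have main: "z (t0, y0) \<le> e" if t0: "1 / \<mu> + 1 \<le> t0" for t0 y0
  proof -
    define a A where "a = t0 - 1 / \<mu>" and "A = t0 + 1 / \<mu>"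
    have aA: "1 \<le> a" "a < t0" "t0 < A" using t0 mu by (auto simp: a_def A_def)
    define D where "D = (\<lambda>t. 1 - \<mu>\<^sup>2 * (t - t0)\<^sup>2)"
    define f where "f = (\<lambda>t. \<epsilon> * D t powr (- k))"
    define f' where "f' = (\<lambda>t. 2 * \<epsilon> * k * \<mu>\<^sup>2 * (t - t0) * D t powr (- k - 1))"
    define f'' where "f'' = (\<lambda>t. \<epsilon> * k * \<mu>\<^sup>2 * (2 * D t powr (- k - 1) + 4 * (k + 1) * \<mu>\<^sup>2 * (t - t0)\<^sup>2 * D t powr (- k - 2)))"
    have r1: "\<mu> * \<bar>t - t0\<bar> < 1" if "a < t" "t < A" for t
    proof -
      have "\<bar>t - t0\<bar> < 1 / \<mu>" using that by (auto simp: a_def A_def)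
      thus ?thesis using mu by (simp add: field_simps)
    qed
    have Dr: "D t = 1 - (\<mu> * \<bar>t - t0\<bar>)\<^sup>2" for t by (simp add: D_def power_mult_distrib)
    have D0: "0 < D t" if "a < t" "t < A" for t
      unfolding Dr using r1[OF that] mu by (simp add: power_less_one_iff)
    have Dh: "D (h + t) = 1 - \<mu>\<^sup>2 * ((t - t0)\<^sup>2 + 2 * h * (t - t0) + h\<^sup>2)" for h t
      by (simp add: D_def power2_eq_square algebra_simps)
    have prof: "\<forall>t. a < t \<and> t < A \<longrightarrow> (f has_real_derivative f' t) (at t) \<and> (f' has_real_derivative f'' t) (at t) \<and>
        0 \<le> f t \<and> f'' t + \<eta> < \<alpha> * (f t + \<epsilon>) powr p + 1/2 * \<beta> * \<bar>f' t\<bar> powr q"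
    proof (intro allI impI conjI)
      fix t assume t: "a < t \<and> t < A"
      have Dt: "0 < 1 - \<mu>\<^sup>2 * (t - t0)\<^sup>2" using D0 t by (simp add: D_def)
      have "((\<lambda>h. f (h + t)) has_real_derivative f' t) (at 0)"
        unfolding f_def Dh
        using has_real_derivative_barrier[of \<mu> "(t - t0)\<^sup>2" 0 "t - t0" \<epsilon> k] Dt by (simp add: f'_def D_def)
      thus "(f has_real_derivative f' t) (at t)" using DERIV_shift[of f "f' t" 0 t] by simp
      have "((\<lambda>h. f' (h + t)) has_real_derivative f'' t) (at 0)"
      proof -
        have "f' (h + t) = 2 * \<epsilon> * k * \<mu>\<^sup>2 * (t - t0 + h) * (1 - \<mu>\<^sup>2 * ((t - t0)\<^sup>2 + 2 * h * (t - t0) + h\<^sup>2)) powr (- k - 1)" for h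
          unfolding f'_def Dh by (simp add: algebra_simps)
        thus ?thesis
          using has_real_derivative_barrier2[of \<mu> "(t - t0)\<^sup>2" \<epsilon> k "t - t0"] Dt by (simp add: f''_def D_def)
      qed
      thus "(f' has_real_derivative f'' t) (at t)" using DERIV_shift[of f' "f'' t" 0 t] by simp
      show f0: "0 \<le> f t" using ep by (simp add: f_def)
      have "\<bar>f' t\<bar> = 2 * \<epsilon> * k * \<mu>\<^sup>2 * \<bar>t - t0\<bar> * D t powr (- k - 1)"
        using ep k0 by (simp add: f'_def abs_mult)
      moreover have "f'' t = \<epsilon> * k * \<mu>\<^sup>2 * (2 * 1 * D t powr (-k-1) + 4 * (k+1) * \<mu>\<^sup>2 * \<bar>t - t0\<bar>\<^sup>2 * D t powr (-k-2))"
        by (simp add: f''_def)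
      ultimately have "f'' t \<le> \<eta> + 1/2 * \<beta> * \<bar>f' t\<bar> powr q"
        using bar[of "\<bar>t - t0\<bar>"] r1[of t] t unfolding Dr by simp
      moreover have "\<alpha> * \<epsilon> powr p \<le> \<alpha> * (f t + \<epsilon>) powr p"
        using al p ep f0 by (intro mult_left_mono powr_mono2) auto
      moreover have "2 * \<eta> < \<alpha> * \<epsilon> powr p" using eta by (simp add: \<eta>_def)
      ultimately show "f'' t + \<eta> < \<alpha> * (f t + \<epsilon>) powr p + 1/2 * \<beta> * \<bar>f' t\<bar> powr q" by linarith
    qed
    have "{a..A} \<times> cball y0 R \<subseteq> half_space" using aA by (auto simp: half_space_def)
    from bounded_above_on_compact[OF compact_Times[OF compact_Icc compact_cball] this]
    obtain B where B: "0 < B" "\<And>\<xi>. \<xi> \<in> {a..A} \<times> cball y0 R \<Longrightarrow> z \<xi> \<le> B" by blast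
    define D1 where "D1 = (B / \<epsilon>) powr (- (1 / k))"
    have D1: "0 < D1" using B ep by (simp add: D1_def)
    have fB: "B \<le> f t" if "a < t" "t < A" "D t < D1" for t
    proof -
      have "D1 powr (- k) \<le> D t powr (- k)" using D0[OF that(1,2)] that k0 by (intro powr_mono2') auto
      moreover have "D1 powr (- k) = B / \<epsilon>" using k0 B ep by (simp add: D1_def powr_powr)
      ultimately show ?thesis using ep by (simp add: f_def field_simps)
    qed
    have zf: "z (t, y) < f t + \<epsilon>" if "a < t" "t < A" "D t < D1" "y \<in> cball y0 R" for t y
      using fB[OF that(1-3)] B(2)[of "(t, y)"] that ep by auto
    have Dc: "isCont D t" for t unfolding D_def by (intro continuous_intros)
    have Da: "D a = 0" "D A = 0" using mu by (simp_all add: D_def a_def A_def power_mult_distrib[symmetric])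
    have near: "\<exists>d>0. \<forall>s. dist s t < d \<longrightarrow> D s < D1" if "D t = 0" for t
    proof -
      have "\<forall>\<^sub>F s in nhds t. D s < D1"
        by (rule order_tendstoD(2)[of D "D t"]) (use Dc[of t] that D1 in \<open>simp_all add: isCont_def tendsto_nhds_iff\<close>)
      thus ?thesis by (simp add: eventually_nhds_metric)
    qed
    obtain da where da: "da > 0" "\<And>s. dist s a < da \<Longrightarrow> D s < D1" using near[OF Da(1)] by blast
    obtain dA where dA: "dA > 0" "\<And>s. dist s A < dA \<Longrightarrow> D s < D1" using near[OF Da(2)] by blast
    have "z (t0, y0) \<le> f t0 + \<epsilon>"
    proof (rule cmp[OF _ aA(2,3) prof])
      show "0 \<le> a" using aA by simp
      show "\<exists>a1>a. \<forall>t y. a < t \<and> t < a1 \<and> y \<in> cball y0 R \<longrightarrow> z (t, y) < f t + \<epsilon>"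
        using da aA by (intro exI[of _ "min t0 (a + da)"]) (auto intro!: zf simp: dist_real_def)
      show "\<exists>A1<A. \<forall>t y. A1 < t \<and> t < A \<and> y \<in> cball y0 R \<longrightarrow> z (t, y) < f t + \<epsilon>"
        using dA aA by (intro exI[of _ "max t0 (A - dA)"]) (auto intro!: zf simp: dist_real_def)
    qed
    also have "f t0 = \<epsilon>" by (simp add: f_def D_def)
    finally show ?thesis by (simp add: \<epsilon>_def)
  qed
  show ?thesis by (rule that[of "1 / \<mu> + 1"]) (use mu main in \<open>auto intro: add_pos_pos\<close>)
qed

text \<open>Absorption supplies everything: \<open>decay\<close> gives the condition at infinity for
  the upper bound, and \<alpha> s^p \<ge> \<alpha> \<epsilon>^p for s \<ge> \<epsilon> gives the
  surplus in both directions. Only monotonicity of s^p is used, so every p > 0 is covered.\<close>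

lemma eq_profile_of_absorption:
  assumes al: "0 < \<alpha>" and pr: "profile q \<alpha> p \<beta> \<phi> \<phi>'" and lim: "profile_limit M \<phi>" and t: "0 < t"
  shows "z (t, y) = \<phi> t"
proof (rule antisym)
  have "z (t, y) \<le> 0 + \<phi> t"
  proof (rule le_profile_limit[OF pr t])
    fix c \<epsilon> \<delta> :: real assume c: "1 < c" and e: "0 < \<epsilon>" and d: "\<delta> < t" "if M = \<infinity> then 0 < \<delta> else \<delta> = 0"
    obtain T where T: "0 < T" "\<And>t y. T \<le> t \<Longrightarrow> z (t, y) \<le> \<epsilon> / 2"
      using decay[OF al, of "\<epsilon> / 2"] e by auto
    \<comment> \<open>Half of what the factor 1/c saves in the absorption; with \<theta> = 1/c the
      two gradient terms agree.\<close>
    define \<eta> where "\<eta> = (1 - 1 / c) * (\<alpha> * \<epsilon> powr p) / 2"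
    have eta: "0 < \<eta>" using c al e by (simp add: \<eta>_def)
    show "z (t, y) \<le> 0 + c * \<phi> ((t - \<delta>) / c) + \<epsilon>"
    proof (rule upper_bound_by_profile[OF pr order_refl c e, where S = T and A = "max t T + 1" and \<theta> = "1 / c" and \<eta> = \<eta>])
      show "M = \<infinity> \<and> 0 < \<delta> \<and> filterlim \<phi> at_top (at_right 0) \<or>
         M \<noteq> \<infinity> \<and> \<delta> = 0 \<and> 0 \<le> enn2real M \<and> (\<phi> \<longlongrightarrow> enn2real M - 0) (at_right 0)"
        using d lim by (auto simp: profile_limit_def split: if_splits)
      show "t < max t T + 1" "T < max t T + 1" by linarith+
      show "z (s, x) < 0 + \<epsilon>" if "T \<le> s" for s x using T(2)[OF that, of x] e by simp
      fix s :: real assume s: "0 < s"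
      have ph: "0 \<le> \<phi> s" by (rule profileD(3)[OF pr s])
      have le: "\<phi> s \<le> 0 + c * \<phi> s + \<epsilon>" using mult_right_mono[of 1 c "\<phi> s"] ph c e by simp
      have "\<alpha> * \<phi> s powr p \<le> \<alpha> * (0 + c * \<phi> s + \<epsilon>) powr p"
        using al p ph le by (intro mult_left_mono powr_mono2) auto
      hence 1: "1 / c * (\<alpha> * \<phi> s powr p) \<le> 1 / c * (\<alpha> * (0 + c * \<phi> s + \<epsilon>) powr p)"
        by (rule mult_left_mono) (use c in simp)
      have "\<alpha> * \<epsilon> powr p \<le> \<alpha> * (0 + c * \<phi> s + \<epsilon>) powr p"
        using al p e ph c by (intro mult_left_mono powr_mono2) auto
      hence "(1 - 1 / c) * (\<alpha> * \<epsilon> powr p) \<le> (1 - 1 / c) * (\<alpha> * (0 + c * \<phi> s + \<epsilon>) powr p)"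
        by (rule mult_left_mono) (use c in simp)
      hence "2 * \<eta> \<le> (1 - 1 / c) * (\<alpha> * (0 + c * \<phi> s + \<epsilon>) powr p)" by (simp add: \<eta>_def)
      with 1 eta have "1 / c * (\<alpha> * \<phi> s powr p) + \<eta> < \<alpha> * (0 + c * \<phi> s + \<epsilon>) powr p"
        by (simp only: left_diff_distrib)
      thus "(\<alpha> * \<phi> s powr p + \<beta> * \<bar>\<phi>' s\<bar> powr q) / c + \<eta> < \<alpha> * (0 + c * \<phi> s + \<epsilon>) powr p + 1 / c * \<beta> * \<bar>\<phi>' s\<bar> powr q"
        by (simp add: add_divide_distrib)
    qed (use d eta c in auto)
  qed
  thus "z (t, y) \<le> \<phi> t" by simp
  have "0 + \<phi> t \<le> z (t, y)"
  proof (rule ge_profile_limit[OF pr t])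
    fix c \<epsilon> \<delta> :: real assume c: "0 < c" "c < 1" and e: "0 < \<epsilon>" and d: "if M = \<infinity> then 0 < \<delta> else \<delta> = 0"
    show "0 + c * \<phi> ((t + \<delta>) / c) - \<epsilon> \<le> z (t, y)"
    proof (rule lower_bound_by_profile[OF pr _ _ _ c e _ _ _ t, where g = "\<alpha> * \<epsilon> powr p"])
      show "M = \<infinity> \<and> 0 < \<delta> \<or> M \<noteq> \<infinity> \<and> \<delta> = 0 \<and> (\<phi> \<longlongrightarrow> enn2real M - 0) (at_right 0)"
        using d lim by (auto simp: profile_limit_def split: if_splits)
      show "\<alpha> * \<epsilon> powr p \<le> \<alpha> * \<phi> s powr p + \<beta> * \<bar>\<phi>' s\<bar> powr q" if "\<epsilon> < \<phi> s" for s
      proof -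
        have "\<alpha> * \<epsilon> powr p \<le> \<alpha> * \<phi> s powr p" using that al p e by (intro mult_left_mono powr_mono2) auto
        moreover have "0 \<le> \<beta> * \<bar>\<phi>' s\<bar> powr q" using beta by simp
        ultimately show ?thesis by linarith
      qed
    qed (use nonneg al e in auto)
  qed
  thus "\<phi> t \<le> z (t, y)" by simp
qed

end

section \<open>The equation without absorption\<close>

text \<open>Closed form of the integral of \<open>slope\<close> over {t..}. For q > 1 the exponent
  -(2-q)/(q-1) is negative exactly when q < 2; for q = 2 the integrand would decay only like
  1/s.\<close>

definition slope_tail :: "real \<Rightarrow> real \<Rightarrow> real \<Rightarrow> real \<Rightarrow> real" where
  "slope_tail q \<beta> c t = ((q - 1) * \<beta> * t + c) powr (1 - 1 / (q - 1)) / ((2 - q) * \<beta>)"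

context
  fixes q \<beta> c :: real
  assumes q: "1 < q" "q < 2" and be: "0 < \<beta>" and c: "0 \<le> c"
begin

lemma slope_base_pos: "0 < t \<or> 0 \<le> t \<and> 0 < c \<Longrightarrow> 0 < (q - 1) * \<beta> * t + c"
  using q be c by (auto intro: add_pos_nonneg add_nonneg_pos)

lemma DERIV_slope_base_powr:
  assumes "0 < (q - 1) * \<beta> * t + c"
  shows "((\<lambda>t. ((q - 1) * \<beta> * t + c) powr r) has_real_derivative
    r * ((q - 1) * \<beta> * t + c) powr (r - 1) * ((q - 1) * \<beta>)) (at t)"
proof -
  have "((\<lambda>t. (q - 1) * \<beta> * t + c) has_real_derivative (q - 1) * \<beta>) (at t)"
    by (auto intro!: derivative_eq_intros)
  from DERIV_fun_powr[OF this assms, of r] show ?thesis by simp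
qed

lemma DERIV_slope_tail:
  assumes "0 < (q - 1) * \<beta> * t + c"
  shows "(slope_tail q \<beta> c has_real_derivative - slope q \<beta> c t) (at t)"
proof -
  let ?X = "((q - 1) * \<beta> * t + c) powr (- 1 / (q - 1))"
  have "((\<lambda>t. ((q - 1) * \<beta> * t + c) powr (1 - 1 / (q - 1)) / ((2 - q) * \<beta>)) has_real_derivative
      (1 - 1 / (q - 1)) * ?X * ((q - 1) * \<beta>) / ((2 - q) * \<beta>)) (at t)"
    using DERIV_cdivide[OF DERIV_slope_base_powr[OF assms, of "1 - 1 / (q - 1)"], of "(2 - q) * \<beta>"] by simp
  moreover have "(1 - 1 / (q - 1)) * ?X * ((q - 1) * \<beta>) / ((2 - q) * \<beta>) = - ?X"
  proof -
    have "(1 - 1 / (q - 1)) * (q - 1) = - (2 - q)" using q by (simp add: field_simps)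
    hence "(1 - 1 / (q - 1)) * Y * ((q - 1) * \<beta>) = - (Y * ((2 - q) * \<beta>))" for Y
      by (metis (no_types, opaque_lifting) mult.assoc mult.commute mult_minus_left)
    thus ?thesis using q be by simp
  qed
  ultimately show ?thesis unfolding slope_tail_def[abs_def] slope_def by simp
qed

lemma DERIV_slope:
  assumes "0 < (q - 1) * \<beta> * t + c"
  shows "((\<lambda>t. - slope q \<beta> c t) has_real_derivative \<beta> * slope q \<beta> c t powr q) (at t)"
proof -
  define g where "g = 1 / (q - 1)"
  have g: "g * (q - 1) = 1" using q by (simp add: g_def)
  have "((\<lambda>t. ((q - 1) * \<beta> * t + c) powr (- g)) has_real_derivative
      - g * ((q - 1) * \<beta> * t + c) powr (- g - 1) * ((q - 1) * \<beta>)) (at t)"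
    by (rule DERIV_slope_base_powr[OF assms])
  from DERIV_minus[OF this]
  have "((\<lambda>t. - (((q - 1) * \<beta> * t + c) powr (- g))) has_real_derivative
      (g * (q - 1)) * (\<beta> * ((q - 1) * \<beta> * t + c) powr (- g - 1))) (at t)"
    by (rule DERIV_cong) (simp add: mult_ac)
  moreover have "- g - 1 = - g * q" using g by (simp add: algebra_simps)
  ultimately show ?thesis unfolding slope_def using q(1) by (simp add: g powr_powr g_def)
qed

lemma slope_tail_tendsto_0: "(slope_tail q \<beta> c \<longlongrightarrow> 0) at_top"
proof -
  have a: "0 < (q - 1) * \<beta>" using q be by simp
  have "filterlim (\<lambda>t. (q - 1) * \<beta> * t + c) at_top at_top"
    by (intro filterlim_tendsto_add_at_top[OF tendsto_const, of _ _ c, simplified add.commute[of c]]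
          filterlim_tendsto_pos_mult_at_top[OF tendsto_const a filterlim_ident])
  moreover have "1 - 1 / (q - 1) < 0" using q by (simp add: field_simps)
  ultimately have "((\<lambda>t. ((q - 1) * \<beta> * t + c) powr (1 - 1 / (q - 1))) \<longlongrightarrow> 0) at_top"
    by (intro tendsto_neg_powr)
  from tendsto_divide[OF this tendsto_const, of "(2 - q) * \<beta>"] show ?thesis
    using q be unfolding slope_tail_def[abs_def] by simp
qed

lemma slope_pos: "0 < (q - 1) * \<beta> * t + c \<Longrightarrow> 0 < slope q \<beta> c t"
  by (simp add: slope_def)

lemma slope_profile: "profile q 0 p \<beta> (slope_tail q \<beta> c) (\<lambda>t. - slope q \<beta> c t)"
  unfolding profile_def
proof (intro conjI allI impI slope_tail_tendsto_0)
  fix t :: real assume "0 < t"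
  hence b: "0 < (q - 1) * \<beta> * t + c" by (intro slope_base_pos) auto
  show "(slope_tail q \<beta> c has_real_derivative - slope q \<beta> c t) (at t)" by (rule DERIV_slope_tail[OF b])
  show "((\<lambda>t. - slope q \<beta> c t) has_real_derivative 0 * slope_tail q \<beta> c t powr p + \<beta> * \<bar>- slope q \<beta> c t\<bar> powr q) (at t)"
    using DERIV_slope[OF b] slope_pos[OF b] by simp
  show "0 \<le> slope_tail q \<beta> c t" using q be by (simp add: slope_tail_def)
  show "- slope q \<beta> c t \<le> 0" using slope_pos[OF b] by simp
qed

text \<open>The case t = 0 with c > 0 is what the implicit relation needs; for c = 0 the integrand
  has exponent -1/(q-1) < -1 and is not integrable at 0.\<close>

lemma slope_has_integral:
  assumes t: "0 < t \<or> 0 \<le> t \<and> 0 < c"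
  shows "(slope q \<beta> c has_integral slope_tail q \<beta> c t) {t..}"
proof -
  have b: "0 < (q - 1) * \<beta> * s + c" if "t \<le> s" for s
    using t that by (intro slope_base_pos) auto
  have I: "(slope q \<beta> c has_integral (- slope_tail q \<beta> c y - - slope_tail q \<beta> c t)) {t..y}" if "t \<le> y" for y
  proof (rule fundamental_theorem_of_calculus[OF that])
    fix s assume "s \<in> {t..y}"
    from DERIV_minus[OF DERIV_slope_tail[OF b]] this
    have "((\<lambda>t. - slope_tail q \<beta> c t) has_real_derivative slope q \<beta> c s) (at s)" by simp
    thus "((\<lambda>t. - slope_tail q \<beta> c t) has_vector_derivative slope q \<beta> c s) (at s within {t..y})"
      unfolding has_real_derivative_iff_has_vector_derivative by (rule has_vector_derivative_at_within)
  qed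
  show ?thesis
  proof (rule has_integral_to_inf)
    show "slope q \<beta> c integrable_on {t..y}" for y
      using I[of y] by (cases "t \<le> y") auto
    have "((\<lambda>y. - slope_tail q \<beta> c y - - slope_tail q \<beta> c t) \<longlongrightarrow> - 0 - - slope_tail q \<beta> c t) at_top"
      by (intro tendsto_intros slope_tail_tendsto_0)
    moreover have "\<forall>\<^sub>F y in at_top. - slope_tail q \<beta> c y - - slope_tail q \<beta> c t = integral {t..y} (slope q \<beta> c)"
      using eventually_ge_at_top[of t] by eventually_elim (rule integral_unique[OF I, symmetric])
    ultimately show "((\<lambda>y. integral {t..y} (slope q \<beta> c)) \<longlongrightarrow> slope_tail q \<beta> c t) at_top"
      by (auto elim: Lim_transform_eventually)
  qed (simp add: slope_def)
qed

lemma slope_tail_at_0: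
  assumes "0 < c"
  shows "(slope_tail q \<beta> c \<longlongrightarrow> slope_tail q \<beta> c 0) (at_right 0)"
proof -
  have "isCont (slope_tail q \<beta> c) 0"
    by (rule DERIV_isCont[OF DERIV_slope_tail]) (use assms in simp)
  thus ?thesis by (auto simp: isCont_def filterlim_at_split)
qed

end

lemma slope_tail_at_0_infinite:
  assumes q: "1 < q" "q < 2" and be: "0 < \<beta>"
  shows "filterlim (slope_tail q \<beta> 0) at_top (at_right 0)"
proof -
  define a where "a = (q - 1) * \<beta>"
  define r where "r = 1 / (q - 1) - 1"
  have a: "0 < a" and r: "0 < r" and d: "0 < (2 - q) * \<beta>" using q be by (auto simp: a_def r_def field_simps)
  show ?thesis
    unfolding filterlim_at_top
  proof
    fix Z :: real
    define W where "W = (\<bar>Z\<bar> + 1) * ((2 - q) * \<beta>)"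
    have W: "0 < W" unfolding W_def by (rule mult_pos_pos[OF _ d]) simp
    define T where "T = W powr (- (1 / r)) / a"
    have T: "0 < T" using a W by (simp add: T_def)
    have "\<forall>\<^sub>F t in at_right 0. t \<in> {0<..<T}" by (rule eventually_at_right_real[OF T])
    thus "\<forall>\<^sub>F t in at_right 0. Z \<le> slope_tail q \<beta> 0 t"
    proof eventually_elim
      case (elim t)
      have "a * t \<le> W powr (- (1 / r))" using elim a by (simp add: T_def field_simps)
      hence "(W powr (- (1 / r))) powr (- r) \<le> (a * t) powr (- r)"
        using elim a r by (intro powr_mono2') auto
      hence "W \<le> (a * t) powr (- r)" using r W by (simp add: powr_powr)
      hence "\<bar>Z\<bar> + 1 \<le> (a * t) powr (- r) / ((2 - q) * \<beta>)" using d by (simp only: pos_le_divide_eq W_def)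
      moreover have "slope_tail q \<beta> 0 t = (a * t) powr (- r) / ((2 - q) * \<beta>)"
        by (simp add: slope_tail_def a_def r_def)
      ultimately show ?case by linarith
    qed
  qed
qed

text \<open>Turns the relation into algebra. The value c = 0 is impossible: the integral over {0..}
  would dominate all tails from t > 0, and these blow up as t tends to 0.\<close>

lemma implicit_relation_iff:
  assumes q: "1 < q" "q < 2" and be: "0 < \<beta>"
  shows "implicit_relation q \<beta> d c \<longleftrightarrow> 0 < c \<and> slope_tail q \<beta> c 0 = d"
proof
  assume "0 < c \<and> slope_tail q \<beta> c 0 = d"
  thus "implicit_relation q \<beta> d c"
    using slope_has_integral[OF q be, of c 0] by (auto simp: implicit_relation_def)
next
  assume "implicit_relation q \<beta> d c"
  hence c: "0 \<le> c" and I: "(slope q \<beta> c has_integral d) {0..}" by (auto simp: implicit_relation_def)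
  have "c \<noteq> 0"
  proof
    assume c0: "c = 0"
    have 1: "\<forall>\<^sub>F t in at_right 0. d + 1 \<le> slope_tail q \<beta> 0 t"
      using slope_tail_at_0_infinite[OF q be] by (simp add: filterlim_at_top)
    have "\<forall>\<^sub>F t in at_right 0. (0::real) < t" by (rule eventually_at_right_less)
    from eventually_happens[OF eventually_conj[OF 1 this]]
    obtain t where t: "d + 1 \<le> slope_tail q \<beta> 0 t" "0 < t" by auto
    have "slope_tail q \<beta> 0 t \<le> d"
      by (rule has_integral_subset_le[OF _ slope_has_integral[OF q be] I[unfolded c0]])
        (use t in \<open>auto simp: slope_def\<close>)
    thus False using t by simp
  qed
  hence "0 < c" using c by simp
  thus "0 < c \<and> slope_tail q \<beta> c 0 = d"
    using has_integral_unique[OF slope_has_integral[OF q be c, of 0] I] by simp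
qed

lemma implicit_relation_ex1:
  assumes q: "1 < q" "q < 2" and be: "0 < \<beta>" and d: "0 < d"
  shows "\<exists>!c. implicit_relation q \<beta> d c"
proof -
  define r where "r = 1 / (q - 1) - 1"
  define B where "B = (2 - q) * \<beta>"
  have r: "0 < r" and b: "0 < B" using q be by (auto simp: r_def B_def field_simps)
  have tail: "slope_tail q \<beta> c 0 = c powr (- r) / B" for c by (simp add: slope_tail_def r_def B_def)
  show ?thesis
  \<comment> \<open>The witness solves c^(-r) / B = d.\<close>
  proof (rule ex1I[of _ "(d * B) powr (- (1 / r))"])
    show "implicit_relation q \<beta> d ((d * B) powr (- (1 / r)))"
      unfolding implicit_relation_iff[OF q be] tail using d b r by (simp add: powr_powr)
  next
    fix c assume "implicit_relation q \<beta> d c"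
    hence c: "0 < c" "c powr (- r) / B = d" unfolding implicit_relation_iff[OF q be] tail by auto
    hence "d * B = c powr (- r)" using b by (simp add: field_simps)
    thus "c = (d * B) powr (- (1 / r))" using c r by (simp add: powr_powr)
  qed
qed

section \<open>Behaviour far from the boundary for \<alpha> = 0, and the quadratic case\<close>

context half_space_problem
begin

lemma gradient_decay:
  assumes "\<alpha> = 0"
  obtains C where "0 < C" "\<And>\<xi>. \<xi> \<in> half_space \<Longrightarrow> norm (gradient z \<xi>) \<le> (C / fst \<xi>) powr (1 / (q - 1))"
proof -
  obtain C where C: "0 < C" "\<And>(z :: real \<times> (real^'m) \<Rightarrow> real) S xc R. C2_on S z \<Longrightarrow> open S \<Longrightarrow>
     (\<forall>x\<in>S. laplacian z x = \<beta> * norm (gradient z x) powr q) \<Longrightarrow> 0 < R \<Longrightarrow> cball xc R \<subseteq> S \<Longrightarrow>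
     norm (gradient z xc) \<le> (C / R) powr (1 / (q - 1))"
    using interior_gradient_bound[OF q beta, where ?'a = "real \<times> (real^'m)"] by blast
  have "norm (gradient z \<xi>) \<le> (2 * C / fst \<xi>) powr (1 / (q - 1))" if xi: "\<xi> \<in> half_space" for \<xi>
  proof -
    have f: "0 < fst \<xi>" using xi by (simp add: half_space_def)
    \<comment> \<open>Half the distance to the boundary, since the closed ball must lie in the open
      half space.\<close>
    have "cball \<xi> (fst \<xi> / 2) \<subseteq> half_space"
    proof
      fix y assume "y \<in> cball \<xi> (fst \<xi> / 2)"
      hence "dist (fst \<xi>) (fst y) \<le> fst \<xi> / 2" using dist_fst_le[of \<xi> y] by simp
      hence "\<bar>fst \<xi> - fst y\<bar> \<le> fst \<xi> / 2" by (simp add: dist_real_def)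
      hence "0 < fst y" using f by linarith
      thus "y \<in> half_space" by (simp add: half_space_def)
    qed
    moreover have "\<forall>x\<in>half_space. laplacian z x = \<beta> * norm (gradient z x) powr q"
      using eq assms by simp
    ultimately have "norm (gradient z \<xi>) \<le> (C / (fst \<xi> / 2)) powr (1 / (q - 1))"
      using C(2)[OF C2 open_half_space, of "fst \<xi> / 2" \<xi>] f by simp
    thus ?thesis by (simp add: mult.commute)
  qed
  thus ?thesis using that[of "2 * C"] C(1) by simp
qed

text \<open>The gradient tends to 0 uniformly in \<xi>', and {fst \<ge> T} is convex, so the mean
  value theorem applies between any two of its points.\<close>

lemma eventually_lipschitz:
  assumes a0: "\<alpha> = 0" and s: "0 < \<sigma>"
  obtains T where "0 < T" "\<And>\<xi> \<zeta>. T \<le> fst \<xi> \<Longrightarrow> T \<le> fst \<zeta> \<Longrightarrow> z \<xi> \<le> z \<zeta> + \<sigma> * norm (\<xi> - \<zeta>)"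
proof -
  obtain C where C: "0 < C" "\<And>\<xi>. \<xi> \<in> half_space \<Longrightarrow> norm (gradient z \<xi>) \<le> (C / fst \<xi>) powr (1 / (q - 1))"
    using gradient_decay[OF a0] by blast
  define T where "T = C / \<sigma> powr (q - 1)"
  have T: "0 < T" using C s by (simp add: T_def)
  have g: "norm (gradient z \<xi>) \<le> \<sigma>" if "T \<le> fst \<xi>" for \<xi>
  proof -
    have f: "0 < fst \<xi>" using T that by simp
    have "C / fst \<xi> \<le> \<sigma> powr (q - 1)" using that f s by (simp add: T_def field_simps)
    hence "(C / fst \<xi>) powr (1 / (q - 1)) \<le> (\<sigma> powr (q - 1)) powr (1 / (q - 1))"
      using C f q by (intro powr_mono2) auto
    also have "\<dots> = \<sigma>" using s q by (simp add: powr_powr)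
    finally show ?thesis using C(2)[of \<xi>] f by (simp add: half_space_def)
  qed
  show ?thesis
  proof (rule that[OF T])
    fix \<xi> \<zeta> :: "real \<times> (real^'m)" assume xz: "T \<le> fst \<xi>" "T \<le> fst \<zeta>"
    have seg: "closed_segment \<zeta> (\<zeta> + (\<xi> - \<zeta>)) \<subseteq> {x. T \<le> fst x}"
    proof (rule closed_segment_subset)
      have "{x :: real \<times> (real^'m). T \<le> fst x} = fst -` {T..}" by auto
      thus "convex {x :: real \<times> (real^'m). T \<le> fst x}"
        by (simp add: convex_linear_vimage linear_fst)
    qed (use xz in auto)
    also have "\<dots> \<subseteq> half_space" using T by (auto simp: half_space_def)
    finally have "closed_segment \<zeta> (\<zeta> + (\<xi> - \<zeta>)) \<subseteq> half_space" .
    moreover have "z differentiable_on half_space" using C2 by (simp add: C2_on_def)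
    ultimately obtain w where w: "w \<in> closed_segment \<zeta> (\<zeta> + (\<xi> - \<zeta>))" "z (\<zeta> + (\<xi> - \<zeta>)) - z \<zeta> = gradient z w \<bullet> (\<xi> - \<zeta>)"
      using gradient_mean_value[OF _ open_half_space] by blast
    have "gradient z w \<bullet> (\<xi> - \<zeta>) \<le> norm (gradient z w) * norm (\<xi> - \<zeta>)" by (rule norm_cauchy_schwarz)
    also have "\<dots> \<le> \<sigma> * norm (\<xi> - \<zeta>)" using g[of w] w(1) seg by (intro mult_right_mono) auto
    finally show "z \<xi> \<le> z \<zeta> + \<sigma> * norm (\<xi> - \<zeta>)" using w(2) by simp
  qed
qed

text \<open>The linear function M + \<sigma> \<xi>1 is a strict supersolution, with second
  derivative 0 against the gradient term \<beta> \<sigma>^q. Far away it lies above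
  \<open>z\<close>, whose Lipschitz constant there is only \<sigma>/2. Any small \<sigma> is
  allowed, and every q in (1, 2].\<close>

lemma le_boundary_value:
  assumes a0: "\<alpha> = 0" and MF: "M \<noteq> \<infinity>" and t0: "0 < t0"
  shows "z (t0, y0) \<le> enn2real M"
proof (rule ccontr)
  assume "\<not> z (t0, y0) \<le> enn2real M"
  define e where "e = z (t0, y0) - enn2real M"
  have e: "0 < e" using \<open>\<not> z (t0, y0) \<le> enn2real M\<close> by (simp add: e_def)
  \<comment> \<open>\<sigma> t0 and \<epsilon> cost e/3 each, less than the assumed excess
    e.\<close>
  define \<sigma> where "\<sigma> = e / (3 * t0)"
  define \<epsilon> where "\<epsilon> = e / 3"
  have s: "0 < \<sigma>" and ep: "0 < \<epsilon>" using e t0 by (auto simp: \<sigma>_def \<epsilon>_def)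
  define \<eta> where "\<eta> = 1/2 * \<beta> * \<sigma> powr q / 2"
  have eta: "0 < \<eta>" using beta s by (simp add: \<eta>_def)
  have half: "0 < (1/2 :: real)" "(1/2 :: real) < 1" by simp_all
  obtain R where R: "R > 0" and cmp: "\<And>f f' f'' a A t0 y0. \<lbrakk>0 \<le> a; a < t0; t0 < A;
     \<forall>t. a < t \<and> t < A \<longrightarrow> (f has_real_derivative f' t) (at t) \<and> (f' has_real_derivative f'' t) (at t) \<and>
        0 \<le> f t \<and> f'' t + \<eta> < \<alpha> * (f t + \<epsilon>) powr p + 1/2 * \<beta> * \<bar>f' t\<bar> powr q;
     \<exists>a1>a. \<forall>t y. a < t \<and> t < a1 \<and> y \<in> cball y0 R \<longrightarrow> z (t, y) < f t + \<epsilon>;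
     \<exists>A1<A. \<forall>t y. A1 < t \<and> t < A \<and> y \<in> cball y0 R \<longrightarrow> z (t, y) < f t + \<epsilon>\<rbrakk> \<Longrightarrow>
     z (t0, y0) \<le> f t0 + \<epsilon>"
    using upper_comparison[OF half ep eta] by blast
  obtain T where T: "0 < T" "\<And>\<xi> \<zeta>. T \<le> fst \<xi> \<Longrightarrow> T \<le> fst \<zeta> \<Longrightarrow> z \<xi> \<le> z \<zeta> + \<sigma> / 2 * norm (\<xi> - \<zeta>)"
    using eventually_lipschitz[OF a0, of "\<sigma> / 2"] s by auto
  \<comment> \<open>Beyond \<open>A1\<close> the growth \<sigma> t outruns z (T, y0) + \<sigma> (t +
    R) / 2, the Lipschitz bound on the whole ball.\<close>
  define A1 where "A1 = max (max T t0) (2 * \<bar>z (T, y0)\<bar> / \<sigma> + R)"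
  have A1: "T \<le> A1" "t0 \<le> A1" "2 * \<bar>z (T, y0)\<bar> / \<sigma> + R \<le> A1" by (auto simp: A1_def)
  have M0: "0 \<le> enn2real M" by simp
  have "z (t0, y0) \<le> (\<lambda>t. enn2real M + \<sigma> * t) t0 + \<epsilon>"
  proof (rule cmp[of 0 t0 "A1 + 1" _ "\<lambda>_. \<sigma>" "\<lambda>_. 0"])
    show "\<forall>t. 0 < t \<and> t < A1 + 1 \<longrightarrow> ((\<lambda>t. enn2real M + \<sigma> * t) has_real_derivative \<sigma>) (at t) \<and>
       ((\<lambda>_. \<sigma>) has_real_derivative 0) (at t) \<and> 0 \<le> enn2real M + \<sigma> * t \<and>
       0 + \<eta> < \<alpha> * (enn2real M + \<sigma> * t + \<epsilon>) powr p + 1/2 * \<beta> * \<bar>\<sigma>\<bar> powr q"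
      using s M0 a0 beta by (auto intro!: derivative_eq_intros simp: \<eta>_def)
    have "\<forall>\<^sub>F t in at_right 0. \<forall>y\<in>cball y0 R. \<bar>z (t, y) - enn2real M\<bar> < \<epsilon>"
      by (rule boundary_finite[OF MF compact_cball ep])
    then obtain a1 where a1: "0 < a1" "\<And>t y. 0 < t \<Longrightarrow> t < a1 \<Longrightarrow> y \<in> cball y0 R \<Longrightarrow> \<bar>z (t, y) - enn2real M\<bar> < \<epsilon>"
      unfolding eventually_at_right_field by blast
    show "\<exists>a1>0. \<forall>t y. 0 < t \<and> t < a1 \<and> y \<in> cball y0 R \<longrightarrow> z (t, y) < enn2real M + \<sigma> * t + \<epsilon>"
    proof (intro exI[of _ a1] conjI allI impI a1(1))
      fix t y assume ty: "0 < t \<and> t < a1 \<and> y \<in> cball y0 R"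
      have "\<bar>z (t, y) - enn2real M\<bar> < \<epsilon>" using a1(2) ty by blast
      moreover have "0 < \<sigma> * t" using s ty by simp
      ultimately show "z (t, y) < enn2real M + \<sigma> * t + \<epsilon>" by linarith
    qed
    show "\<exists>A1'<A1 + 1. \<forall>t y. A1' < t \<and> t < A1 + 1 \<and> y \<in> cball y0 R \<longrightarrow> z (t, y) < enn2real M + \<sigma> * t + \<epsilon>"
    proof (intro exI[of _ A1] conjI allI impI)
      fix t y assume ty: "A1 < t \<and> t < A1 + 1 \<and> y \<in> cball y0 R"
      have "norm ((t, y) - (T, y0)) \<le> norm (t - T) + norm (y - y0)"
        using norm_Pair_le[of "t - T" "y - y0"] by simp
      also have "\<dots> \<le> t + R" using ty A1 T by (auto simp: dist_norm norm_minus_commute)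
      finally have "\<sigma> / 2 * norm ((t, y) - (T, y0)) \<le> \<sigma> / 2 * (t + R)" using s by (intro mult_left_mono) auto
      hence "z (t, y) \<le> z (T, y0) + \<sigma> / 2 * (t + R)"
        using T(2)[of "(t, y)" "(T, y0)"] ty A1 by simp
      moreover have "2 * \<bar>z (T, y0)\<bar> / \<sigma> + R \<le> t" using ty A1 by simp
      hence "\<sigma> * (2 * \<bar>z (T, y0)\<bar> / \<sigma> + R) \<le> \<sigma> * t" using s by (intro mult_left_mono) auto
      hence "2 * \<bar>z (T, y0)\<bar> + \<sigma> * R \<le> \<sigma> * t" using s by (simp add: distrib_left)
      moreover have "\<sigma> / 2 * (t + R) = \<sigma> * t / 2 + \<sigma> * R / 2" by (simp add: field_simps)
      ultimately show "z (t, y) < enn2real M + \<sigma> * t + \<epsilon>" using M0 ep by linarith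
    qed simp
  qed (use A1 t0 in auto)
  moreover have "\<sigma> * t0 = e / 3" using t0 by (simp add: \<sigma>_def)
  moreover have "z (t0, y0) = enn2real M + e" by (simp add: e_def)
  ultimately show False using e by (simp add: \<epsilon>_def)
qed

text \<open>For q = 2 the substitution e^(-\<beta> z) linearizes the equation, and L - ln (1 +
  \<sigma> t) / \<beta> is an exact solution unbounded below. Halving the logarithm gives f'' = 2
  \<beta> f'^2, a strict subsolution whose surplus pays for the barrier. For small \<sigma> it is
  close to L at any given point, yet it still drops below 0 eventually, where
  \<open>z \<ge> 0\<close> takes over.\<close>

lemma ge_level_of_quadratic:
  assumes a0: "\<alpha> = 0" and q2: "q = 2" and L: "M = \<infinity> \<or> L = enn2real M" and t0: "0 < t0"
  shows "L \<le> z (t0, y0)"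
proof (rule ccontr)
  assume "\<not> L \<le> z (t0, y0)"
  define e where "e = L - z (t0, y0)"
  have e: "0 < e" using \<open>\<not> L \<le> z (t0, y0)\<close> by (simp add: e_def)
  define \<epsilon> where "\<epsilon> = e / 4"
  have ep: "0 < \<epsilon>" using e by (simp add: \<epsilon>_def)
  \<comment> \<open>Solves ln (1 + \<sigma> t0) = \<beta> e, so that f t0 = L - e/2.\<close>
  define \<sigma> where "\<sigma> = (exp (\<beta> * e) - 1) / t0"
  have s: "0 < \<sigma>" using e beta t0 by (simp add: \<sigma>_def)
  \<comment> \<open>Where f > \<epsilon> one has 1 + \<sigma> t < E, so the surplus there is at
    least \<open>g\<close>.\<close>
  define E where "E = exp (2 * \<beta> * \<bar>L\<bar>)"
  have E: "0 < E" by (simp add: E_def)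
  define g where "g = \<sigma>\<^sup>2 / (4 * \<beta>) * (inverse E)\<^sup>2"
  have g: "0 < g" using s beta E by (simp add: g_def)
  obtain \<eta> where eta: "0 < \<eta>" "real (DIM(real^'m)) * \<eta> + \<beta> * \<eta> powr q < g"
    using ex_small_perturbation[of "real (DIM(real^'m))" \<beta> q g] beta q g by auto
  define f where "f = (\<lambda>t. L - ln (1 + \<sigma> * t) / (2 * \<beta>))"
  define f' where "f' = (\<lambda>t. - (\<sigma> / (2 * \<beta>)) * inverse (1 + \<sigma> * t))"
  define f'' where "f'' = (\<lambda>t. \<sigma>\<^sup>2 / (2 * \<beta>) * (inverse (1 + \<sigma> * t))\<^sup>2)"
  have pos: "0 < 1 + \<sigma> * t" if "0 < t" for t using s that by (simp add: add_pos_pos)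
  have "f t0 - \<epsilon> \<le> z (t0, y0)"
  proof (rule lower_comparison[of 0 \<epsilon> \<eta> f f' f'' L, OF _ _ ep eta(1) _ _ _ _ _ _ t0])
    fix t :: real assume t: "0 < t"
    show "(f has_real_derivative f' t) (at t)"
    proof -
      have l: "((\<lambda>t. 1 + \<sigma> * t) has_real_derivative \<sigma>) (at t)" by (auto intro!: derivative_eq_intros)
      from DERIV_diff[OF DERIV_const DERIV_cdivide[OF DERIV_chain2[OF DERIV_ln[OF pos[OF t]] l], of "2 * \<beta>"], of L]
      moreover have "0 - i * \<sigma> / (2 * \<beta>) = - (\<sigma> / (2 * \<beta>)) * i" for i by (simp add: mult.commute)
      ultimately show ?thesis unfolding f_def f'_def by metis
    qed
    show "(f' has_real_derivative f'' t) (at t)"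
    proof -
      have "((\<lambda>t. 1 + \<sigma> * t) has_real_derivative \<sigma>) (at t)" by (auto intro!: derivative_eq_intros)
      from DERIV_inverse'[OF this] pos[OF t]
      have "((\<lambda>t. inverse (1 + \<sigma> * t)) has_real_derivative - (inverse (1 + \<sigma> * t) * \<sigma> * inverse (1 + \<sigma> * t))) (at t)"
        by simp
      from DERIV_cmult[OF this, of "- (\<sigma> / (2 * \<beta>))"] show ?thesis
        unfolding f'_def f''_def by (rule DERIV_cong) (simp add: power2_eq_square)
    qed
    have ln0: "0 \<le> ln (1 + \<sigma> * t)" using s t by simp
    thus "f t \<le> L" using beta by (simp add: f_def)
    assume ft: "0 + \<epsilon> < f t"
    have "ln (1 + \<sigma> * t) < 2 * \<beta> * \<bar>L\<bar>"
    proof -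
      have "ln (1 + \<sigma> * t) / (2 * \<beta>) < \<bar>L\<bar>" using ft ep by (simp add: f_def)
      thus ?thesis using beta by (simp add: field_simps)
    qed
    hence "exp (ln (1 + \<sigma> * t)) < E" unfolding E_def by (rule exp_less_mono)
    hence lt: "1 + \<sigma> * t < E" using pos[OF t] by simp
    hence "inverse E \<le> inverse (1 + \<sigma> * t)" using pos[OF t] by (intro le_imp_inverse_le) auto
    define X where "X = \<sigma>\<^sup>2 / (4 * \<beta>) * (inverse (1 + \<sigma> * t))\<^sup>2"
    from \<open>inverse E \<le> inverse (1 + \<sigma> * t)\<close>
    have "(inverse E)\<^sup>2 \<le> (inverse (1 + \<sigma> * t))\<^sup>2" using E by (intro power_mono) auto
    hence gX: "g \<le> X" unfolding g_def X_def using beta by (intro mult_left_mono) auto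
    have "\<beta> * (- (\<sigma> / (2 * \<beta>)) * i)\<^sup>2 = \<sigma>\<^sup>2 / (4 * \<beta>) * i\<^sup>2" for i
      using beta by (simp add: power2_eq_square field_simps)
    hence "\<beta> * (f' t)\<^sup>2 = X" unfolding f'_def X_def .
    moreover have "\<bar>f' t\<bar> powr q = (f' t)\<^sup>2"
      using pos[OF t] s beta q2 by (simp add: f'_def powr_numeral)
    moreover have "f'' t = 2 * X" by (simp add: f''_def X_def)
    ultimately have "\<beta> * \<bar>f' t\<bar> powr q + g \<le> f'' t" using gX by simp
    thus "\<alpha> * f t powr p + \<beta> * \<bar>f' t\<bar> powr q + (real DIM(real^'m) * \<eta> + \<beta> * \<eta> powr q) < f'' t"
      using eta(2) a0 by simp
  next
    show "\<forall>\<^sub>F t in at_top. f t \<le> 0 + \<epsilon>"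
      using eventually_ge_at_top[of "E / \<sigma>"]
    proof eventually_elim
      case (elim t)
      have "E \<le> 1 + \<sigma> * t" using elim s by (simp add: field_simps)
      hence "ln E \<le> ln (1 + \<sigma> * t)" using E by simp
      hence "2 * \<beta> * \<bar>L\<bar> / (2 * \<beta>) \<le> ln (1 + \<sigma> * t) / (2 * \<beta>)"
        using beta by (intro divide_right_mono) (auto simp: E_def)
      thus ?case using beta ep by (simp add: f_def)
    qed
    fix K :: "(real^'m) set" assume K: "compact K"
    have "\<forall>\<^sub>F t in at_right 0. \<forall>y\<in>K. L - \<epsilon> < z (t, y)"
    proof (cases "M = \<infinity>")
      case False
      from boundary_finite[OF False K ep] show ?thesis
      proof eventually_elim
        case (elim t)
        thus ?case using False L by (auto simp: abs_less_iff dest!: bspec)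
      qed
    qed (rule boundary_infinite[OF _ K])
    with eventually_at_right_less[of 0] show "\<forall>\<^sub>F t in at_right 0. \<forall>y\<in>K. f t - \<epsilon> < z (t, y)"
    proof eventually_elim
      case (elim t)
      have "0 \<le> ln (1 + \<sigma> * t)" using s elim by simp
      hence "f t \<le> L" using beta by (simp add: f_def)
      thus ?case using elim(2) by force
    qed
  qed (use nonneg in auto)
  moreover have "f t0 = L - e / 2" using t0 beta by (simp add: f_def \<sigma>_def)
  moreover have "z (t0, y0) = L - e" by (simp add: e_def)
  ultimately show False using e unfolding \<epsilon>_def by linarith
qed

end

lemma half_space_nonempty: "half_space \<noteq> {}"
proof -
  have "(1, 0) \<in> half_space" by (simp add: half_space_def)
  thus ?thesis by blast
qed

context half_space_problem
begin

text \<open>For q < 2 the exponent \<gamma> = 1/(q-1) exceeds 1, so the bound on the \<xi>1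
  derivative is integrable at infinity and moving along \<xi>1 beyond A costs at most e/3. Two
  points are joined by going out to a common \<xi>1 = S, across, and back, with S so large that the
  Lipschitz constant there beats their distance in \<xi>'. S depends on the two points, A does
  not.\<close>

lemma oscillation_decay:
  assumes a0: "\<alpha> = 0" and q2: "q < 2" and e: "0 < e"
  obtains A where "0 < A" "\<And>\<xi> \<zeta>. A \<le> fst \<xi> \<Longrightarrow> A \<le> fst \<zeta> \<Longrightarrow> z \<xi> \<le> z \<zeta> + e"
proof -
  obtain C where C: "0 < C" "\<And>\<xi>. \<xi> \<in> half_space \<Longrightarrow> norm (gradient z \<xi>) \<le> (C / fst \<xi>) powr (1 / (q - 1))"
    using gradient_decay[OF a0] by blast
  define \<gamma> where "\<gamma> = 1 / (q - 1)"
  have gam: "1 < \<gamma>" using q q2 by (simp add: \<gamma>_def)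
  define K where "K = C powr \<gamma> / (\<gamma> - 1)"
  have K: "0 < K" using C gam by (simp add: K_def)
  have slope1: "\<exists>d. ((\<lambda>s. z (s, y)) has_real_derivative d) (at s) \<and> \<bar>d\<bar> \<le> C powr \<gamma> * s powr (- \<gamma>)" if s: "0 < s" for s y
  proof -
    have H: "(s, y) \<in> half_space" using s by (simp add: half_space_def)
    have zd: "z differentiable_on half_space" using C2 by (simp add: C2_on_def)
    have "(z has_derivative (\<lambda>v. gradient z (s, y) \<bullet> v)) (at (s, y))"
      by (rule frechet_derivative_eq_gradient[OF zd open_half_space H])
    moreover have "((\<lambda>s. (s, y)) has_derivative (\<lambda>h. (h, 0))) (at s)"
      by (auto intro!: derivative_eq_intros)
    ultimately have "((\<lambda>s. z (s, y)) has_derivative (\<lambda>h. gradient z (s, y) \<bullet> (h, 0))) (at s)"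
      by (rule has_derivative_compose[rotated])
    moreover have "gradient z (s, y) \<bullet> (h, 0) = fst (gradient z (s, y)) * h" for h
      by (simp add: inner_prod_def)
    ultimately have "((\<lambda>s. z (s, y)) has_real_derivative fst (gradient z (s, y))) (at s)"
      by (simp add: has_field_derivative_def)
    moreover have "\<bar>fst (gradient z (s, y))\<bar> \<le> norm (gradient z (s, y))"
      using norm_fst_le[of "fst (gradient z (s, y))" "snd (gradient z (s, y))"] by simp
    moreover have "norm (gradient z (s, y)) \<le> (C / s) powr \<gamma>" using C(2)[OF H] by (simp add: \<gamma>_def)
    moreover have "(C / s) powr \<gamma> = C powr \<gamma> * s powr (- \<gamma>)"
      using C s by (simp add: powr_divide powr_minus_divide)
    ultimately show ?thesis by (intro exI[of _ "fst (gradient z (s, y))"]) simp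
  qed
  have DK: "((\<lambda>s. K * s powr (1 - \<gamma>)) has_real_derivative - (C powr \<gamma> * s powr (- \<gamma>))) (at s)" if s: "0 < s" for s
  proof -
    have "((\<lambda>s. K * s powr (1 - \<gamma>)) has_real_derivative K * ((1 - \<gamma>) * s powr (1 - \<gamma> - 1))) (at s)"
      by (rule DERIV_cmult[OF has_real_derivative_powr[OF s]])
    moreover have "K * ((1 - \<gamma>) * X) = - (C powr \<gamma> * X)" for X
    proof -
      have "K * (\<gamma> - 1) = C powr \<gamma>" using gam by (simp add: K_def)
      hence "C powr \<gamma> * X = K * (\<gamma> - 1) * X" by simp
      thus ?thesis by (simp add: algebra_simps)
    qed
    ultimately show ?thesis by simp
  qed
  have up: "z (s, y) \<le> z (t, y) + K * t powr (1 - \<gamma>)" if ts: "0 < t" "t \<le> s" for s t y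
  proof -
    have "z (s, y) + K * s powr (1 - \<gamma>) \<le> z (t, y) + K * t powr (1 - \<gamma>)"
    proof (rule DERIV_nonpos_imp_nonincreasing[OF ts(2)])
      fix x assume "t \<le> x" "x \<le> s"
      hence x: "0 < x" using ts by simp
      obtain d where d: "((\<lambda>s. z (s, y)) has_real_derivative d) (at x)" "\<bar>d\<bar> \<le> C powr \<gamma> * x powr (- \<gamma>)"
        using slope1[OF x] by blast
      show "\<exists>D. ((\<lambda>s. z (s, y) + K * s powr (1 - \<gamma>)) has_real_derivative D) (at x) \<and> D \<le> 0"
        using DERIV_add[OF d(1) DK[OF x]] d(2) by (intro exI[of _ "d + - (C powr \<gamma> * x powr (- \<gamma>))"]) auto
    qed
    moreover have "0 \<le> K * s powr (1 - \<gamma>)" using K by simp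
    ultimately show ?thesis by linarith
  qed
  have down: "z (t, y) \<le> z (s, y) + K * t powr (1 - \<gamma>)" if ts: "0 < t" "t \<le> s" for s t y
  proof -
    have "z (t, y) - K * t powr (1 - \<gamma>) \<le> z (s, y) - K * s powr (1 - \<gamma>)"
    proof (rule DERIV_nonneg_imp_nondecreasing[OF ts(2)])
      fix x assume "t \<le> x" "x \<le> s"
      hence x: "0 < x" using ts by simp
      obtain d where d: "((\<lambda>s. z (s, y)) has_real_derivative d) (at x)" "\<bar>d\<bar> \<le> C powr \<gamma> * x powr (- \<gamma>)"
        using slope1[OF x] by blast
      show "\<exists>D. ((\<lambda>s. z (s, y) - K * s powr (1 - \<gamma>)) has_real_derivative D) (at x) \<and> 0 \<le> D"
        using DERIV_diff[OF d(1) DK[OF x]] d(2) by (intro exI[of _ "d - - (C powr \<gamma> * x powr (- \<gamma>))"]) auto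
    qed
    moreover have "0 \<le> K * s powr (1 - \<gamma>)" using K by simp
    ultimately show ?thesis by linarith
  qed
  define A where "A = (e / (3 * K)) powr (1 / (1 - \<gamma>))"
  have A: "0 < A" using e K by (simp add: A_def)
  have AK: "K * t powr (1 - \<gamma>) \<le> e / 3" if "A \<le> t" for t
  proof -
    have "t powr (1 - \<gamma>) \<le> A powr (1 - \<gamma>)" using that A gam by (intro powr_mono2') auto
    also have "\<dots> = e / (3 * K)" using e K gam by (simp add: A_def powr_powr)
    finally have "K * t powr (1 - \<gamma>) \<le> K * (e / (3 * K))" using K by (intro mult_left_mono) auto
    thus ?thesis using K by simp
  qed
  show ?thesis
  proof (rule that[OF A])
    fix \<xi> \<zeta> :: "real \<times> (real^'m)" assume xz: "A \<le> fst \<xi>" "A \<le> fst \<zeta>"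
    obtain t y where x: "\<xi> = (t, y)" by (cases \<xi>)
    obtain t' y' where w: "\<zeta> = (t', y')" by (cases \<zeta>)
    define \<sigma> where "\<sigma> = e / (3 * (norm (y - y') + 1))"
    have s: "0 < \<sigma>" using e by (simp add: \<sigma>_def add_nonneg_pos)
    obtain T where T: "0 < T" "\<And>\<xi> \<zeta>. T \<le> fst \<xi> \<Longrightarrow> T \<le> fst \<zeta> \<Longrightarrow> z \<xi> \<le> z \<zeta> + \<sigma> * norm (\<xi> - \<zeta>)"
      using eventually_lipschitz[OF a0 s] by blast
    define S where "S = max T (max t t')"
    have S: "T \<le> S" "t \<le> S" "t' \<le> S" by (auto simp: S_def)
    have tt: "0 < t" "0 < t'" "A \<le> t" "A \<le> t'" using xz A by (auto simp: x w)
    have "z (t, y) \<le> z (S, y) + e / 3" using down[OF tt(1) S(2), of y] AK[OF tt(3)] by linarith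
    moreover have "z (S, y) \<le> z (S, y') + e / 3"
    proof -
      have "\<sigma> * norm (y - y') \<le> \<sigma> * (norm (y - y') + 1)" using s by (intro mult_left_mono) auto
      also have "\<dots> = e / 3"
      proof -
        have "norm (y - y') + 1 \<noteq> 0" using norm_ge_zero[of "y - y'"] by linarith
        moreover have "e / (3 * x) * x = e / 3" if "x \<noteq> 0" for x using that by simp
        ultimately show ?thesis unfolding \<sigma>_def by blast
      qed
      finally show ?thesis using T(2)[of "(S, y)" "(S, y')"] S(1) by (simp add: norm_Pair)
    qed
    moreover have "z (S, y') \<le> z (t', y') + e / 3" using up[OF tt(2) S(3), of y'] AK[OF tt(4)] by linarith
    ultimately show "z \<xi> \<le> z \<zeta> + e" unfolding x w by linarith
  qed
qed

text \<open>The lower bound m + \<phi> shows that a near-minimizer of \<open>z\<close> cannot have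
  small \<xi>1. It lies where the oscillation is small, so \<open>z\<close> is close to its infimum
  for all large \<xi>1, and this is the condition at infinity that the upper bound needs.\<close>

lemma eq_profile_of_subquadratic:
  assumes a0: "\<alpha> = 0" and q2: "q < 2" and c: "0 \<le> c"
    and m: "m = Inf (z ` half_space)" and mM: "M = \<infinity> \<and> c = 0 \<or> M \<noteq> \<infinity> \<and> 0 < c \<and> m < enn2real M \<and> slope_tail q \<beta> c 0 = enn2real M - m"
    and t: "0 < t"
  shows "z (t, y) = m + slope_tail q \<beta> c t"
proof -
  define \<phi> where "\<phi> = slope_tail q \<beta> c"
  define \<phi>' where "\<phi>' = (\<lambda>t. - slope q \<beta> c t)"
  have pr: "profile q \<alpha> p \<beta> \<phi> \<phi>'"
    unfolding \<phi>_def \<phi>'_def a0 by (rule slope_profile[OF q(1) q2 beta c])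
  have lim: "M = \<infinity> \<and> filterlim \<phi> at_top (at_right 0) \<or> M \<noteq> \<infinity> \<and> m \<le> enn2real M \<and> (\<phi> \<longlongrightarrow> enn2real M - m) (at_right 0)"
    using mM slope_tail_at_0_infinite[OF q(1) q2 beta] slope_tail_at_0[OF q(1) q2 beta c] unfolding \<phi>_def by auto
  have ne: "half_space \<noteq> ({} :: (real \<times> (real^'m)) set)"
    by (rule half_space_nonempty)
  have bdd: "bdd_below (z ` half_space)" using nonneg by (intro bdd_belowI[of _ 0]) auto
  have mz: "m \<le> z \<xi>" if "\<xi> \<in> half_space" for \<xi> unfolding m using bdd that by (intro cInf_lower) auto
  have m0: "0 \<le> m" unfolding m using ne nonneg by (intro cInf_greatest) auto
  have sp: "0 < slope q \<beta> c s" if "0 < s" for s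
    by (rule slope_pos[OF q(1) q2 beta c slope_base_pos[OF q(1) q2 beta c]]) (use that in auto)
  have sdec: "slope q \<beta> c u \<le> slope q \<beta> c s" if "0 < s" "s \<le> u" for s u
  proof -
    have b: "0 < (q - 1) * \<beta> * s + c" by (rule slope_base_pos[OF q(1) q2 beta c]) (use that in auto)
    have "(q - 1) * \<beta> * s + c \<le> (q - 1) * \<beta> * u + c"
      using that q beta by (intro add_right_mono mult_left_mono) auto
    thus ?thesis unfolding slope_def using b q by (intro powr_mono2') auto
  qed
  \<comment> \<open>The slope decreases, so on (0, S] the gradient term is at least its value at S.
    Without absorption this is the only gain, uniform on bounded ranges only.\<close>
  have gr: "\<beta> * slope q \<beta> c S powr q \<le> \<beta> * \<bar>\<phi>' s\<bar> powr q" if "0 < s" "s \<le> S" for s S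
    using sdec[OF that] sp[of s] sp[of S] that q beta unfolding \<phi>'_def
    by (intro mult_left_mono powr_mono2) auto
  have lower: "m + \<phi> t \<le> z (t, y)" if t: "0 < t" for t y
  proof (rule ge_profile_limit[OF pr t])
    fix c' \<epsilon> \<delta> :: real assume c': "0 < c'" "c' < 1" and e: "0 < \<epsilon>" and d: "if M = \<infinity> then 0 < \<delta> else \<delta> = 0"
    have "(\<phi> \<longlongrightarrow> 0) at_top" using pr by (simp add: profile_def)
    hence "\<forall>\<^sub>F s in at_top. \<phi> s < \<epsilon>" using e by (rule order_tendstoD(2))
    then obtain S where S: "\<And>s. S \<le> s \<Longrightarrow> \<phi> s < \<epsilon>" unfolding eventually_at_top_linorder by blast
    define S' where "S' = max S 1"
    have S'0: "0 < S'" by (simp add: S'_def less_max_iff_disj)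
    show "m + c' * \<phi> ((t + \<delta>) / c') - \<epsilon> \<le> z (t, y)"
    proof (rule lower_bound_by_profile[OF pr m0 _ mz c' e _ _ _ t, where g = "\<beta> * slope q \<beta> c S' powr q"])
      show "M = \<infinity> \<and> 0 < \<delta> \<or> M \<noteq> \<infinity> \<and> \<delta> = 0 \<and> (\<phi> \<longlongrightarrow> enn2real M - m) (at_right 0)"
        using d lim by (auto split: if_splits)
      show "0 < \<beta> * slope q \<beta> c S' powr q" using beta sp[OF S'0] by simp
      show "\<beta> * slope q \<beta> c S' powr q \<le> \<alpha> * \<phi> s powr p + \<beta> * \<bar>\<phi>' s\<bar> powr q" if "0 < s" "\<epsilon> < \<phi> s" for s
      proof -
        have "s < S" using S[of s] that by (cases "S \<le> s") auto
        thus ?thesis using gr[of s S'] that a0 by (simp add: S'_def)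
      qed
    qed (use a0 in auto)
  qed
  have "z (t, y) \<le> m + \<phi> t"
  proof (rule le_profile_limit[OF pr t])
    fix c' \<epsilon> \<delta> :: real assume c': "1 < c'" and e: "0 < \<epsilon>" and d: "\<delta> < t" "if M = \<infinity> then 0 < \<delta> else \<delta> = 0"
    obtain A where A: "0 < A" "\<And>\<xi> \<zeta>. A \<le> fst \<xi> \<Longrightarrow> A \<le> fst \<zeta> \<Longrightarrow> z \<xi> \<le> z \<zeta> + \<epsilon> / 2"
      using oscillation_decay[OF a0 q2, of "\<epsilon> / 2"] e by auto
    have phiA: "0 < \<phi> A"
      using slope_base_pos[OF q(1) q2 beta c, of A] A q2 beta by (simp add: \<phi>_def slope_tail_def)
    \<comment> \<open>\<phi> A excludes points with \<xi>1 < A; the other \<epsilon>/2 is taken by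
      the oscillation.\<close>
    have "m < m + min (\<phi> A) (\<epsilon> / 2)" using phiA e by simp
    hence "\<exists>v\<in>z ` half_space. v < m + min (\<phi> A) (\<epsilon> / 2)"
      using cInf_less_iff[OF _ bdd] ne unfolding m by blast
    then obtain \<zeta> where zeta: "\<zeta> \<in> half_space" "z \<zeta> < m + min (\<phi> A) (\<epsilon> / 2)" by auto
    have fz: "0 < fst \<zeta>" using zeta(1) by (simp add: half_space_def)
    have Az: "A \<le> fst \<zeta>"
    proof (rule ccontr)
      assume "\<not> A \<le> fst \<zeta>"
      hence "\<phi> A \<le> \<phi> (fst \<zeta>)" using fz by (intro profile_antimono[OF pr]) auto
      moreover have "m + \<phi> (fst \<zeta>) \<le> z \<zeta>" using lower[OF fz, of "snd \<zeta>"] by simp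
      ultimately show False using zeta(2) by simp
    qed
    have top: "z (s, x) < m + \<epsilon>" if "A \<le> s" for s x
      using A(2)[of "(s, x)" \<zeta>] that Az zeta(2) by simp
    define B where "B = max t A + 1"
    \<comment> \<open>The choice \<theta> = (1 + 1/c')/2, halfway between 1/c' and 1, leaves the
      fraction (1 - 1/c')/2 of the gradient term; \<eta> is half of its lower bound on (0,
      B).\<close>
    define \<eta> where "\<eta> = (1 - 1 / c') / 2 * (\<beta> * slope q \<beta> c B powr q) / 2"
    have B: "0 < B" "t < B" "A < B" using t A(1) by (auto simp: B_def)
    have pB: "0 < \<beta> * slope q \<beta> c B powr q" using beta sp[OF B(1)] by simp
    have eta: "0 < \<eta>" using c' pB by (simp add: \<eta>_def)
    show "z (t, y) \<le> m + c' * \<phi> ((t - \<delta>) / c') + \<epsilon>"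
    proof (rule upper_bound_by_profile[OF pr m0 c' e, where S = A and A = B and \<theta> = "(1 + 1 / c') / 2" and \<eta> = \<eta>])
      show "M = \<infinity> \<and> 0 < \<delta> \<and> filterlim \<phi> at_top (at_right 0) \<or>
         M \<noteq> \<infinity> \<and> \<delta> = 0 \<and> m \<le> enn2real M \<and> (\<phi> \<longlongrightarrow> enn2real M - m) (at_right 0)"
        using d lim by (auto split: if_splits)
      show "0 < (1 + 1 / c') / 2" "(1 + 1 / c') / 2 < 1" using c' by (auto simp: add_pos_pos)
      show "z (s, x) < m + \<epsilon>" if "A \<le> s" for s x by (rule top[OF that])
      show "(\<alpha> * \<phi> s powr p + \<beta> * \<bar>\<phi>' s\<bar> powr q) / c' + \<eta> < \<alpha> * (m + c' * \<phi> s + \<epsilon>) powr p + (1 + 1 / c') / 2 * \<beta> * \<bar>\<phi>' s\<bar> powr q"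
        if "0 < s" "s < B" for s
      proof -
        define X where "X = \<beta> * \<bar>\<phi>' s\<bar> powr q"
        have "\<beta> * slope q \<beta> c B powr q \<le> X" unfolding X_def using that by (intro gr) auto
        hence "(1 - 1 / c') / 2 * (\<beta> * slope q \<beta> c B powr q) \<le> (1 - 1 / c') / 2 * X"
          using c' by (intro mult_left_mono) auto
        moreover have "2 * \<eta> = (1 - 1 / c') / 2 * (\<beta> * slope q \<beta> c B powr q)" by (simp only: \<eta>_def) simp
        ultimately have "2 * \<eta> \<le> (1 - 1 / c') / 2 * X" by (simp only:)
        moreover have "(1 + 1 / c') / 2 * X = X / c' + (1 - 1 / c') / 2 * X" by (simp add: field_simps)
        ultimately have "X / c' + \<eta> < (1 + 1 / c') / 2 * X" using eta by linarith
        thus ?thesis using a0 unfolding X_def by (simp add: mult.assoc)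
      qed
    qed (use d eta B in auto)
  qed
  with lower[OF t, of y] show ?thesis by (simp add: \<phi>_def)
qed

end

theorem theorem4p1:
  fixes q \<alpha> p \<beta> :: real and M :: ennreal
  assumes "1 < q" "q \<le> 2" "0 \<le> \<alpha>" "0 < p" "0 < \<beta>"
  shows
    "(0 < \<alpha> \<longrightarrow>
        (\<exists>z :: real \<times> (real^'m) \<Rightarrow> real.
           solves_P q \<alpha> p \<beta> M z \<and> depends_only_on_first z \<and>
           (\<forall>w. solves_P q \<alpha> p \<beta> M w \<longrightarrow> (\<forall>\<xi>\<in>half_space. w \<xi> = z \<xi>)))) \<and>
     (\<alpha> = 0 \<longrightarrow>
        (q < 2 \<and> M < \<infinity> \<longrightarrow>
           (\<forall>l\<in>{0..<enn2real M}. \<exists>!c. implicit_relation q \<beta> (enn2real M - l) c)) \<and>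
        (\<forall>z :: real \<times> (real^'m) \<Rightarrow> real. solves_P q \<alpha> p \<beta> M z \<longrightarrow>
           depends_only_on_first z \<and>
           (q = 2 \<longrightarrow> M < \<infinity> \<and> (\<forall>\<xi>\<in>half_space. z \<xi> = enn2real M)) \<and>
           (q < 2 \<and> M < \<infinity> \<longrightarrow>
              (\<forall>\<xi>\<in>half_space. z \<xi> = enn2real M) \<or>
              (\<exists>l\<in>{0..<enn2real M}. \<exists>c.
                 implicit_relation q \<beta> (enn2real M - l) c \<and>
                 (\<forall>\<xi>\<in>half_space. slope q \<beta> c integrable_on {fst \<xi>..} \<and>
                    z \<xi> = l + integral {fst \<xi>..} (slope q \<beta> c)))) \<and>
           (q < 2 \<and> M = \<infinity> \<longrightarrow>
              (\<exists>l\<ge>0. \<forall>\<xi>\<in>half_space. slope q \<beta> 0 integrable_on {fst \<xi>..} \<and>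
                 z \<xi> = l + integral {fst \<xi>..} (slope q \<beta> 0)))))"
proof (intro conjI impI allI ballI)
  assume al: "0 < \<alpha>"
  obtain \<phi> \<phi>' where pr: "profile q \<alpha> p \<beta> \<phi> \<phi>'" "profile_limit M \<phi>"
    using profile_exists[OF assms(1,2) al assms(4,5)] by blast
  show "\<exists>z :: real \<times> (real^'m) \<Rightarrow> real. solves_P q \<alpha> p \<beta> M z \<and> depends_only_on_first z \<and>
           (\<forall>w. solves_P q \<alpha> p \<beta> M w \<longrightarrow> (\<forall>\<xi>\<in>half_space. w \<xi> = z \<xi>))"
  proof (intro exI[of _ "\<lambda>\<xi>. \<phi> (fst \<xi>)"] conjI allI impI ballI)
    show "solves_P q \<alpha> p \<beta> M (\<lambda>\<xi> :: real \<times> (real^'m). \<phi> (fst \<xi>))"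
      by (rule profile_solves_P[OF assms(1,4) pr])
    show "depends_only_on_first (\<lambda>\<xi> :: real \<times> (real^'m). \<phi> (fst \<xi>))"
      unfolding depends_only_on_first_def by blast
    fix w :: "real \<times> (real^'m) \<Rightarrow> real" and \<xi> :: "real \<times> (real^'m)"
    assume w: "solves_P q \<alpha> p \<beta> M w" and xi: "\<xi> \<in> half_space"
    interpret half_space_problem q \<alpha> p \<beta> w M
      by (rule solves_P_imp_half_space_problem[OF assms w])
    have "0 < fst \<xi>" using xi by (simp add: half_space_def)
    from eq_profile_of_absorption[OF al pr this, of "snd \<xi>"] show "w \<xi> = \<phi> (fst \<xi>)" by simp
  qed
next
  fix l assume "q < 2 \<and> M < \<infinity>" "l \<in> {0..<enn2real M}"
  thus "\<exists>!c. implicit_relation q \<beta> (enn2real M - l) c"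
    by (intro implicit_relation_ex1 assms) auto
next
  fix z :: "real \<times> (real^'m) \<Rightarrow> real"
  assume a0: "\<alpha> = 0" and sol: "solves_P q \<alpha> p \<beta> M z"
  interpret half_space_problem q \<alpha> p \<beta> z M
    by (rule solves_P_imp_half_space_problem[OF assms sol])
  have H: "0 < fst \<xi>" if "\<xi> \<in> half_space" for \<xi> :: "real \<times> (real^'m)" using that by (simp add: half_space_def)
  have Mfin: "M < \<infinity> \<longleftrightarrow> M \<noteq> \<infinity>" by (simp add: less_top)
  have le: "z \<xi> \<le> enn2real M" if "M < \<infinity>" "\<xi> \<in> half_space" for \<xi> :: "real \<times> (real^'m)"
    using le_boundary_value[OF a0 _ H[OF that(2)], of "snd \<xi>"] that(1) Mfin by simp
  show quad: "M < \<infinity>" if q2: "q = 2"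
  proof (rule ccontr)
    assume "\<not> M < \<infinity>"
    \<comment> \<open>For M = \<infinity> every real L is a lower bound of \<open>z\<close>, in
      particular one above its own value.\<close>
    hence "z (1, 0) + 1 \<le> z (1, 0)" using Mfin by (intro ge_level_of_quadratic[OF a0 q2]) auto
    thus False by simp
  qed
  show quad2: "z \<xi> = enn2real M" if q2: "q = 2" and xi: "\<xi> \<in> half_space" for \<xi> :: "real \<times> (real^'m)"
    using le[OF quad[OF q2] xi] ge_level_of_quadratic[OF a0 q2 _ H[OF xi], of "enn2real M" "snd \<xi>"] by simp
  define m where "m = Inf (z ` half_space)"
  have ne: "half_space \<noteq> ({} :: (real \<times> (real^'m)) set)"
    by (rule half_space_nonempty)
  have bdd: "bdd_below (z ` half_space)" using nonneg by (intro bdd_belowI[of _ 0]) auto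
  have m0: "0 \<le> m" unfolding m_def using ne nonneg by (intro cInf_greatest) auto
  have integrals: "slope q \<beta> c integrable_on {fst \<xi>..} \<and> integral {fst \<xi>..} (slope q \<beta> c) = slope_tail q \<beta> c (fst \<xi>)"
    if "q < 2" "0 \<le> c" "\<xi> \<in> half_space" for c and \<xi> :: "real \<times> (real^'m)"
    using slope_has_integral[OF assms(1) that(1) assms(5) that(2), of "fst \<xi>"] H[OF that(3)]
    by (auto simp: integral_unique has_integral_integrable)
  show fin: "(\<forall>\<xi>\<in>half_space. z \<xi> = enn2real M) \<or>
              (\<exists>l\<in>{0..<enn2real M}. \<exists>c.
                 implicit_relation q \<beta> (enn2real M - l) c \<and>
                 (\<forall>\<xi>\<in>half_space. slope q \<beta> c integrable_on {fst \<xi>..} \<and>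
                    z \<xi> = l + integral {fst \<xi>..} (slope q \<beta> c)))" if qM: "q < 2 \<and> M < \<infinity>"
  \<comment> \<open>The infimum decides: if it is below M it serves as l; otherwise M \<le> m \<le>
    z \<le> M.\<close>
  proof (cases "m < enn2real M")
    case True
    obtain c where c: "implicit_relation q \<beta> (enn2real M - m) c"
      using implicit_relation_ex1[of q \<beta> "enn2real M - m"] assms qM True by auto
    hence c0: "0 < c" "slope_tail q \<beta> c 0 = enn2real M - m"
      using implicit_relation_iff[of q \<beta>] assms qM by auto
    have "z \<xi> = m + slope_tail q \<beta> c (fst \<xi>)" if "\<xi> \<in> half_space" for \<xi>
      using eq_profile_of_subquadratic[OF a0 _ _ m_def _ H[OF that], of c "snd \<xi>"] c0 qM True Mfin by simp
    hence "\<forall>\<xi>\<in>half_space. slope q \<beta> c integrable_on {fst \<xi>..} \<and> z \<xi> = m + integral {fst \<xi>..} (slope q \<beta> c)"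
      using integrals[of c] qM c0 by auto
    moreover have "m \<in> {0..<enn2real M}" using m0 True by simp
    ultimately show ?thesis using c by blast
  next
    case False
    have "z \<xi> = enn2real M" if "\<xi> \<in> half_space" for \<xi>
    proof -
      have "m \<le> z \<xi>" unfolding m_def using bdd that by (intro cInf_lower) auto
      thus ?thesis using le[of \<xi>] that qM False by simp
    qed
    thus ?thesis by blast
  qed
  show inf: "\<exists>l\<ge>0. \<forall>\<xi>\<in>half_space. slope q \<beta> 0 integrable_on {fst \<xi>..} \<and>
                 z \<xi> = l + integral {fst \<xi>..} (slope q \<beta> 0)" if qM: "q < 2 \<and> M = \<infinity>"
  proof (intro exI[of _ m] conjI m0 ballI)
    fix \<xi> :: "real \<times> (real^'m)" assume xi: "\<xi> \<in> half_space"
    show "slope q \<beta> 0 integrable_on {fst \<xi>..}" using integrals[of 0 \<xi>] qM xi by simp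
    show "z \<xi> = m + integral {fst \<xi>..} (slope q \<beta> 0)"
      using eq_profile_of_subquadratic[OF a0 _ order_refl m_def _ H[OF xi], of "snd \<xi>"] integrals[of 0 \<xi>] qM xi by simp
  qed
  show "depends_only_on_first z"
  proof (cases "q = 2")
    case True
    thus ?thesis unfolding depends_only_on_first_def using quad2 by (intro exI[of _ "\<lambda>_. enn2real M"]) auto
  next
    case False
    hence q2: "q < 2" using assms by simp
    show ?thesis
    proof (cases "M < \<infinity>")
      case True
      from fin[OF conjI[OF q2 True]] show ?thesis
      proof (elim disjE bexE exE conjE)
        assume "\<forall>\<xi>\<in>half_space. z \<xi> = enn2real M"
        thus ?thesis unfolding depends_only_on_first_def by (intro exI[of _ "\<lambda>_. enn2real M"])
      next
        fix l c assume "\<forall>\<xi>\<in>half_space. slope q \<beta> c integrable_on {fst \<xi>..} \<and> z \<xi> = l + integral {fst \<xi>..} (slope q \<beta> c)"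
        thus ?thesis unfolding depends_only_on_first_def
          by (intro exI[of _ "\<lambda>t. l + integral {t..} (slope q \<beta> c)"]) blast
      qed
    next
      case False
      hence "M = \<infinity>" using Mfin by simp
      then obtain l where "\<forall>\<xi>\<in>half_space. slope q \<beta> 0 integrable_on {fst \<xi>..} \<and> z \<xi> = l + integral {fst \<xi>..} (slope q \<beta> 0)"
        using inf q2 by blast
      thus ?thesis unfolding depends_only_on_first_def
        by (intro exI[of _ "\<lambda>t. l + integral {t..} (slope q \<beta> 0)"]) blast
    qed
  qed
qed

end
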